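(* Let $H$ be a finitely presented cancellative hoop and let $u\in H$ be a unit. Let $e_1,e_2,e_3,\ldots$ be an enumeration without repetitions of all the discrete extremal states of $(H,u)$, listed according to nondecreasing denominators. Then for every $h\in H$ the limit $$m_u(h)=\lim_{k\to\infty}\frac{1}{k}\sum_{t\le k}e_t(h)$$ exists (if there are only finitely many discrete extremal states, say $e_1,\dots,e_r$, this is understood as $m_u(h)=\frac1r\sum_{t\le r}e_t(h)$), it does not depend on the chosen enumeration, and the function $m_u:H\to\mathbb{R}_{\ge0}$ so defined is an automorphism-invariant state on $(H,u)$.
   Context: A cancellative hoop is an algebra $(H,+,\dot-,0)$ such that $(H,+,0)$ is a commutative monoid and $x\dot-x=0$, $(x\dot-y)\dot-z=x\dot-(y+z)$, $x+(y\dot-x)=y+(x\dot-y)$, $(x+y)\dot-y=x$ hold identically; it is partially ordered by $x\le y$ iff $x\dot-y=0$. The basic example is $\mathbb{R}_{\ge0}$ with ordinary addition and $x\dot-y=\max\{0,x-y\}$. Hoop homomorphisms preserve $+,\dot-,0$. $H$ is finitely presented if it is the quotient of a free cancellative hoop on finitely many generators by the congruence generated by finitely many equations. A unit of $H$ is an element $u$ such that for every $h\in H$ there is an integer $k\ge1$ with $h\le ku$. A state on $(H,u)$ is a monoid homomorphism $m:H\to\mathbb{R}_{\ge0}$ (i.e. $m(0)=0$, $m(x+y)=m(x)+m(y)$) with $m(u)=1$. An extremal state is a state which is a hoop homomorphism $H\to\mathbb{R}_{\ge0}$; the set of these is denoted $E_u$. An extremal state $e$ is discrete if $e[H]$ is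 a discrete subset of $\mathbb{R}_{\ge0}$; this happens iff $e[H]=b^{-1}\mathbb{Z}_{\ge0}$ for a unique integer $b\ge1$, called the denominator of $e$. A state $m$ is automorphism-invariant if $m\circ\sigma=m$ for every hoop automorphism $\sigma$ of $H$ with $\sigma(u)=u$.
   Formalization: The hoop H is assumed to be nontrivial (H ≠ {0}); for H = {0} the element 0 is a unit but there are no states, so the average over r = 0 states is undefined and no state m_u exists. *)

theory Defs
  imports "HOL-Analysis.Analysis" "HOL-Algebra.Group"
begin

section \<open>Cancellative hoops\<close>

text \<open>
  Hoops extend the monoid record of HOL-Algebra by truncated subtraction. The monoid
  is written multiplicatively there, so \<open>x \<otimes> y\<close>, \<open>\<one>\<close> and \<open>u [^] k\<close> below stand for the
  hoop operations $x + y$, $0$ and $k u$.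
\<close>

record 'a hoop = "'a monoid" +
  monus :: "['a, 'a] \<Rightarrow> 'a"  (infixl \<open>\<setminus>\<index>\<close> 70)

locale cancellative_hoop = comm_monoid H for H (structure) +
  assumes monus_closed: "\<lbrakk>x \<in> carrier H; y \<in> carrier H\<rbrakk> \<Longrightarrow> x \<setminus> y \<in> carrier H"
    and monus_self: "x \<in> carrier H \<Longrightarrow> x \<setminus> x = \<one>"
    and monus_monus: "\<lbrakk>x \<in> carrier H; y \<in> carrier H; z \<in> carrier H\<rbrakk>
          \<Longrightarrow> (x \<setminus> y) \<setminus> z = x \<setminus> (y \<otimes> z)"
    and divisibility: "\<lbrakk>x \<in> carrier H; y \<in> carrier H\<rbrakk>
          \<Longrightarrow> x \<otimes> (y \<setminus> x) = y \<otimes> (x \<setminus> y)"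
    and cancellation: "\<lbrakk>x \<in> carrier H; y \<in> carrier H\<rbrakk> \<Longrightarrow> (x \<otimes> y) \<setminus> y = x"

definition hoop_le :: "('a, 'b) hoop_scheme \<Rightarrow> 'a \<Rightarrow> 'a \<Rightarrow> bool" where
  "hoop_le H x y \<longleftrightarrow> x \<setminus>\<^bsub>H\<^esub> y = \<one>\<^bsub>H\<^esub>"

definition real_hoop :: "real hoop" where
  "real_hoop = \<lparr>carrier = {0..}, mult = (+), one = 0, monus = (\<lambda>x y. max 0 (x - y))\<rparr>"

definition hoop_hom :: "('a, 'c) hoop_scheme \<Rightarrow> ('b, 'd) hoop_scheme \<Rightarrow> ('a \<Rightarrow> 'b) set" where
  "hoop_hom G H = {f \<in> hom G H. f \<one>\<^bsub>G\<^esub> = \<one>\<^bsub>H\<^esub> \<and>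
     (\<forall>x\<in>carrier G. \<forall>y\<in>carrier G. f (x \<setminus>\<^bsub>G\<^esub> y) = f x \<setminus>\<^bsub>H\<^esub> f y)}"

definition hoop_iso :: "('a, 'c) hoop_scheme \<Rightarrow> ('b, 'd) hoop_scheme \<Rightarrow> ('a \<Rightarrow> 'b) set" where
  "hoop_iso G H = {f \<in> hoop_hom G H. bij_betw f (carrier G) (carrier H)}"

section \<open>Congruences, free hoops and finite presentation\<close>

definition hoop_congruence :: "('a, 'b) hoop_scheme \<Rightarrow> ('a \<times> 'a) set \<Rightarrow> bool" where
  "hoop_congruence A \<theta> \<longleftrightarrow> equiv (carrier A) \<theta> \<and>
     (\<forall>x x' y y'. (x, x') \<in> \<theta> \<longrightarrow> (y, y') \<in> \<theta> \<longrightarrow>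
        (x \<otimes>\<^bsub>A\<^esub> y, x' \<otimes>\<^bsub>A\<^esub> y') \<in> \<theta> \<and> (x \<setminus>\<^bsub>A\<^esub> y, x' \<setminus>\<^bsub>A\<^esub> y') \<in> \<theta>)"

definition generated_congruence ::
    "('a, 'b) hoop_scheme \<Rightarrow> ('a \<times> 'a) set \<Rightarrow> ('a \<times> 'a) set" where
  "generated_congruence A R = \<Inter> {\<theta>. hoop_congruence A \<theta> \<and> R \<subseteq> \<theta>}"

definition quotient_hoop :: "('a, 'b) hoop_scheme \<Rightarrow> ('a \<times> 'a) set \<Rightarrow> 'a set hoop" where
  "quotient_hoop A \<theta> =
    \<lparr>carrier = carrier A // \<theta>,
     mult = (\<lambda>X Y. \<Union>x\<in>X. \<Union>y\<in>Y. \<theta> `` {x \<otimes>\<^bsub>A\<^esub> y}),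
     one = \<theta> `` {\<one>\<^bsub>A\<^esub>},
     monus = (\<lambda>X Y. \<Union>x\<in>X. \<Union>y\<in>Y. \<theta> `` {x \<setminus>\<^bsub>A\<^esub> y})\<rparr>"

datatype (vars: 'x) hoop_term =
    Var 'x
  | Zero
  | Plus "'x hoop_term" "'x hoop_term"
  | Monus "'x hoop_term" "'x hoop_term"

text \<open>The algebra of terms satisfies none of the hoop identities; only its signature matters.\<close>

definition term_hoop :: "'x set \<Rightarrow> 'x hoop_term hoop" where
  "term_hoop X = \<lparr>carrier = {t. vars t \<subseteq> X}, mult = Plus, one = Zero, monus = Monus\<rparr>"

inductive_set hoop_identities :: "'x set \<Rightarrow> ('x hoop_term \<times> 'x hoop_term) set" for X where
  "\<lbrakk>vars r \<subseteq> X; vars s \<subseteq> X; vars t \<subseteq> X\<rbrakk>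
     \<Longrightarrow> (Plus (Plus r s) t, Plus r (Plus s t)) \<in> hoop_identities X"
| "\<lbrakk>vars r \<subseteq> X; vars s \<subseteq> X\<rbrakk> \<Longrightarrow> (Plus r s, Plus s r) \<in> hoop_identities X"
| "vars r \<subseteq> X \<Longrightarrow> (Plus Zero r, r) \<in> hoop_identities X"
| "vars r \<subseteq> X \<Longrightarrow> (Monus r r, Zero) \<in> hoop_identities X"
| "\<lbrakk>vars r \<subseteq> X; vars s \<subseteq> X; vars t \<subseteq> X\<rbrakk>
     \<Longrightarrow> (Monus (Monus r s) t, Monus r (Plus s t)) \<in> hoop_identities X"
| "\<lbrakk>vars r \<subseteq> X; vars s \<subseteq> X\<rbrakk>
     \<Longrightarrow> (Plus r (Monus s r), Plus s (Monus r s)) \<in> hoop_identities X"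
| "\<lbrakk>vars r \<subseteq> X; vars s \<subseteq> X\<rbrakk> \<Longrightarrow> (Monus (Plus r s) s, r) \<in> hoop_identities X"

definition free_hoop :: "'x set \<Rightarrow> 'x hoop_term set hoop" where
  "free_hoop X =
     quotient_hoop (term_hoop X) (generated_congruence (term_hoop X) (hoop_identities X))"

definition finitely_presented :: "('a, 'b) hoop_scheme \<Rightarrow> bool" where
  "finitely_presented H \<longleftrightarrow>
    (\<exists>(n::nat) R. finite R \<and> R \<subseteq> carrier (free_hoop {..<n}) \<times> carrier (free_hoop {..<n}) \<and>
       hoop_iso (quotient_hoop (free_hoop {..<n}) (generated_congruence (free_hoop {..<n}) R)) H
         \<noteq> {})"

section \<open>Units and states\<close>

definition hoop_unit :: "('a, 'b) hoop_scheme \<Rightarrow> 'a \<Rightarrow> bool" where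
  "hoop_unit H u \<longleftrightarrow>
     u \<in> carrier H \<and> (\<forall>h\<in>carrier H. \<exists>k::nat. k \<ge> 1 \<and> hoop_le H h (u [^]\<^bsub>H\<^esub> k))"

text \<open>
  States are taken to be extensional (\<open>undefined\<close> outside the carrier), so that equality
  of states, and hence an enumeration of them without repetitions, has its usual meaning.
\<close>

definition states :: "('a, 'b) hoop_scheme \<Rightarrow> 'a \<Rightarrow> ('a \<Rightarrow> real) set" where
  "states H u = {m \<in> hom H real_hoop. m \<in> extensional (carrier H) \<and> m \<one>\<^bsub>H\<^esub> = 0 \<and> m u = 1}"

definition extremal_states :: "('a, 'b) hoop_scheme \<Rightarrow> 'a \<Rightarrow> ('a \<Rightarrow> real) set" where
  "extremal_states H u = states H u \<inter> hoop_hom H real_hoop"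

definition discrete_states :: "('a, 'b) hoop_scheme \<Rightarrow> 'a \<Rightarrow> ('a \<Rightarrow> real) set" where
  "discrete_states H u = {e \<in> extremal_states H u. discrete (e ` carrier H)}"

definition denominator :: "('a, 'b) hoop_scheme \<Rightarrow> ('a \<Rightarrow> real) \<Rightarrow> nat" where
  "denominator H e = (THE b. b \<ge> 1 \<and> e ` carrier H = range (\<lambda>n::nat. real n / real b))"

definition automorphism_invariant ::
    "('a, 'b) hoop_scheme \<Rightarrow> 'a \<Rightarrow> ('a \<Rightarrow> real) \<Rightarrow> bool" where
  "automorphism_invariant H u m \<longleftrightarrow>
     (\<forall>\<sigma>\<in>hoop_iso H H. \<sigma> u = u \<longrightarrow> (\<forall>h\<in>carrier H. m (\<sigma> h) = m h))"

section \<open>Enumerations and Cesaro means\<close>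

definition index_set :: "'s set \<Rightarrow> nat set" where
  "index_set D = (if finite D then {1..card D} else {1..})"

definition denominator_enumeration ::
    "('a, 'b) hoop_scheme \<Rightarrow> 'a \<Rightarrow> (nat \<Rightarrow> 'a \<Rightarrow> real) \<Rightarrow> bool" where
  "denominator_enumeration H u e \<longleftrightarrow>
     bij_betw e (index_set (discrete_states H u)) (discrete_states H u) \<and>
     mono_on (index_set (discrete_states H u)) (\<lambda>t. denominator H (e t))"

text \<open>\<open>l\<close> is the value at \<open>h\<close> of the Cesaro mean of the enumerated discrete states; if there
  are only finitely many of them, this is their plain average.\<close>

definition has_mean ::
    "('a, 'b) hoop_scheme \<Rightarrow> 'a \<Rightarrow> (nat \<Rightarrow> 'a \<Rightarrow> real) \<Rightarrow> 'a \<Rightarrow> real \<Rightarrow> bool" where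
  "has_mean H u e h l \<longleftrightarrow>
     (if finite (discrete_states H u)
      then l = (\<Sum>t=1..card (discrete_states H u). e t h) / real (card (discrete_states H u))
      else (\<lambda>k. (\<Sum>t=1..k. e t h) / real k) \<longlonglongrightarrow> l)"

end

theory Submission
  imports Defs
begin

text \<open>
  Choosing a presentation of \<open>H\<close> with \<open>n\<close> generators identifies the extremal states of \<open>(H, u)\<close> with
  the points at which \<open>u\<close> takes the value \<open>1\<close> in a closed polyhedral cone \<open>W\<close> of the nonnegative
  orthant, cut out by the relations; elements of \<open>H\<close> become homogeneous piecewise linear functions on
  \<open>W\<close> with integral coefficients. The discrete states correspond to the primitive integer vectors
  \<open>p \<in> W\<close>: the state of \<open>p\<close> maps \<open>h\<close> to \<open>h(p) / u(p)\<close> and has denominator \<open>u(p)\<close>. Blow-ups partition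
  \<open>W\<close> into relatively open unimodular cones on which \<open>u\<close> and \<open>h\<close> are linear. In a cone with \<open>d\<close> generators the
  integer points with \<open>u \<le> T\<close> number asymptotically a constant times \<open>T ^ d\<close>, and \<open>h / u\<close> summed over
  them has the same order of growth. Passing from all integer points to the primitive ones divides the
  leading coefficients by \<open>\<zeta>(d)\<close>, where \<open>d \<ge> 2\<close> as soon as there are infinitely many primitive points. The
  quotient of the two leading coefficients is the limit of the Cesaro means for every enumeration, and
  invariance follows because an automorphism fixing \<open>u\<close> turns one enumeration into another.

  Nonzero points of \<open>W\<close> exist because an ideal maximal among those avoiding \<open>u\<close> has an Archimedean
  totally ordered quotient, which embeds into the reals by Hoelder's construction.
\<close>

section \<open>Asymptotics of sums\<close>

text \<open>Only leading orders matter, so no volumes are computed: counts in a cone come from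
  one-variable limits, adding one generator at a time. The quotient \<open>h / u\<close> is not
  linear on cones while \<open>h\<close> is. Hence \<open>h\<close> is summed first, one power of
  \<open>T\<close> higher, and Abel summation over the levels of \<open>u\<close> then divides by
  \<open>u\<close>. Blow-ups of single edges suffice because they keep unimodularity, which
  identifies integer points of a cone with positive integer tuples, and because finitely many of
  them make an integral form sign-constant on every piece. The case \<open>d = 1\<close> has to be
  excluded since \<zeta>(1) diverges; a unimodular ray contains just one primitive point, so rays
  alone give only finitely many. An enumeration may order the states of equal denominator
  arbitrarily, and a Cesaro mean may stop inside such a level; as cumulative counts grow like a
  power of \<open>T\<close>, a whole level is negligible against all earlier ones. A nonzero point
  of \<open>W\<close> is indispensable: without it there are no states, and the empty average
  \<open>0 / 0\<close> is not normalised at \<open>u\<close>.\<close>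

lemma stolz_cesaro:
  fixes a b :: "nat \<Rightarrow> real"
  assumes inc: "\<And>n. b n < b (Suc n)"
    and lim: "filterlim b at_top sequentially"
    and quot: "(\<lambda>n. (a (Suc n) - a n) / (b (Suc n) - b n)) \<longlonglongrightarrow> l"
  shows "(\<lambda>n. a n / b n) \<longlonglongrightarrow> l"
proof (rule LIMSEQ_I)
  fix r :: real assume r: "r > 0"
  \<comment> \<open>Subtracting \<open>l * b\<close> reduces the claim to \<open>c = o(b)\<close>:
    eventually each increment of \<open>c\<close> is at most \<open>r / 2\<close> times that of
    \<open>b\<close>, and these bounds telescope.\<close>
  define c where "c n = a n - l * b n" for n
  obtain N where N: "\<And>n. n \<ge> N \<Longrightarrow> \<bar>(a (Suc n) - a n) / (b (Suc n) - b n) - l\<bar> < r / 2"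
    using LIMSEQ_D[OF quot, of "r/2"] r by auto
  have diff_step: "\<bar>c (Suc n) - c n\<bar> \<le> r / 2 * (b (Suc n) - b n)" if "n \<ge> N" for n
  proof -
    have p: "b (Suc n) - b n > 0" using inc[of n] by simp
    have "c (Suc n) - c n = ((a (Suc n) - a n) / (b (Suc n) - b n) - l) * (b (Suc n) - b n)"
      using p by (simp add: c_def field_simps)
    then have "\<bar>c (Suc n) - c n\<bar>
        = \<bar>(a (Suc n) - a n) / (b (Suc n) - b n) - l\<bar> * (b (Suc n) - b n)"
      using p by (simp add: abs_mult)
    then show ?thesis using N[OF that] p by (simp add: mult_right_mono)
  qed
  have tele: "\<bar>c n - c N\<bar> \<le> r / 2 * (b n - b N)" if "n \<ge> N" for n
    using that
  proof (induction n rule: dec_induct)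
    case (step n)
    have "\<bar>c (Suc n) - c N\<bar> \<le> \<bar>c (Suc n) - c n\<bar> + \<bar>c n - c N\<bar>" by linarith
    also have "\<dots> \<le> r / 2 * (b (Suc n) - b n) + r / 2 * (b n - b N)"
      using step.IH step.hyps diff_step by (intro add_mono) auto
    also have "\<dots> = r / 2 * (b (Suc n) - b N)" by (simp add: field_simps)
    finally show ?case .
  qed simp
  \<comment> \<open>Beyond this threshold the constant part of the telescoped bound is below
    \<open>r / 4 * b n\<close>, so the total stays below \<open>r * b n\<close>.\<close>
  have "eventually (\<lambda>n. b n > max 1 (4 * (\<bar>c N\<bar> + r / 2 * \<bar>b N\<bar>) / r)) sequentially"
    using lim filterlim_at_top_dense by blast
  then obtain M where M: "\<And>n. n \<ge> M \<Longrightarrow> b n > max 1 (4 * (\<bar>c N\<bar> + r / 2 * \<bar>b N\<bar>) / r)"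
    unfolding eventually_sequentially by auto
  show "\<exists>no. \<forall>n\<ge>no. norm (a n / b n - l) < r"
  proof (intro exI allI impI)
    fix n assume n: "n \<ge> max M N"
    have b: "b n > 1" "4 * (\<bar>c N\<bar> + r / 2 * \<bar>b N\<bar>) / r < b n" using M[of n] n by auto
    have "\<bar>c n\<bar> \<le> \<bar>c N\<bar> + r / 2 * \<bar>b N\<bar> + r / 2 * b n"
    proof -
      have "\<bar>c n - c N\<bar> \<le> r / 2 * (b n - b N)" using tele[of n] n by simp
      also have "\<dots> = r / 2 * b n + r / 2 * (- b N)" by (simp add: field_simps)
      also have "\<dots> \<le> r / 2 * b n + r / 2 * \<bar>b N\<bar>"
        using r by (intro add_left_mono mult_left_mono) auto
      finally show ?thesis by linarith
    qed
    moreover have "\<bar>c N\<bar> + r / 2 * \<bar>b N\<bar> < r / 4 * b n"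
      using b(2) r by (simp add: field_simps)
    moreover have "r * b n > 0" using r b by simp
    ultimately have "\<bar>c n\<bar> < r * b n" by linarith
    moreover have "a n / b n - l = c n / b n" using b by (simp add: c_def field_simps)
    moreover have "\<bar>c n / b n\<bar> = \<bar>c n\<bar> / b n" using b(1) by (simp add: abs_divide)
    ultimately show "norm (a n / b n - l) < r"
      using b(1) by (simp only: real_norm_def) (simp add: pos_divide_less_eq)
  qed
qed

text \<open>Stolz-Cesaro against \<open>q ^ Suc k\<close>, whose increments are asymptotic to
  \<open>Suc k * q ^ k\<close>.\<close>

lemma sum_asymp_power:
  fixes x :: "nat \<Rightarrow> real"
  assumes "(\<lambda>j. x j / real j ^ k) \<longlonglongrightarrow> C"
  shows "(\<lambda>q. (\<Sum>j<q. x j) / real q ^ Suc k) \<longlonglongrightarrow> C / real (Suc k)"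
proof (rule stolz_cesaro)
  show "real n ^ Suc k < real (Suc n) ^ Suc k" for n
    by (rule power_strict_mono) auto
  show "filterlim (\<lambda>n. real n ^ Suc k) at_top sequentially"
    by (intro filterlim_pow_at_top filterlim_real_sequentially) auto
  \<comment> \<open>The increment of \<open>n ^ Suc k\<close> divided by \<open>n ^ k\<close> is the
    difference quotient of \<open>y ^ Suc k\<close> at 1 with step \<open>1 / n\<close>, hence tends
    to the derivative there.\<close>
  have d: "(\<lambda>n. (((1 + inverse (real n)) ^ Suc k - 1) / inverse (real n))) \<longlonglongrightarrow> real (Suc k)"
  proof -
    have "((\<lambda>y::real. y ^ Suc k) has_field_derivative real (Suc k)) (at 1)"
      by (auto intro!: derivative_eq_intros simp del: power_Suc)
    then have "((\<lambda>h::real. ((1 + h) ^ Suc k - 1) / h) \<longlongrightarrow> real (Suc k)) (at 0)"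
      unfolding DERIV_def by simp
    moreover have "filterlim (\<lambda>n. inverse (real n)) (at 0) sequentially"
      unfolding filterlim_at using LIMSEQ_inverse_real_of_nat
      by (auto intro!: eventually_sequentiallyI[of 1] lim_inverse_n)
    ultimately show ?thesis by (rule filterlim_compose)
  qed
  have "(\<lambda>n. x n / real n ^ k / (((1 + inverse (real n)) ^ Suc k - 1) / inverse (real n)))
      \<longlonglongrightarrow> C / real (Suc k)"
    by (intro tendsto_divide assms d) auto
  then show "(\<lambda>n. ((\<Sum>j<Suc n. x j) - (\<Sum>j<n. x j)) / (real (Suc n) ^ Suc k - real n ^ Suc k))
      \<longlonglongrightarrow> C / real (Suc k)"
  proof (rule Lim_transform_eventually)
    show "\<forall>\<^sub>F n in sequentially. x n / real n ^ k / (((1 + inverse (real n)) ^ Suc k - 1) / inverse (real n))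
        = ((\<Sum>j<Suc n. x j) - (\<Sum>j<n. x j)) / (real (Suc n) ^ Suc k - real n ^ Suc k)"
    proof (rule eventually_sequentiallyI[of 1])
      fix n :: nat assume n: "n \<ge> 1"
      have "real (Suc n) = real n * (1 + inverse (real n))" using n by (simp add: field_simps)
      then have "real (Suc n) ^ Suc k - real n ^ Suc k
          = real n ^ Suc k * ((1 + inverse (real n)) ^ Suc k - 1)"
        by (simp only: power_mult_distrib right_diff_distrib mult_1_right)
      then have "real (Suc n) ^ Suc k - real n ^ Suc k
          = real n ^ k * (((1 + inverse (real n)) ^ Suc k - 1) / inverse (real n))"
        by (simp add: divide_inverse)
      then show "x n / real n ^ k / (((1 + inverse (real n)) ^ Suc k - 1) / inverse (real n))
        = ((\<Sum>j<Suc n. x j) - (\<Sum>j<n. x j)) / (real (Suc n) ^ Suc k - real n ^ Suc k)"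
        by simp
    qed
  qed
qed

text \<open>Serves to evaluate \<open>T div a\<close> exactly: on a residue class modulo
  \<open>a\<close> it is the running index \<open>q\<close>.\<close>

lemma LIMSEQ_residues:
  fixes f :: "nat \<Rightarrow> real"
  assumes a: "a > 0" and lim: "\<And>r. r < a \<Longrightarrow> (\<lambda>q. f (a * q + r)) \<longlonglongrightarrow> l"
  shows "f \<longlonglongrightarrow> l"
proof (rule LIMSEQ_I)
  fix e :: real assume e: "e > 0"
  have "\<forall>r\<in>{..<a}. eventually (\<lambda>q. norm (f (a * q + r) - l) < e) sequentially"
    using lim e unfolding tendsto_iff dist_norm by auto
  then have "eventually (\<lambda>q. \<forall>r\<in>{..<a}. norm (f (a * q + r) - l) < e) sequentially"
    by (intro eventually_ball_finite) auto
  then obtain Q where Q: "\<And>q r. q \<ge> Q \<Longrightarrow> r < a \<Longrightarrow> norm (f (a * q + r) - l) < e"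
    unfolding eventually_sequentially by auto
  show "\<exists>no. \<forall>n\<ge>no. norm (f n - l) < e"
  proof (intro exI allI impI)
    fix n assume "n \<ge> a * Q"
    then have "n div a \<ge> Q" using a
      by (metis div_le_mono nonzero_mult_div_cancel_left not_gr_zero)
    then show "norm (f n - l) < e" using Q[of "n div a" "n mod a"] a by simp
  qed
qed

lemma affine_power_quotient_tendsto:
  assumes "a > 0"
  shows "(\<lambda>q. (real (a * q + r) / real q) ^ k) \<longlonglongrightarrow> real a ^ k"
proof -
  have "(\<lambda>q. real a + real r * inverse (real q)) \<longlonglongrightarrow> real a + real r * 0"
    by (intro tendsto_intros lim_inverse_n)
  then have "(\<lambda>q. real (a * q + r) / real q) \<longlonglongrightarrow> real a"
    unfolding mult_zero_right add_0_right
    by (rule Lim_transform_eventually)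
       (auto intro!: eventually_sequentiallyI[of 1] simp: field_simps)
  then show ?thesis by (rule tendsto_power)
qed

text \<open>For \<open>T = a * q + r\<close> the arguments of \<open>N\<close> are the numbers
  \<open>a * j + r\<close> with \<open>j < q\<close>. Their contribution is about
  \<open>C * a ^ k * q ^ Suc k / Suc k\<close>, to be divided by
  \<open>(a * q) ^ Suc k\<close>.\<close>

lemma sum_progression_asymp:
  fixes N :: "nat \<Rightarrow> real"
  assumes a: "a > 0" and N: "(\<lambda>T. N T / real T ^ k) \<longlonglongrightarrow> C"
  shows "(\<lambda>T. (\<Sum>m=1..T div a. N (T - a * m)) / real T ^ Suc k) \<longlonglongrightarrow> C / (real a * real (Suc k))"
proof (rule LIMSEQ_residues[OF a])
  fix r assume r: "r < a"
  have sub: "(\<lambda>j. N (a * j + r) / real (a * j + r) ^ k) \<longlonglongrightarrow> C"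
    using N by (rule filterlim_compose[of "\<lambda>T. N T / real T ^ k"])
      (use a in \<open>auto intro!: filterlim_subseq strict_monoI\<close>)
  have lim: "(\<lambda>j. N (a * j + r) / real (a * j + r) ^ k * (real (a * j + r) / real j) ^ k)
      \<longlonglongrightarrow> C * real a ^ k"
    by (intro tendsto_mult sub affine_power_quotient_tendsto a)
  have cancel: "x / p ^ k * (p / y) ^ k = x / y ^ k" if "p \<noteq> 0" for x p y :: real
    using that by (simp add: power_divide)
  from lim have "(\<lambda>j. N (a * j + r) / real j ^ k) \<longlonglongrightarrow> C * real a ^ k"
  proof (rule Lim_transform_eventually, intro eventually_sequentiallyI[of 1])
    fix j :: nat assume "j \<ge> 1"
    then have "a * j + r \<noteq> 0" using a by simp
    then have "real (a * j + r) \<noteq> 0" by linarith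
    then show "N (a * j + r) / real (a * j + r) ^ k * (real (a * j + r) / real j) ^ k
        = N (a * j + r) / real j ^ k"
      by (rule cancel)
  qed
  then have "(\<lambda>q. (\<Sum>j<q. N (a * j + r)) / real q ^ Suc k) \<longlonglongrightarrow> C * real a ^ k / real (Suc k)"
    by (rule sum_asymp_power)
  from tendsto_divide[OF this affine_power_quotient_tendsto[OF a, of r "Suc k"]]
  have "(\<lambda>q. (\<Sum>j<q. N (a * j + r)) / real q ^ Suc k / (real (a * q + r) / real q) ^ Suc k)
      \<longlonglongrightarrow> C * real a ^ k / real (Suc k) / real a ^ Suc k"
    using a by (simp del: power_Suc of_nat_Suc)
  also have "C * real a ^ k / real (Suc k) / real a ^ Suc k = C / (real a * real (Suc k))"
    using a by (simp add: divide_divide_eq_left del: of_nat_Suc)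
  finally show "(\<lambda>q. (\<Sum>m=1..(a * q + r) div a. N (a * q + r - a * m)) / real (a * q + r) ^ Suc k)
      \<longlonglongrightarrow> C / (real a * real (Suc k))"
  proof (rule Lim_transform_eventually)
    show "\<forall>\<^sub>F q in sequentially.
      (\<Sum>j<q. N (a * j + r)) / real q ^ Suc k / (real (a * q + r) / real q) ^ Suc k =
      (\<Sum>m=1..(a * q + r) div a. N (a * q + r - a * m)) / real (a * q + r) ^ Suc k"
    proof (rule eventually_sequentiallyI[of 1])
      fix q :: nat assume q: "q \<ge> 1"
      have "(\<Sum>m=1..(a * q + r) div a. N (a * q + r - a * m)) = (\<Sum>m=1..q. N (a * (q - m) + r))"
        using r by (intro sum.cong) (auto simp: algebra_simps diff_mult_distrib2)
      also have "\<dots> = (\<Sum>j<q. N (a * j + r))"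
        by (rule sum.reindex_bij_witness[of _ "\<lambda>j. q - j" "\<lambda>m. q - m"]) auto
      finally show "(\<Sum>j<q. N (a * j + r)) / real q ^ Suc k / (real (a * q + r) / real q) ^ Suc k =
      (\<Sum>m=1..(a * q + r) div a. N (a * q + r - a * m)) / real (a * q + r) ^ Suc k"
        using q by (simp add: power_divide del: power_Suc)
    qed
  qed
qed

text \<open>Summation by parts with \<open>1 / b - 1 / Suc b = 1 / (b * Suc b)\<close>: the boundary
  term contributes \<open>C\<close>, and the weighted partial sums, of size
  \<open>C * b ^ k\<close>, contribute \<open>C / Suc k\<close>.\<close>

lemma abel_summation_asymp:
  fixes g :: "nat \<Rightarrow> real"
  assumes G: "(\<lambda>T. (\<Sum>b=1..T. g b) / real T ^ Suc (Suc k)) \<longlonglongrightarrow> C"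
  shows "(\<lambda>T. (\<Sum>b=1..T. g b / real b) / real T ^ Suc k) \<longlonglongrightarrow> C + C / real (Suc k)"
proof -
  define S where "S T = (\<Sum>b=1..T. g b)" for T
  \<comment> \<open>The summand at \<open>b = 0\<close> is harmless: \<open>S 0\<close> is an empty
    sum and division by zero yields 0.\<close>
  have abel: "(\<Sum>b=1..T. g b / real b) = S T / real (Suc T) + (\<Sum>b<Suc T. S b / (real b * real (Suc b)))"
    for T
  proof (induction T)
    case (Suc T)
    have "S (Suc T) = S T + g (Suc T)" by (simp add: S_def)
    then show ?case using Suc
      by (simp add: field_simps del: of_nat_Suc) (simp add: algebra_simps)
  qed (simp add: S_def)
  have SG: "(\<lambda>T. S T / real T ^ Suc (Suc k)) \<longlonglongrightarrow> C" using G by (simp add: S_def)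
  have q1: "(\<lambda>n. real n / real (Suc n)) \<longlonglongrightarrow> 1" by (rule LIMSEQ_n_over_Suc_n)
  have q2: "(\<lambda>n. real (Suc n) / real n) \<longlonglongrightarrow> 1" by (rule LIMSEQ_Suc_n_over_n)
  have a1: "(\<lambda>T. S T / real (Suc T) / real T ^ Suc k) \<longlonglongrightarrow> C"
  proof (rule Lim_transform_eventually)
    show "(\<lambda>T. S T / real T ^ Suc (Suc k) * (real T / real (Suc T))) \<longlonglongrightarrow> C"
      using tendsto_mult[OF SG q1] by simp
  qed (auto intro!: eventually_sequentiallyI[of 1] simp: divide_simps)
  have "(\<lambda>b. S b / (real b * real (Suc b)) / real b ^ k) \<longlonglongrightarrow> C"
  proof (rule Lim_transform_eventually)
    show "(\<lambda>T. S T / real T ^ Suc (Suc k) * (real T / real (Suc T))) \<longlonglongrightarrow> C"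
      using tendsto_mult[OF SG q1] by simp
  qed (auto intro!: eventually_sequentiallyI[of 1] simp: divide_simps)
  then have "(\<lambda>q. (\<Sum>b<q. S b / (real b * real (Suc b))) / real q ^ Suc k) \<longlonglongrightarrow> C / real (Suc k)"
    by (rule sum_asymp_power)
  then have "(\<lambda>T. (\<Sum>b<Suc T. S b / (real b * real (Suc b))) / real (Suc T) ^ Suc k) \<longlonglongrightarrow> C / real (Suc k)"
    by (rule LIMSEQ_Suc)
  then have "(\<lambda>T. (\<Sum>b<Suc T. S b / (real b * real (Suc b))) / real (Suc T) ^ Suc k
      * (real (Suc T) / real T) ^ Suc k) \<longlonglongrightarrow> C / real (Suc k) * 1 ^ Suc k"
    by (intro tendsto_mult tendsto_power q2)
  then have "(\<lambda>T. (\<Sum>b<Suc T. S b / (real b * real (Suc b))) / real T ^ Suc k) \<longlonglongrightarrow> C / real (Suc k)"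
    by (simp add: power_divide del: power_Suc of_nat_Suc sum.lessThan_Suc)
  from tendsto_add[OF a1 this] show ?thesis
    unfolding abel by (simp add: add_divide_distrib del: power_Suc of_nat_Suc sum.lessThan_Suc)
qed


section \<open>Divisor sums and division by zeta values\<close>

text \<open>\<open>3 / 4\<close> is \<open>1 / 4\<close> for \<open>k = 2\<close> plus
  \<open>1 / 2\<close> for the telescoping bound of the tail. What counts is that it is below
  1.\<close>

lemma sum_inverse_power_le:
  assumes d: "d \<ge> 2"
  shows "(\<Sum>k=2..T. 1 / real k ^ d) \<le> 3 / 4"
proof -
  \<comment> \<open>The correction \<open>- 1 / real T\<close> carries the induction: it changes by
    \<open>1 / T - 1 / Suc T\<close>, at least the new term. At \<open>T = 2\<close> there is
    equality.\<close>
  have sq: "(\<Sum>k=2..T. 1 / real k ^ 2) \<le> 3 / 4 - 1 / real T" if "T \<ge> 2" for T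
    using that
  proof (induction T rule: dec_induct)
    case (step T)
    have "1 / real (Suc T) ^ 2 \<le> 1 / real T - 1 / real (Suc T)"
    proof -
      have "1 / real (Suc T) ^ 2 \<le> 1 / (real T * real (Suc T))"
        using step.hyps unfolding power2_eq_square
        by (intro divide_left_mono mult_right_mono) auto
      also have "\<dots> = 1 / real T - 1 / real (Suc T)"
        using step.hyps by (simp add: field_simps)
      finally show ?thesis .
    qed
    then show ?case using step.IH step.hyps by simp
  qed (simp add: power2_eq_square)
  show ?thesis
  proof (cases "T \<ge> 2")
    case True
    have "(\<Sum>k=2..T. 1 / real k ^ d) \<le> (\<Sum>k=2..T. 1 / real k ^ 2)"
      using d by (intro sum_mono divide_left_mono power_increasing) auto
    also have "\<dots> \<le> 3 / 4 - 1 / real T" by (rule sq[OF True])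
    also have "\<dots> \<le> 3 / 4" by simp
    finally show ?thesis .
  qed simp
qed

lemma summable_inverse_Suc_power:
  "d \<ge> 2 \<Longrightarrow> summable (\<lambda>k. 1 / real (Suc k) ^ d)"
  using inverse_power_summable[of d, where ?'a = real]
  by (subst summable_Suc_iff) (simp add: field_simps)

text \<open>Tannery's theorem: each term tends to \<open>1 / k ^ d\<close> and is dominated by it,
  uniformly in \<open>T\<close>.\<close>

lemma sum_div_power_tendsto:
  assumes d: "d \<ge> 2"
  shows "(\<lambda>T. \<Sum>k=1..T. (real (T div k) / real T) ^ d) \<longlonglongrightarrow> (\<Sum>k. 1 / real (Suc k) ^ d)"
proof -
  define a where "a k T = (real (T div Suc k) / real T) ^ d" for k T :: nat
  note M = summable_inverse_Suc_power[OF d]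
  have lim: "(\<lambda>T. a k T) \<longlonglongrightarrow> 1 / real (Suc k) ^ d" for k
  proof -
    have "(\<lambda>T. real (T div Suc k) / real T) \<longlonglongrightarrow> 1 / real (Suc k)"
    proof (rule tendsto_sandwich)
      show "(\<lambda>T. 1 / real (Suc k) - inverse (real T)) \<longlonglongrightarrow> 1 / real (Suc k)"
        using tendsto_diff[OF tendsto_const lim_inverse_n, of "1 / real (Suc k)"] by simp
      have "1 / real (Suc k) - inverse (real T) \<le> real (T div Suc k) / real T"
        if "T \<ge> 1" for T
      proof -
        have "real T - real (Suc k) \<le> real (Suc k) * real (T div Suc k)"
        proof -
          have "T \<le> Suc k * (T div Suc k) + Suc k"
            by (metis add_left_mono less_imp_le_nat mod_less_divisor mult_div_mod_eq zero_less_Suc)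
          then have "real T \<le> real (Suc k * (T div Suc k) + Suc k)" by (rule of_nat_mono)
          then show ?thesis by (simp only: of_nat_add of_nat_mult diff_le_eq)
        qed
        then have "(real T - real (Suc k)) / (real (Suc k) * real T)
            \<le> real (Suc k) * real (T div Suc k) / (real (Suc k) * real T)"
          by (intro divide_right_mono) auto
        moreover have "(real T - real (Suc k)) / (real (Suc k) * real T) = 1 / real (Suc k) - inverse (real T)"
          using that by (simp add: diff_divide_distrib inverse_eq_divide del: of_nat_Suc)
        moreover have "real (Suc k) * real (T div Suc k) / (real (Suc k) * real T) = real (T div Suc k) / real T"
          by (simp del: of_nat_Suc)
        ultimately show ?thesis by simp
      qed
      then show "\<forall>\<^sub>F T in sequentially. 1 / real (Suc k) - inverse (real T) \<le> real (T div Suc k) / real T"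
        by (rule eventually_sequentiallyI)
      have "real (T div Suc k) / real T \<le> 1 / real (Suc k)" for T
      proof -
        have "real (Suc k * (T div Suc k)) \<le> real T" by (intro of_nat_mono times_div_less_eq_dividend)
        then show ?thesis by (cases "T = 0") (simp_all add: field_simps)
      qed
      then show "\<forall>\<^sub>F T in sequentially. real (T div Suc k) / real T \<le> 1 / real (Suc k)"
        by simp
    qed simp
    from tendsto_power[OF this, of d] show ?thesis by (simp add: a_def power_divide)
  qed
  have bound: "norm (a k T) \<le> 1 / real (Suc k) ^ d" for k T
  proof -
    have "real (T div Suc k) / real T \<le> 1 / real (Suc k)"
    proof -
      have "real (Suc k * (T div Suc k)) \<le> real T" by (intro of_nat_mono times_div_less_eq_dividend)
      then show ?thesis by (cases "T = 0") (simp_all add: field_simps)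
    qed
    then have "a k T \<le> (1 / real (Suc k)) ^ d" unfolding a_def by (intro power_mono) auto
    then show ?thesis by (simp add: a_def power_divide)
  qed
  have "(\<lambda>T. \<Sum>k. a k T) \<longlonglongrightarrow> (\<Sum>k. 1 / real (Suc k) ^ d)"
    using tannerys_theorem[OF lim _ M] bound by (auto simp: always_eventually)
  moreover have "(\<Sum>k. a k T) = (\<Sum>k=1..T. (real (T div k) / real T) ^ d)" for T
  proof -
    have "(\<Sum>k. a k T) = (\<Sum>k<T. a k T)"
      using d by (intro suminf_finite) (auto simp: a_def)
    also have "\<dots> = (\<Sum>k=1..T. (real (T div k) / real T) ^ d)"
      unfolding a_def
      by (rule sum.reindex_bij_witness[of _ "\<lambda>k. k - 1" Suc]) auto
    finally show ?thesis .
  qed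
  ultimately show ?thesis by simp
qed

text \<open>A contraction argument replaces Moebius inversion here: the terms \<open>k \<ge> 2\<close> of the divisor sum
  contribute at most \<open>\<zeta>(d) - 1 \<le> 3/4\<close> times the current bound on \<open>B\<close>.\<close>

lemma divisor_sum_small_o:
  fixes B :: "nat \<Rightarrow> real"
  assumes d: "d \<ge> 2"
    and bound: "\<And>T. \<bar>B T\<bar> \<le> K * real T ^ d"
    and R: "(\<lambda>T. (\<Sum>k=1..T. B (T div k)) / real T ^ d) \<longlonglongrightarrow> 0"
  shows "(\<lambda>T. B T / real T ^ d) \<longlonglongrightarrow> 0"
proof -
  define K' where "K' = max 1 K"
  have K': "K' > 0" "\<bar>B T\<bar> \<le> K' * real T ^ d" for T
    using order_trans[OF bound[of T] mult_right_mono[of K K']] by (auto simp: K'_def)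
  \<comment> \<open>\<open>4/5\<close> is \<open>3/4 + 1/40 + 1/40\<close>: the terms
    \<open>k \<ge> 2\<close>, the given divisor sum, and the terms with argument below
    \<open>T0\<close>.\<close>
  have contract: "eventually (\<lambda>T. \<bar>B T\<bar> \<le> 4/5 * M * real T ^ d) sequentially"
    if M: "M > 0" and ev: "eventually (\<lambda>T. \<bar>B T\<bar> \<le> M * real T ^ d) sequentially" for M
  proof -
    obtain T0 where T0: "\<And>T. T \<ge> T0 \<Longrightarrow> \<bar>B T\<bar> \<le> M * real T ^ d"
      using ev unfolding eventually_sequentially by auto
    \<comment> \<open>A uniform bound on the terms with \<open>T div k < T0\<close>. Fewer than
      \<open>T\<close> of them occur, and \<open>T * D\<close> is small against \<open>T ^ d\<close>
      because \<open>d \<ge> 2\<close>.\<close>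
    define D where "D = K' * real T0 ^ d"
    have D: "D \<ge> 0" using K' by (simp add: D_def)
    have e1: "eventually (\<lambda>T. \<bar>\<Sum>k=1..T. B (T div k)\<bar> / real T ^ d < M / 40) sequentially"
      using tendstoD[OF R, of "M/40"] M by (simp add: dist_norm abs_divide)
    have "(\<lambda>T. D * inverse (real T)) \<longlonglongrightarrow> D * 0"
      by (intro tendsto_intros lim_inverse_n)
    then have e2: "eventually (\<lambda>T. D * inverse (real T) < M / 40) sequentially"
      using M by (intro order_tendstoD) auto
    show ?thesis
      using e1 e2 eventually_ge_at_top[of 1]
    proof eventually_elim
      case (elim T)
      have Tpos: "real T ^ d > 0" using elim by simp
      have each: "\<bar>B (T div k)\<bar> \<le> M * real T ^ d * (1 / real k ^ d) + D" if "k \<in> {2..T}" for k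
      proof (cases "T div k \<ge> T0")
        case True
        have "real (k * (T div k)) \<le> real T" by (intro of_nat_mono times_div_less_eq_dividend)
        then have "real (T div k) \<le> real T / real k" using that by (simp add: field_simps)
        then have "real (T div k) ^ d \<le> (real T / real k) ^ d" by (intro power_mono) auto
        then have "M * real (T div k) ^ d \<le> M * (real T / real k) ^ d"
          using M by (intro mult_left_mono) auto
        then show ?thesis using T0[OF True] D by (simp add: power_divide)
      next
        case False
        have "\<bar>B (T div k)\<bar> \<le> K' * real (T div k) ^ d" by (rule K')
        also have "\<dots> \<le> D" unfolding D_def
          using False K' by (intro mult_left_mono power_mono) auto
        finally show ?thesis using M by (simp add: add_increasing)
      qed
      have "(\<Sum>k=1..T. B (T div k)) = B T + (\<Sum>k=2..T. B (T div k))"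
        using elim by (subst sum.atLeast_Suc_atMost) (auto simp: numeral_2_eq_2)
      then have "\<bar>B T\<bar> \<le> \<bar>\<Sum>k=1..T. B (T div k)\<bar> + \<bar>\<Sum>k=2..T. B (T div k)\<bar>" by linarith
      also have "\<bar>\<Sum>k=2..T. B (T div k)\<bar> \<le> (\<Sum>k=2..T. M * real T ^ d * (1 / real k ^ d) + D)"
        by (rule order_trans[OF sum_abs sum_mono]) (rule each)
      also have "\<dots> = M * real T ^ d * (\<Sum>k=2..T. 1 / real k ^ d) + real (T - 1) * D"
        by (simp add: sum.distrib sum_distrib_left)
      also have "\<dots> \<le> M * real T ^ d * (3 / 4) + real T * D"
        using M D sum_inverse_power_le[OF d] Tpos
        by (intro add_mono mult_left_mono mult_right_mono) auto
      finally have 1: "\<bar>B T\<bar> \<le> \<bar>\<Sum>k=1..T. B (T div k)\<bar> + (M * real T ^ d * (3 / 4) + real T * D)"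
        by simp
      have 2: "\<bar>\<Sum>k=1..T. B (T div k)\<bar> \<le> M / 40 * real T ^ d"
        using elim Tpos by (simp add: field_simps)
      have "D \<le> M / 40 * real T" using elim by (simp add: field_simps)
      then have "real T * D \<le> real T * (M / 40 * real T)" by (intro mult_left_mono) auto
      also have "\<dots> = M / 40 * real T ^ 2" by (simp add: power2_eq_square)
      also have "\<dots> \<le> M / 40 * real T ^ d"
        using M d elim by (intro mult_left_mono power_increasing) auto
      finally have 3: "real T * D \<le> M / 40 * real T ^ d" .
      show ?case using 1 2 3 by linarith
    qed
  qed
  have iter: "eventually (\<lambda>T. \<bar>B T\<bar> \<le> (4/5) ^ j * K' * real T ^ d) sequentially" for j
  proof (induction j)
    case (Suc j)
    show ?case using contract[OF _ Suc] K' by (simp add: mult.assoc)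
  qed (use K' in simp)
  show ?thesis
  proof (rule tendstoI)
    fix e :: real assume e: "e > 0"
    have "(\<lambda>j. (4/5) ^ j * K') \<longlonglongrightarrow> 0 * K'" by (intro tendsto_intros LIMSEQ_power_zero) auto
    then have "eventually (\<lambda>j. (4/5) ^ j * K' < e) sequentially"
      using e by (intro order_tendstoD) auto
    then obtain j where j: "(4/5) ^ j * K' < e" unfolding eventually_sequentially by auto
    show "eventually (\<lambda>T. dist (B T / real T ^ d) 0 < e) sequentially"
      using iter[of j] eventually_ge_at_top[of 1]
    proof eventually_elim
      case (elim T)
      then have "\<bar>B T\<bar> / real T ^ d \<le> (4/5) ^ j * K'" by (simp add: field_simps)
      then show ?case using j by (simp add: abs_divide)
    qed
  qed
qed

text \<open>The expected main term \<open>L * T ^ d\<close> has divisor sum asymptotic to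
  \<open>L * \<zeta> * T ^ d\<close>, which matches \<open>c * T ^ d\<close>. So the remainder
  \<open>B\<close> has a negligible divisor sum. The bound on \<open>B\<close> that is required for
  the contraction comes from \<open>A' T \<le> A T\<close>, by the term
  \<open>k = 1\<close>.\<close>

lemma divisor_sum_inversion:
  fixes A A' :: "nat \<Rightarrow> real"
  assumes d: "d \<ge> 2"
    and nonneg: "\<And>T. A' T \<ge> 0"
    and zero: "A' 0 = 0"
    and A: "\<And>T. A T = (\<Sum>k=1..T. A' (T div k))"
    and lim: "(\<lambda>T. A T / real T ^ d) \<longlonglongrightarrow> c"
  shows "(\<lambda>T. A' T / real T ^ d) \<longlonglongrightarrow> c / (\<Sum>k. 1 / real (Suc k) ^ d)"
proof -
  define \<zeta> :: real where "\<zeta> = (\<Sum>k. 1 / real (Suc k) ^ d)"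
  have \<zeta>: "\<zeta> > 0" unfolding \<zeta>_def by (rule suminf_pos[OF summable_inverse_Suc_power[OF d]]) simp
  define L where "L = c / \<zeta>"
  define B where "B T = A' T - L * real T ^ d" for T
  have "Bseq (\<lambda>T. A T / real T ^ d)" using lim by (intro convergent_imp_Bseq convergentI)
  then obtain K where K: "K > 0" "\<And>T. \<bar>A T / real T ^ d\<bar> \<le> K"
    unfolding Bseq_def by auto
  have bound: "\<bar>B T\<bar> \<le> (K + \<bar>L\<bar>) * real T ^ d" for T
  proof (cases "T = 0")
    case True
    then have "B T = 0" using d zero by (simp add: B_def zero_power)
    then show ?thesis using K(1) by simp
  next
    case False
    have "A' T \<le> (\<Sum>k=1..T. A' (T div k))"
      using member_le_sum[of 1 "{1..T}" "\<lambda>k. A' (T div k)"] False nonneg by simp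
    then have "A' T \<le> A T" by (simp add: A)
    also have "A T \<le> K * real T ^ d" using K(2)[of T] False by (simp add: abs_le_iff field_simps)
    finally have "\<bar>A' T\<bar> \<le> K * real T ^ d" using nonneg[of T] by simp
    moreover have "\<bar>L * real T ^ d\<bar> = \<bar>L\<bar> * real T ^ d" by (simp add: abs_mult)
    ultimately show ?thesis unfolding B_def by (simp add: ring_distribs)
  qed
  have "(\<lambda>T. A T / real T ^ d - L * (\<Sum>k=1..T. (real (T div k) / real T) ^ d)) \<longlonglongrightarrow> c - L * \<zeta>"
    unfolding \<zeta>_def by (intro tendsto_intros lim sum_div_power_tendsto d)
  moreover have "A T / real T ^ d - L * (\<Sum>k=1..T. (real (T div k) / real T) ^ d)
      = (\<Sum>k=1..T. B (T div k)) / real T ^ d" for T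
    by (simp add: A B_def sum_subtractf sum_distrib_left power_divide diff_divide_distrib
        sum_divide_distrib)
  moreover have "c - L * \<zeta> = 0" using \<zeta> by (simp add: L_def)
  ultimately have "(\<lambda>T. (\<Sum>k=1..T. B (T div k)) / real T ^ d) \<longlonglongrightarrow> 0" by simp
  from divisor_sum_small_o[OF d bound this]
  have "(\<lambda>T. B T / real T ^ d + L) \<longlonglongrightarrow> 0 + L" by (intro tendsto_intros)
  then have "(\<lambda>T. A' T / real T ^ d) \<longlonglongrightarrow> L"
    unfolding add_0_left
  proof (rule Lim_transform_eventually, intro eventually_sequentiallyI[of 1])
    show "B T / real T ^ d + L = A' T / real T ^ d" if "T \<ge> 1" for T
      using that by (simp add: B_def diff_divide_distrib)
  qed
  then show ?thesis by (simp add: L_def \<zeta>_def)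
qed

section \<open>Counting positive integer points of a simplex\<close>

text \<open>Strict positivity reflects the relative interior of a cone; \<open>PiE\<close> makes a
  tuple determined by its values on \<open>I\<close>.\<close>

definition positive_tuples :: "'i set \<Rightarrow> ('i \<Rightarrow> nat) \<Rightarrow> nat \<Rightarrow> ('i \<Rightarrow> nat) set" where
  "positive_tuples I a T = {t \<in> PiE I (\<lambda>_. {1..}). (\<Sum>i\<in>I. a i * t i) \<le> T}"

lemma finite_positive_tuples:
  assumes "finite I" "\<And>i. i \<in> I \<Longrightarrow> a i > 0"
  shows "finite (positive_tuples I a T)"
proof (rule finite_subset)
  show "positive_tuples I a T \<subseteq> PiE I (\<lambda>_. {..T})"
  proof
    fix t assume t: "t \<in> positive_tuples I a T"
    have "t i \<le> T" if i: "i \<in> I" for i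
    proof -
      have "t i \<le> a i * t i" using assms(2)[OF i] by simp
      also have "\<dots> \<le> (\<Sum>i\<in>I. a i * t i)"
        by (rule member_le_sum[of i I "\<lambda>i. a i * t i"]) (use i assms in auto)
      finally show ?thesis using t by (simp add: positive_tuples_def)
    qed
    then show "t \<in> PiE I (\<lambda>_. {..T})" using t by (auto simp: positive_tuples_def PiE_def Pi_def)
  qed
  show "finite (PiE I (\<lambda>_. {..T}))" using assms by (intro finite_PiE) auto
qed

text \<open>Slicing by the value \<open>m\<close> of coordinate \<open>j\<close>. Resetting that
  coordinate to \<open>undefined\<close> turns the rest into an extensional tuple on
  \<open>I\<close>.\<close>

lemma card_positive_tuples_insert:
  assumes I: "finite I" "j \<notin> I" and a: "\<And>i. i \<in> insert j I \<Longrightarrow> a i > 0"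
  shows "card (positive_tuples (insert j I) a T)
    = (\<Sum>m=1..T div a j. card (positive_tuples I a (T - a j * m)))"
proof -
  have "card (positive_tuples (insert j I) a T)
      = card (SIGMA m:{1..T div a j}. positive_tuples I a (T - a j * m))"
  proof (rule bij_betw_same_card[of "\<lambda>t. (t j, t(j := undefined))"],
      rule bij_betw_byWitness[where f' = "\<lambda>(m, t). t(j := m)"])
    have s1: "(\<Sum>i\<in>I. a i * (if i = j then m else t i)) = (\<Sum>i\<in>I. a i * t i)" for m and t :: "_ \<Rightarrow> nat"
      by (rule sum.cong) (use I in auto)
    show "\<forall>t\<in>positive_tuples (insert j I) a T. (case (t j, t(j := undefined)) of (m, t) \<Rightarrow> t(j := m)) = t"
      by auto
    show "\<forall>p\<in>(SIGMA m:{1..T div a j}. positive_tuples I a (T - a j * m)).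
        ((case p of (m, t) \<Rightarrow> t(j := m)) j, (case p of (m, t) \<Rightarrow> t(j := m))(j := undefined)) = p"
      using I by (auto simp: positive_tuples_def PiE_def extensional_def fun_eq_iff)
    show "(\<lambda>t. (t j, t(j := undefined))) ` positive_tuples (insert j I) a T
        \<subseteq> (SIGMA m:{1..T div a j}. positive_tuples I a (T - a j * m))"
    proof (rule image_subsetI, rule SigmaI)
      fix t assume t: "t \<in> positive_tuples (insert j I) a T"
      then have le: "a j * t j + (\<Sum>i\<in>I. a i * t i) \<le> T" and "t j \<ge> 1"
        using I by (auto simp: positive_tuples_def PiE_def Pi_def)
      moreover from le have "t j * a j \<le> T" by (simp add: mult.commute)
      ultimately show "t j \<in> {1..T div a j}" using a[of j] by (simp add: less_eq_div_iff_mult_less_eq)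
      show "t(j := undefined) \<in> positive_tuples I a (T - a j * t j)"
        using t le I by (auto simp: positive_tuples_def PiE_def Pi_def extensional_def fun_upd_def s1)
    qed
    show "(\<lambda>(m, t). t(j := m)) ` (SIGMA m:{1..T div a j}. positive_tuples I a (T - a j * m))
        \<subseteq> positive_tuples (insert j I) a T"
    proof clarify
      fix m t assume m: "m \<in> {1..T div a j}" and t: "t \<in> positive_tuples I a (T - a j * m)"
      have "m * a j \<le> T" using m a[of j] by (simp add: less_eq_div_iff_mult_less_eq)
      then have "a j * m + (\<Sum>i\<in>I. a i * t i) \<le> T"
        using t by (simp add: positive_tuples_def mult.commute) linarith
      then show "t(j := m) \<in> positive_tuples (insert j I) a T"
        using t m I by (auto simp: positive_tuples_def PiE_def Pi_def extensional_def fun_upd_def s1)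
    qed
  qed
  also have "\<dots> = (\<Sum>m=1..T div a j. card (positive_tuples I a (T - a j * m)))"
    using I a by (subst card_SigmaI) (auto intro!: finite_positive_tuples)
  finally show ?thesis .
qed

text \<open>Each generator raises the exponent by one through \<open>sum_progression_asymp\<close>.
  The constant arising is the volume of the simplex, \<open>1 / d!\<close> divided by the product of
  the \<open>a i\<close>; its positivity is kept for later division.\<close>

lemma card_positive_tuples_asymp:
  assumes "finite I" "\<And>i. i \<in> I \<Longrightarrow> a i > 0"
  shows "\<exists>C>0. (\<lambda>T. real (card (positive_tuples I a T)) / real T ^ card I) \<longlonglongrightarrow> C"
  using assms
proof (induction I rule: finite_induct)
  case empty
  have "positive_tuples {} a T = {\<lambda>_. undefined}" for T by (auto simp: positive_tuples_def)
  then show ?case by (auto intro!: exI[of _ 1])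
next
  case (insert j I)
  then obtain C where C: "C > 0"
    "(\<lambda>T. real (card (positive_tuples I a T)) / real T ^ card I) \<longlonglongrightarrow> C" by auto
  have aj: "a j > 0" using insert by simp
  have eq: "card (positive_tuples (insert j I) a T)
      = (\<Sum>m=1..T div a j. card (positive_tuples I a (T - a j * m)))" for T
    by (rule card_positive_tuples_insert) (use insert in auto)
  have "(\<lambda>T. real (card (positive_tuples (insert j I) a T)) / real T ^ card (insert j I))
      \<longlonglongrightarrow> C / (real (a j) * real (Suc (card I)))"
    using sum_progression_asymp[OF aj C(2)] insert.hyps
    by (simp add: eq del: power_Suc of_nat_Suc)
  moreover have "C / (real (a j) * real (Suc (card I))) > 0" using C aj by simp
  ultimately show ?case by blast
qed

text \<open>Double counting: \<open>t j\<close> is the number of \<open>m < t j\<close>, and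
  lowering coordinate \<open>j\<close> by \<open>m\<close> trades the pair for a tuple under the
  bound \<open>T - a j * m\<close>. The value \<open>m = 0\<close> gives the first summand.\<close>

lemma sum_positive_tuples_coord:
  assumes I: "finite I" "j \<in> I" and a: "\<And>i. i \<in> I \<Longrightarrow> a i > 0"
  shows "(\<Sum>t\<in>positive_tuples I a T. t j)
    = card (positive_tuples I a T) + (\<Sum>m=1..T div a j. card (positive_tuples I a (T - a j * m)))"
proof -
  have fin: "finite (positive_tuples I a T)" for T by (intro finite_positive_tuples assms)
  have split: "(\<Sum>i\<in>I. a i * t i) = a j * t j + (\<Sum>i\<in>I-{j}. a i * t i)" for t :: "_ \<Rightarrow> nat"
    using I by (simp add: sum.remove)
  have s1: "(\<Sum>i\<in>I-{j}. a i * (if i = j then m else t i)) = (\<Sum>i\<in>I-{j}. a i * t i)" for m and t :: "_ \<Rightarrow> nat"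
    by (rule sum.cong) auto
  have "(\<Sum>t\<in>positive_tuples I a T. t j)
      = (\<Sum>t\<in>positive_tuples I a T. card {0..<t j})" by simp
  also have "\<dots> = card (SIGMA t:positive_tuples I a T. {0..<t j})"
    using fin by (subst card_SigmaI) auto
  also have "\<dots> = card (SIGMA m:{0..T div a j}. positive_tuples I a (T - a j * m))"
  proof (rule bij_betw_same_card[of "\<lambda>(t, m). (m, t(j := t j - m))"],
      rule bij_betw_byWitness[where f' = "\<lambda>(m, t). (t(j := t j + m), m)"])
    show "\<forall>p\<in>SIGMA t:positive_tuples I a T. {0..<t j}.
        (case (case p of (t, m) \<Rightarrow> (m, t(j := t j - m))) of (m, t) \<Rightarrow> (t(j := t j + m), m)) = p"
      by auto
    show "\<forall>p\<in>SIGMA m:{0..T div a j}. positive_tuples I a (T - a j * m).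
        (case (case p of (m, t) \<Rightarrow> (t(j := t j + m), m)) of (t, m) \<Rightarrow> (m, t(j := t j - m))) = p"
      by auto
    show "(\<lambda>(t, m). (m, t(j := t j - m))) ` (SIGMA t:positive_tuples I a T. {0..<t j})
        \<subseteq> (SIGMA m:{0..T div a j}. positive_tuples I a (T - a j * m))"
    proof
      fix p assume "p \<in> (\<lambda>(t, m). (m, t(j := t j - m))) ` (SIGMA t:positive_tuples I a T. {0..<t j})"
      then obtain t m where p: "p = (m, t(j := t j - m))"
        and t: "t \<in> positive_tuples I a T" and m: "m \<in> {0..<t j}" by auto
      from t have le: "a j * t j + (\<Sum>i\<in>I-{j}. a i * t i) \<le> T"
        by (simp add: positive_tuples_def split)
      have m': "a j * m + a j * (t j - m) = a j * t j"
        using m by (simp add: distrib_left[symmetric])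
      then have "m * a j \<le> T" using le by (simp add: mult.commute)
      then have "m \<in> {0..T div a j}" using a[OF I(2)] by (simp add: less_eq_div_iff_mult_less_eq)
      moreover have "t(j := t j - m) \<in> positive_tuples I a (T - a j * m)"
        using t le m m' I
        by (auto simp: positive_tuples_def split PiE_def Pi_def extensional_def fun_upd_def s1)
      ultimately show "p \<in> (SIGMA m:{0..T div a j}. positive_tuples I a (T - a j * m))"
        unfolding p by blast
    qed
    show "(\<lambda>(m, t). (t(j := t j + m), m)) ` (SIGMA m:{0..T div a j}. positive_tuples I a (T - a j * m))
        \<subseteq> (SIGMA t:positive_tuples I a T. {0..<t j})"
    proof
      fix p assume "p \<in> (\<lambda>(m, t). (t(j := t j + m), m)) ` (SIGMA m:{0..T div a j}. positive_tuples I a (T - a j * m))"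
      then obtain m t where p: "p = (t(j := t j + m), m)" and m: "m \<in> {0..T div a j}"
        and t: "t \<in> positive_tuples I a (T - a j * m)" by auto
      have "m * a j \<le> T" using m a[OF I(2)] by (simp add: less_eq_div_iff_mult_less_eq)
      then have "a j * m + (a j * t j + (\<Sum>i\<in>I-{j}. a i * t i)) \<le> T"
        using t by (simp add: positive_tuples_def split mult.commute) linarith
      then have "t(j := t j + m) \<in> positive_tuples I a T"
        using t I by (auto simp: positive_tuples_def split PiE_def Pi_def extensional_def fun_upd_def
            s1 algebra_simps)
      moreover have "m \<in> {0..<(t(j := t j + m)) j}"
        using t I by (auto simp: positive_tuples_def PiE_def Pi_def Suc_le_eq)
      ultimately show "p \<in> (SIGMA t:positive_tuples I a T. {0..<t j})"
        unfolding p by blast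
    qed
  qed
  also have "\<dots> = (\<Sum>m=0..T div a j. card (positive_tuples I a (T - a j * m)))"
    using fin by (subst card_SigmaI) auto
  also have "\<dots> = card (positive_tuples I a T) + (\<Sum>m=1..T div a j. card (positive_tuples I a (T - a j * m)))"
    by (subst sum.atLeast_Suc_atMost) auto
  finally show ?thesis .
qed

lemma sum_positive_tuples_coord_asymp:
  assumes I: "finite I" "j \<in> I" and a: "\<And>i. i \<in> I \<Longrightarrow> a i > 0"
  shows "\<exists>C. (\<lambda>T. real (\<Sum>t\<in>positive_tuples I a T. t j) / real T ^ Suc (card I)) \<longlonglongrightarrow> C"
proof -
  obtain C where C: "(\<lambda>T. real (card (positive_tuples I a T)) / real T ^ card I) \<longlonglongrightarrow> C"
    using card_positive_tuples_asymp[of I a] I(1) a by auto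
  have "(\<lambda>T. real (card (positive_tuples I a T)) / real T ^ card I * inverse (real T)
      + (\<Sum>m=1..T div a j. real (card (positive_tuples I a (T - a j * m)))) / real T ^ Suc (card I))
    \<longlonglongrightarrow> C * 0 + C / (real (a j) * real (Suc (card I)))"
    by (intro tendsto_intros C lim_inverse_n sum_progression_asymp a I)
  moreover have "real (\<Sum>t\<in>positive_tuples I a T. t j) / real T ^ Suc (card I)
    = real (card (positive_tuples I a T)) / real T ^ card I * inverse (real T)
      + (\<Sum>m=1..T div a j. real (card (positive_tuples I a (T - a j * m)))) / real T ^ Suc (card I)" for T
    by (simp add: sum_positive_tuples_coord[OF assms] add_divide_distrib divide_inverse algebra_simps)
  ultimately show ?thesis by auto
qed

section \<open>Unimodular cones and piecewise linear functions\<close>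

definition comb :: "(nat \<Rightarrow> real) set \<Rightarrow> ((nat \<Rightarrow> real) \<Rightarrow> real) \<Rightarrow> nat \<Rightarrow> real" where
  "comb V t = (\<lambda>i. \<Sum>w\<in>V. t w * w i)"

text \<open>Relatively open, so that cones can be disjoint; the empty generating set yields the
  origin alone.\<close>

definition open_cone :: "(nat \<Rightarrow> real) set \<Rightarrow> (nat \<Rightarrow> real) set" where
  "open_cone V = {comb V t |t. \<forall>w\<in>V. t w > 0}"

text \<open>Letting \<open>t\<close> range over all real coefficients says that \<open>V\<close> is
  a basis of the group of integer points in its span; linear independence is a consequence.\<close>

definition unimodular :: "(nat \<Rightarrow> real) set \<Rightarrow> bool" where
  "unimodular V \<longleftrightarrow> finite V \<and> (\<forall>w\<in>V. \<forall>i. w i \<in> \<nat>) \<and>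
     (\<forall>t. (\<forall>i. comb V t i \<in> \<int>) \<longrightarrow> (\<forall>w\<in>V. t w \<in> \<int>))"

definition cone_partition :: "(nat \<Rightarrow> real) set \<Rightarrow> (nat \<Rightarrow> real) set set \<Rightarrow> bool" where
  "cone_partition A \<V> \<longleftrightarrow> finite \<V> \<and> (\<forall>V\<in>\<V>. unimodular V) \<and> A = (\<Union>V\<in>\<V>. open_cone V) \<and>
     (\<forall>V\<in>\<V>. \<forall>W\<in>\<V>. V \<noteq> W \<longrightarrow> open_cone V \<inter> open_cone W = {})"

lemma unimodularD:
  assumes "unimodular V"
  shows "finite V" "w \<in> V \<Longrightarrow> w i \<in> \<nat>"
    "(\<And>i. comb V t i \<in> \<int>) \<Longrightarrow> w \<in> V \<Longrightarrow> t w \<in> \<int>"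
  using assms by (auto simp: unimodular_def)

lemma open_coneI: "(\<And>w. w \<in> V \<Longrightarrow> t w > 0) \<Longrightarrow> comb V t \<in> open_cone V"
  by (auto simp: open_cone_def)

lemma comb_cong: "(\<And>w. w \<in> V \<Longrightarrow> s w = t w) \<Longrightarrow> comb V s = comb V t"
  by (simp add: comb_def)

text \<open>A nonzero coefficient of a vanishing combination could be rescaled to \<open>1/2\<close>.\<close>

lemma unimodular_independent:
  assumes V: "unimodular V" and eq: "comb V s = comb V t" and w: "w \<in> V"
  shows "s w = t w"
proof (rule ccontr)
  define c where "c = 1 / (2 * (s w - t w))"
  assume ne: "s w \<noteq> t w"
  have "comb V (\<lambda>w. c * (s w - t w)) i = c * (comb V s i - comb V t i)" for i
    by (simp add: comb_def sum_distrib_left left_diff_distrib sum_subtractf mult.assoc right_diff_distrib)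
  then have "comb V (\<lambda>w. c * (s w - t w)) i \<in> \<int>" for i using eq by simp
  from unimodularD(3)[OF V this w] have "c * (s w - t w) \<in> \<int>" .
  moreover have "c * (s w - t w) = 1 / 2" using ne by (simp add: c_def)
  ultimately have "(1 / 2 :: real) \<in> \<int>" by simp
  then obtain k :: int where "(1 / 2 :: real) = of_int k" by (auto elim: Ints_cases)
  then have "of_int (2 * k) = (of_int 1 :: real)" by simp
  then have "2 * k = 1" using of_int_eq_iff by blast
  then show False by presburger
qed

lemma unimodular_nonzero:
  assumes V: "unimodular V" and w: "w \<in> V" shows "\<exists>i. w i > 0"
proof (rule ccontr)
  assume "\<not> ?thesis"
  then have "w i = 0" for i using unimodularD(2)[OF V w, of i]
    by (metis Nats_cases antisym_conv3 of_nat_0_le_iff not_less)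
  then have "comb V (\<lambda>v. if v = w then 1 else 0) = comb V (\<lambda>_. 0)"
    using unimodularD(1)[OF V] w by (simp add: comb_def fun_eq_iff if_distrib[of "\<lambda>x. x * _"] sum.delta cong: if_cong)
  from unimodular_independent[OF V this w] show False by simp
qed

lemma cone_partition_singleton: "unimodular V \<Longrightarrow> cone_partition (open_cone V) {V}"
  by (simp add: cone_partition_def)

lemma cone_partition_refine:
  assumes part: "cone_partition A \<V>"
    and refine: "\<And>V. V \<in> \<V> \<Longrightarrow> \<exists>\<W>. cone_partition (open_cone V) \<W> \<and> (\<forall>W\<in>\<W>. P W)"
  shows "\<exists>\<W>. cone_partition A \<W> \<and> (\<forall>W\<in>\<W>. P W)"
proof -
  obtain f where f: "\<And>V. V \<in> \<V> \<Longrightarrow> cone_partition (open_cone V) (f V) \<and> (\<forall>W\<in>f V. P W)"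
    using refine by metis
  have sub: "open_cone W \<subseteq> open_cone V" if "V \<in> \<V>" "W \<in> f V" for V W
    using f[OF that(1)] that(2) unfolding cone_partition_def by blast
  have "cone_partition A (\<Union>V\<in>\<V>. f V)"
    unfolding cone_partition_def
  proof (intro conjI ballI impI)
    show "finite (\<Union>V\<in>\<V>. f V)" using part f by (simp add: cone_partition_def)
    show "unimodular W" if "W \<in> (\<Union>V\<in>\<V>. f V)" for W
    proof -
      from that obtain V where "V \<in> \<V>" "W \<in> f V" by blast
      then show ?thesis using f[of V] by (simp add: cone_partition_def)
    qed
    have "A = (\<Union>V\<in>\<V>. open_cone V)" using part by (simp add: cone_partition_def)
    also have "\<dots> = (\<Union>V\<in>\<V>. \<Union>W\<in>f V. open_cone W)"
    proof (intro SUP_cong refl)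
      show "open_cone V = (\<Union>W\<in>f V. open_cone W)" if "V \<in> \<V>" for V
        using f[OF that] by (simp add: cone_partition_def)
    qed
    finally show "A = (\<Union>W\<in>(\<Union>V\<in>\<V>. f V). open_cone W)" by simp
    fix W W' assume W: "W \<in> (\<Union>V\<in>\<V>. f V)" "W' \<in> (\<Union>V\<in>\<V>. f V)" "W \<noteq> W'"
    then obtain V V' where V: "V \<in> \<V>" "W \<in> f V" "V' \<in> \<V>" "W' \<in> f V'" by blast
    show "open_cone W \<inter> open_cone W' = {}"
    proof (cases "V = V'")
      case True
      then show ?thesis using f[OF V(1)] V W(3) unfolding cone_partition_def by blast
    next
      case False
      then have "open_cone V \<inter> open_cone V' = {}" using part V unfolding cone_partition_def by blast
      then show ?thesis using sub[OF V(1,2)] sub[OF V(3,4)] by blast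
    qed
  qed
  then show ?thesis using f by blast
qed

text \<open>Stellar subdivision of an edge, from
  \<open>t1 * w1 + t2 * w2 = (t1 - t2) * w1 + t2 * z\<close>. The change of coefficients is integral
  in both directions, which preserves unimodularity. Only the half keeping \<open>w1\<close> and the
  common wall are treated; the other half follows by exchanging \<open>w1\<close> and
  \<open>w2\<close>.\<close>

lemma blow_up_half:
  assumes V: "unimodular V" and w: "w1 \<in> V" "w2 \<in> V" "w1 \<noteq> w2"
  defines "z \<equiv> \<lambda>i. w1 i + w2 i" and "R \<equiv> V - {w1, w2}"
  shows "z \<notin> V"
    and "comb (insert w1 (insert z R)) t = comb V (t(w1 := t w1 + t z, w2 := t z))"
    and "comb (insert z R) t = comb V (t(w1 := t z, w2 := t z))"
    and "unimodular (insert w1 (insert z R))"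
    and "unimodular (insert z R)"
    and "open_cone (insert w1 (insert z R)) = {comb V t |t. (\<forall>w\<in>V. t w > 0) \<and> t w1 > t w2}"
    and "open_cone (insert z R) = {comb V t |t. (\<forall>w\<in>V. t w > 0) \<and> t w1 = t w2}"
proof -
  have fin: "finite V" "finite R" using unimodularD(1)[OF V] by (auto simp: R_def)
  have VR: "V = insert w1 (insert w2 R)" "w1 \<notin> R" "w2 \<notin> R" using w by (auto simp: R_def)
  have combV: "comb V t i = t w1 * w1 i + t w2 * w2 i + (\<Sum>w\<in>R. t w * w i)" for t i
    using fin w(3) VR(2,3) by (simp add: comb_def VR(1))
  show zV: "z \<notin> V"
  proof
    assume z: "z \<in> V"
    \<comment> \<open>As a generator, \<open>z\<close> would have two coefficient vectors: 1 at
      \<open>w1\<close> and \<open>w2\<close>, and 1 at \<open>z\<close>.\<close>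
    have "comb V (\<lambda>w. (if w = w1 then 1 else 0) + (if w = w2 then 1 else 0)) = z"
      using fin w by (intro ext) (simp add: comb_def z_def distrib_right sum.distrib
          if_distrib[of "\<lambda>x. x * _"] sum.delta cong: if_cong)
    also have "z = comb V (\<lambda>w. if w = z then 1 else 0)"
      using fin z by (intro ext) (simp add: comb_def if_distrib[of "\<lambda>x. x * _"] sum.delta cong: if_cong)
    finally have eq: "comb V (\<lambda>w. (if w = w1 then 1 else 0) + (if w = w2 then 1 else 0))
      = comb V (\<lambda>w. if w = z then 1 else (0::real))" .
    from unimodular_independent[OF V eq w(1)] unimodular_independent[OF V eq w(2)] w(3)
    show False by (simp split: if_splits)
  qed
  then have zR: "z \<notin> R" "z \<noteq> w1" "z \<noteq> w2" "w1 \<noteq> z" using w by (auto simp: R_def)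
  have R_upd: "(\<Sum>w\<in>R. (t(w1 := a, w2 := b)) w * w i) = (\<Sum>w\<in>R. t w * w i)" for t :: "_ \<Rightarrow> real" and a b i
    using VR by (intro sum.cong) auto
  show comb1: "comb (insert w1 (insert z R)) t = comb V (t(w1 := t w1 + t z, w2 := t z))" for t
  proof
    fix i
    have "comb (insert w1 (insert z R)) t i = t w1 * w1 i + (t z * z i + (\<Sum>w\<in>R. t w * w i))"
      using fin zR VR by (simp add: comb_def)
    then show "comb (insert w1 (insert z R)) t i = comb V (t(w1 := t w1 + t z, w2 := t z)) i"
      using w(3) unfolding combV R_upd by (simp add: z_def algebra_simps)
  qed
  show comb2: "comb (insert z R) t = comb V (t(w1 := t z, w2 := t z))" for t
  proof
    fix i
    have "comb (insert z R) t i = t z * z i + (\<Sum>w\<in>R. t w * w i)"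
      using fin zR VR by (simp add: comb_def)
    then show "comb (insert z R) t i = comb V (t(w1 := t z, w2 := t z)) i"
      using w(3) unfolding combV R_upd by (simp add: z_def algebra_simps)
  qed
  have zN: "z i \<in> \<nat>" for i using unimodularD(2)[OF V] w by (simp add: z_def Nats_add)
  have RV: "w \<in> R \<Longrightarrow> w \<in> V \<and> w \<noteq> w1 \<and> w \<noteq> w2" for w by (auto simp: R_def)
  show "unimodular (insert w1 (insert z R))"
    unfolding unimodular_def
  proof (intro conjI allI impI ballI)
    show "v i \<in> \<nat>" if "v \<in> insert w1 (insert z R)" for v i
      using that zN unimodularD(2)[OF V] w RV by auto
    fix t v assume int: "\<forall>i. comb (insert w1 (insert z R)) t i \<in> \<int>" and v: "v \<in> insert w1 (insert z R)"
    define s where "s = t(w1 := t w1 + t z, w2 := t z)"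
    have s: "s x \<in> \<int>" if "x \<in> V" for x
      using unimodularD(3)[OF V _ that, of s] int unfolding comb1 s_def by blast
    have "t z \<in> \<int>" using s[OF w(2)] by (simp add: s_def)
    moreover have "t w1 + t z \<in> \<int>" using s[OF w(1)] w(3) by (simp add: s_def)
    ultimately have "t w1 \<in> \<int>" using Ints_diff[of "t w1 + t z" "t z"] by simp
    moreover have "t x \<in> \<int>" if "x \<in> R" for x using s[of x] RV[OF that] by (simp add: s_def)
    ultimately show "t v \<in> \<int>" using v \<open>t z \<in> \<int>\<close> by auto
  qed (use fin in simp)
  show "unimodular (insert z R)"
    unfolding unimodular_def
  proof (intro conjI allI impI ballI)
    show "v i \<in> \<nat>" if "v \<in> insert z R" for v i
      using that zN unimodularD(2)[OF V] w RV by auto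
    fix t v assume int: "\<forall>i. comb (insert z R) t i \<in> \<int>" and v: "v \<in> insert z R"
    define s where "s = t(w1 := t z, w2 := t z)"
    have s: "s x \<in> \<int>" if "x \<in> V" for x
      using unimodularD(3)[OF V _ that, of s] int unfolding comb2 s_def by blast
    have "t z \<in> \<int>" using s[OF w(2)] by (simp add: s_def)
    moreover have "t x \<in> \<int>" if "x \<in> R" for x using s[of x] RV[OF that] by (simp add: s_def)
    ultimately show "t v \<in> \<int>" using v by auto
  qed (use fin in simp)
  show "open_cone (insert w1 (insert z R)) = {comb V t |t. (\<forall>w\<in>V. t w > 0) \<and> t w1 > t w2}"
  proof (intro equalityI subsetI)
    fix x assume "x \<in> open_cone (insert w1 (insert z R))"
    then obtain t where x: "x = comb V (t(w1 := t w1 + t z, w2 := t z))"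
      and t: "\<forall>w\<in>insert w1 (insert z R). t w > 0" unfolding open_cone_def comb1 by blast
    have "\<forall>w\<in>V. (t(w1 := t w1 + t z, w2 := t z)) w > 0" using t VR by (auto simp: add_pos_pos)
    moreover have "(t(w1 := t w1 + t z, w2 := t z)) w1 > (t(w1 := t w1 + t z, w2 := t z)) w2"
      using t w(3) by simp
    ultimately show "x \<in> {comb V t |t. (\<forall>w\<in>V. t w > 0) \<and> t w1 > t w2}" using x by blast
  next
    fix x assume "x \<in> {comb V t |t. (\<forall>w\<in>V. t w > 0) \<and> t w1 > t w2}"
    then obtain t where x: "x = comb V t" and t: "\<forall>w\<in>V. t w > 0" "t w1 > t w2" by blast
    define s where "s = t(w1 := t w1 - t w2, z := t w2)"
    have "comb (insert w1 (insert z R)) s = comb V t"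
      unfolding comb1 by (rule comb_cong) (use zV zR w in \<open>auto simp: s_def\<close>)
    moreover have "\<forall>w\<in>insert w1 (insert z R). s w > 0" using t w RV by (auto simp: s_def)
    ultimately show "x \<in> open_cone (insert w1 (insert z R))" using x open_coneI by metis
  qed
  show "open_cone (insert z R) = {comb V t |t. (\<forall>w\<in>V. t w > 0) \<and> t w1 = t w2}"
  proof (intro equalityI subsetI)
    fix x assume "x \<in> open_cone (insert z R)"
    then obtain t where x: "x = comb V (t(w1 := t z, w2 := t z))"
      and t: "\<forall>w\<in>insert z R. t w > 0" unfolding open_cone_def comb2 by blast
    have "\<forall>w\<in>V. (t(w1 := t z, w2 := t z)) w > 0" using t VR by auto
    moreover have "(t(w1 := t z, w2 := t z)) w1 = (t(w1 := t z, w2 := t z)) w2" by simp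
    ultimately show "x \<in> {comb V t |t. (\<forall>w\<in>V. t w > 0) \<and> t w1 = t w2}" using x by blast
  next
    fix x assume "x \<in> {comb V t |t. (\<forall>w\<in>V. t w > 0) \<and> t w1 = t w2}"
    then obtain t where x: "x = comb V t" and t: "\<forall>w\<in>V. t w > 0" "t w1 = t w2" by blast
    define s where "s = t(z := t w2)"
    have "comb (insert z R) s = comb V t"
      unfolding comb2 by (rule comb_cong) (use zV zR w t in \<open>auto simp: s_def\<close>)
    moreover have "\<forall>w\<in>insert z R. s w > 0" using t w RV by (auto simp: s_def)
    ultimately show "x \<in> open_cone (insert z R)" using x open_coneI by metis
  qed
qed

text \<open>By independence a point determines its coefficients at \<open>w1\<close> and
  \<open>w2\<close>; their comparison decides which of the three pieces contains it.\<close>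

lemma blow_up_partition:
  assumes V: "unimodular V" and w: "w1 \<in> V" "w2 \<in> V" "w1 \<noteq> w2"
  defines "z \<equiv> \<lambda>i. w1 i + w2 i" and "R \<equiv> V - {w1, w2}"
  shows "cone_partition (open_cone V) {insert w1 (insert z R), insert w2 (insert z R), insert z R}"
proof -
  have z': "z = (\<lambda>i. w2 i + w1 i)" and R': "R = V - {w2, w1}" by (auto simp: z_def R_def add.commute)
  note half1 = blow_up_half[OF V w, folded z_def R_def]
  note half2 = blow_up_half[OF V w(2,1) w(3)[symmetric], folded z' R']
  have indep: "s w1 = t w1 \<and> s w2 = t w2" if "comb V s = comb V t" for s t
    using unimodular_independent[OF V that] w by blast
  have disj: "{comb V t |t. P t \<and> Q t} \<inter> {comb V t |t. P' t \<and> Q' t} = {}"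
    if "\<And>s t. Q s \<Longrightarrow> Q' t \<Longrightarrow> s w1 = t w1 \<Longrightarrow> s w2 = t w2 \<Longrightarrow> False" for P P' Q Q'
  proof (rule equals0I)
    fix x assume "x \<in> {comb V t |t. P t \<and> Q t} \<inter> {comb V t |t. P' t \<and> Q' t}"
    then obtain s t where "x = comb V s" "Q s" "x = comb V t" "Q' t" by blast
    then show False using that[of s t] indep[of s t] by auto
  qed
  have "open_cone V \<subseteq> open_cone (insert w1 (insert z R)) \<union> open_cone (insert w2 (insert z R)) \<union> open_cone (insert z R)"
  proof
    fix x assume "x \<in> open_cone V"
    then obtain t where t: "x = comb V t" "\<forall>w\<in>V. t w > 0" by (auto simp: open_cone_def)
    then show "x \<in> open_cone (insert w1 (insert z R)) \<union> open_cone (insert w2 (insert z R)) \<union> open_cone (insert z R)"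
      unfolding half1(6,7) half2(6) using linorder_less_linear[of "t w1" "t w2"] by blast
  qed
  moreover have "open_cone (insert w1 (insert z R)) \<union> open_cone (insert w2 (insert z R)) \<union> open_cone (insert z R) \<subseteq> open_cone V"
    unfolding half1(6,7) half2(6) open_cone_def[of V] by blast
  moreover have "open_cone (insert w1 (insert z R)) \<inter> open_cone (insert w2 (insert z R)) = {}"
    "open_cone (insert w1 (insert z R)) \<inter> open_cone (insert z R) = {}"
    "open_cone (insert w2 (insert z R)) \<inter> open_cone (insert z R) = {}"
    unfolding half1(6,7) half2(6) by (rule disj; linarith)+
  ultimately show ?thesis
    unfolding cone_partition_def using half1(4,5) half2(4) by auto
qed

section \<open>Integral linear forms and sign-constant subdivisions\<close>

definition integral_form :: "nat \<Rightarrow> ((nat \<Rightarrow> real) \<Rightarrow> real) \<Rightarrow> bool" where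
  "integral_form n f \<longleftrightarrow> (\<exists>a :: nat \<Rightarrow> int. f = (\<lambda>x. \<Sum>i<n. of_int (a i) * x i))"

lemma integral_form_comb:
  assumes "integral_form n f"
  shows "f (comb V t) = (\<Sum>w\<in>V. t w * f w)"
proof -
  obtain a :: "nat \<Rightarrow> int" where f: "f = (\<lambda>x. \<Sum>i<n. of_int (a i) * x i)"
    using assms by (auto simp: integral_form_def)
  have "f (comb V t) = (\<Sum>i<n. \<Sum>w\<in>V. t w * (of_int (a i) * w i))"
    by (simp add: f comb_def sum_distrib_left algebra_simps)
  also have "\<dots> = (\<Sum>w\<in>V. t w * f w)" by (subst sum.swap) (simp add: f sum_distrib_left)
  finally show ?thesis .
qed

lemma integral_form_Ints: "integral_form n f \<Longrightarrow> (\<And>i. x i \<in> \<int>) \<Longrightarrow> f x \<in> \<int>"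
  by (auto simp: integral_form_def intro!: Ints_sum Ints_mult)

lemma integral_form_plus: "integral_form n f \<Longrightarrow> integral_form n g \<Longrightarrow> integral_form n (\<lambda>x. f x + g x)"
  unfolding integral_form_def
proof clarify
  fix a b :: "nat \<Rightarrow> int"
  show "\<exists>c::nat \<Rightarrow> int. (\<lambda>x. (\<Sum>i<n. of_int (a i) * x i) + (\<Sum>i<n. of_int (b i) * x i)) = (\<lambda>x. \<Sum>i<n. of_int (c i) * x i :: real)"
    by (rule exI[of _ "\<lambda>i. a i + b i"]) (simp add: sum.distrib distrib_right)
qed

lemma integral_form_uminus: "integral_form n f \<Longrightarrow> integral_form n (\<lambda>x. - f x)"
  unfolding integral_form_def
proof clarify
  fix a :: "nat \<Rightarrow> int"
  show "\<exists>c::nat \<Rightarrow> int. (\<lambda>x. - (\<Sum>i<n. of_int (a i) * x i)) = (\<lambda>x. \<Sum>i<n. of_int (c i) * x i :: real)"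
    by (rule exI[of _ "\<lambda>i. - a i"]) (simp add: sum_negf)
qed

lemma integral_form_minus: "integral_form n f \<Longrightarrow> integral_form n g \<Longrightarrow> integral_form n (\<lambda>x. f x - g x)"
  using integral_form_plus[OF _ integral_form_uminus, of n f g] by simp

lemma integral_form_zero: "integral_form n (\<lambda>_. 0)"
  unfolding integral_form_def by (rule exI[of _ "\<lambda>_. 0"]) simp

lemma integral_form_coord: "i < n \<Longrightarrow> integral_form n (\<lambda>x. x i)"
  unfolding integral_form_def
  by (rule exI[of _ "\<lambda>j. if j = i then 1 else 0"]) (simp add: if_distrib[of "\<lambda>x. x * _"] if_distrib[of of_int] sum.delta' sum.delta cong: if_cong)

definition sign_constant :: "((nat \<Rightarrow> real) \<Rightarrow> real) \<Rightarrow> (nat \<Rightarrow> real) set \<Rightarrow> bool" where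
  "sign_constant f A \<longleftrightarrow> (\<forall>x\<in>A. f x > 0) \<or> (\<forall>x\<in>A. f x = 0) \<or> (\<forall>x\<in>A. f x < 0)"

lemma sign_constant_nonneg_generators:
  assumes f: "integral_form n f" and V: "finite V" "\<And>w. w \<in> V \<Longrightarrow> f w \<ge> 0"
  shows "sign_constant f (open_cone V)"
proof (cases "\<forall>w\<in>V. f w = 0")
  case True
  then have "\<forall>x\<in>open_cone V. f x = 0" by (auto simp: open_cone_def integral_form_comb[OF f])
  then show ?thesis by (simp add: sign_constant_def)
next
  case False
  then obtain w where w: "w \<in> V" "f w > 0" using V by force
  have "f (comb V t) > 0" if "\<forall>w\<in>V. t w > 0" for t
    unfolding integral_form_comb[OF f] using V w that
    by (intro sum_pos2[of V w]) (auto simp: less_imp_le)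
  then have "\<forall>x\<in>open_cone V. f x > 0" by (auto simp: open_cone_def)
  then show ?thesis by (simp add: sign_constant_def)
qed

lemma sign_constant_uminus: "sign_constant (\<lambda>x. - f x) A = sign_constant f A"
  by (auto simp: sign_constant_def)

abbreviation sign_split :: "((nat \<Rightarrow> real) \<Rightarrow> real) \<Rightarrow> (nat \<Rightarrow> real) set \<Rightarrow> bool" where
  "sign_split f V \<equiv> \<exists>\<W>. cone_partition (open_cone V) \<W> \<and> (\<forall>W\<in>\<W>. sign_constant f (open_cone W))"

text \<open>Blowing up at a generator of maximal value \<open>B\<close> and one of negative value removes either the
  negative generator or the maximal one, and the new generator has absolute value below \<open>B\<close>.\<close>

lemma sign_split_max:
  assumes f: "integral_form n f"
    and IH: "\<And>V. unimodular V \<Longrightarrow> (\<And>w. w \<in> V \<Longrightarrow> \<bar>f w\<bar> \<le> B) \<Longrightarrow> card {w\<in>V. \<bar>f w\<bar> = B} < c \<Longrightarrow> sign_split f V"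
    and V: "unimodular V" "\<And>w. w \<in> V \<Longrightarrow> \<bar>f w\<bar> \<le> B" "card {w\<in>V. \<bar>f w\<bar> = B} \<le> c"
    and w1: "w1 \<in> V" "f w1 = B" and B: "B > 0"
  shows "sign_split f V"
  using V w1
proof (induction "card {w\<in>V. f w < 0}" arbitrary: V)
  case 0
  then have "\<And>w. w \<in> V \<Longrightarrow> f w \<ge> 0" using unimodularD(1)[OF 0(2)] by force
  then show ?case
    using 0 sign_constant_nonneg_generators[OF f unimodularD(1)[OF 0(2)]] cone_partition_singleton by blast
next
  case (Suc q)
  note V = \<open>unimodular V\<close>
  have fin: "finite V" by (rule unimodularD(1)[OF V])
  obtain w2 where w2: "w2 \<in> V" "f w2 < 0" using Suc(2) by (metis (no_types, lifting) Collect_empty_eq card.empty nat.distinct(1))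
  have ne: "w1 \<noteq> w2" using w2 Suc.prems B by auto
  define z where "z = (\<lambda>i. w1 i + w2 i)"
  define R where "R = V - {w1, w2}"
  have VR: "V = insert w1 (insert w2 R)" "w1 \<notin> R" "w2 \<notin> R" "finite R"
    using Suc.prems w2 fin by (auto simp: R_def)
  note half1 = blow_up_half[OF V \<open>w1 \<in> V\<close> w2(1) ne, folded z_def R_def]
  have zc: "z = (\<lambda>i. w2 i + w1 i)" and Rc: "R = V - {w2, w1}" by (auto simp: z_def R_def add.commute)
  note half2 = blow_up_half[OF V w2(1) \<open>w1 \<in> V\<close> ne[symmetric], folded zc Rc]
  note part = blow_up_partition[OF V \<open>w1 \<in> V\<close> w2(1) ne, folded z_def R_def]
  have fz: "f z = f w1 + f w2"
    using f by (auto simp: integral_form_def z_def distrib_left sum.distrib)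
  have zB: "f z \<ge> 0" "\<bar>f z\<bar> < B" using fz Suc.prems(2)[OF w2(1)] \<open>f w1 = B\<close> w2 by auto
  have bnd: "\<bar>f w\<bar> \<le> B" if "w \<in> insert w1 (insert w2 (insert z R))" for w
    using that Suc.prems(2) VR zB by auto
  have cV: "card {w\<in>V. \<bar>f w\<bar> = B} = card (insert w1 {w\<in>insert w2 R. \<bar>f w\<bar> = B})"
    using VR \<open>f w1 = B\<close> B by (intro arg_cong[of _ _ card]) auto
  have cV': "card {w\<in>V. \<bar>f w\<bar> = B} = Suc (card {w\<in>insert w2 R. \<bar>f w\<bar> = B})"
    unfolding cV using VR ne by (subst card_insert_disjoint) auto
  \<comment> \<open>Here \<open>w2\<close> is replaced by \<open>z\<close> with
    \<open>f z \<ge> 0\<close>, so there is one negative generator fewer and the induction on their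
    number applies.\<close>
  have s1: "sign_split f (insert w1 (insert z R))"
  proof (rule Suc.hyps(1))
    have "{w\<in>V. f w < 0} = insert w2 {w\<in>insert w1 (insert z R). f w < 0}"
      using VR w2 zB by auto
    moreover have "w2 \<notin> {w\<in>insert w1 (insert z R). f w < 0}" using VR ne half1(1) w2 by auto
    ultimately have "card {w\<in>V. f w < 0} = Suc (card {w\<in>insert w1 (insert z R). f w < 0})"
      using VR(4) by simp
    then show "q = card {w\<in>insert w1 (insert z R). f w < 0}" using Suc.hyps(2) by simp
    show "unimodular (insert w1 (insert z R))" by (rule half1)
    have "{w\<in>insert w1 (insert z R). \<bar>f w\<bar> = B} \<subseteq> {w\<in>V. \<bar>f w\<bar> = B}" using VR zB by auto
    then have "card {w\<in>insert w1 (insert z R). \<bar>f w\<bar> = B} \<le> card {w\<in>V. \<bar>f w\<bar> = B}"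
      using fin by (intro card_mono) auto
    then show "card {w\<in>insert w1 (insert z R). \<bar>f w\<bar> = B} \<le> c" using Suc.prems by linarith
  qed (use bnd Suc.prems in auto)
  \<comment> \<open>The other half and the wall lose \<open>w1\<close>, which attains
    \<open>B\<close>, while \<open>z\<close> stays strictly below \<open>B\<close>; so
    \<open>IH\<close> applies to both.\<close>
  have le: "card {w\<in>insert w2 (insert z R). \<bar>f w\<bar> = B} < c" "card {w\<in>insert z R. \<bar>f w\<bar> = B} < c"
  proof -
    have "card {w\<in>insert w2 (insert z R). \<bar>f w\<bar> = B} \<le> card {w\<in>insert w2 R. \<bar>f w\<bar> = B}"
      using VR(4) zB by (intro card_mono) auto
    moreover have "card {w\<in>insert z R. \<bar>f w\<bar> = B} \<le> card {w\<in>insert w2 R. \<bar>f w\<bar> = B}"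
      using VR(4) zB by (intro card_mono) auto
    ultimately show "card {w\<in>insert w2 (insert z R). \<bar>f w\<bar> = B} < c" "card {w\<in>insert z R. \<bar>f w\<bar> = B} < c"
      using cV' Suc.prems(3) by linarith+
  qed
  have s2: "sign_split f (insert w2 (insert z R))" by (rule IH[OF half2(4) _ le(1)]) (use bnd in auto)
  have s3: "sign_split f (insert z R)" by (rule IH[OF half1(5) _ le(2)]) (use bnd in auto)
  show ?case by (rule cone_partition_refine[OF part]) (use s1 s2 s3 in auto)
qed

text \<open>Induction on the bound, and for a fixed bound on the number of generators attaining it.
  Once none attains \<open>Suc B\<close>, integrality of \<open>f\<close> at the generators lowers
  the bound to \<open>B\<close>.\<close>

lemma sign_split_bounded:
  assumes "integral_form n f" "unimodular V" "\<And>w. w \<in> V \<Longrightarrow> \<bar>f w\<bar> \<le> real B"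
  shows "sign_split f V"
  using assms
proof (induction B arbitrary: f V)
  case 0
  have "\<And>w. w \<in> V \<Longrightarrow> f w \<ge> 0" using 0(3) by force
  then show ?case
    using 0 sign_constant_nonneg_generators[OF 0(1) unimodularD(1)[OF 0(2)]] cone_partition_singleton by blast
next
  case (Suc B)
  have "sign_split f V"
    if "integral_form n f" "unimodular V" "\<And>w. w \<in> V \<Longrightarrow> \<bar>f w\<bar> \<le> real (Suc B)" "card {w\<in>V. \<bar>f w\<bar> = real (Suc B)} = c" for f V c
    using that
  proof (induction c arbitrary: f V rule: less_induct)
    case (less c)
    note V = \<open>unimodular V\<close> and f = \<open>integral_form n f\<close>
    have IH: "sign_split f' V'"
      if "integral_form n f'" "unimodular V'" "\<And>w. w \<in> V' \<Longrightarrow> \<bar>f' w\<bar> \<le> real (Suc B)" "card {w\<in>V'. \<bar>f' w\<bar> = real (Suc B)} < c" for f' V'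
      by (rule less.IH[OF that(4,1,2,3) refl])
    consider w where "w \<in> V" "f w = real (Suc B)" | w where "w \<in> V" "- f w = real (Suc B)"
      | "\<And>w. w \<in> V \<Longrightarrow> \<bar>f w\<bar> \<noteq> real (Suc B)"
      by (metis abs_if)
    then show ?case
    proof cases
      case (1 w)
      show ?thesis
        by (rule sign_split_max[OF f IH[OF f] V less.prems(3) eq_imp_le[OF less.prems(4)] 1]) auto
    next
      \<comment> \<open>An extremal negative value becomes maximal for \<open>- f\<close>, which has
        the same sign-constant pieces; hence the inner induction leaves \<open>f\<close>
        arbitrary.\<close>
      case (2 w)
      have "sign_split (\<lambda>x. - f x) V"
        by (rule sign_split_max[OF integral_form_uminus[OF f] IH[OF integral_form_uminus[OF f]] V _ _ 2])
          (use less.prems in auto)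
      then show ?thesis by (simp add: sign_constant_uminus)
    next
      case 3
      have "\<bar>f w\<bar> \<le> real B" if w: "w \<in> V" for w
      proof -
        have "f w \<in> \<int>" using integral_form_Ints[OF f] unimodularD(2)[OF V w] Nats_subset_Ints by blast
        then obtain k where k: "f w = of_int k" by (auto elim: Ints_cases)
        have "\<bar>f w\<bar> < real (Suc B)" using less.prems(3)[OF w] 3[OF w] by linarith
        then have "\<bar>k\<bar> < int (Suc B)" unfolding k by linarith
        then have "\<bar>k\<bar> \<le> int B" by linarith
        then show ?thesis unfolding k by linarith
      qed
      then show ?thesis by (rule Suc.IH[OF f V])
    qed
  qed
  then show ?case using Suc.prems by blast
qed

lemma sign_split_form:
  assumes f: "integral_form n f" and V: "unimodular V"
  shows "sign_split f V"
proof -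
  have "\<bar>f w\<bar> \<le> real (nat \<lceil>\<Sum>w\<in>V. \<bar>f w\<bar>\<rceil>)" if "w \<in> V" for w
  proof -
    have "\<bar>f w\<bar> \<le> (\<Sum>w\<in>V. \<bar>f w\<bar>)" using that unimodularD(1)[OF V]
      by (intro member_le_sum) auto
    then show ?thesis by (metis order_trans real_nat_ceiling_ge)
  qed
  then show ?thesis by (rule sign_split_bounded[OF assms])
qed

section \<open>Hoop terms as piecewise linear functions\<close>

primrec eval_term :: "('x \<Rightarrow> real) \<Rightarrow> 'x hoop_term \<Rightarrow> real" where
  "eval_term x (Var i) = x i"
| "eval_term x Zero = 0"
| "eval_term x (Plus r s) = eval_term x r + eval_term x s"
| "eval_term x (Monus r s) = max 0 (eval_term x r - eval_term x s)"

definition linear_on :: "nat \<Rightarrow> nat hoop_term \<Rightarrow> (nat \<Rightarrow> real) set \<Rightarrow> bool" where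
  "linear_on n t A \<longleftrightarrow> (\<exists>f. integral_form n f \<and> (\<forall>x\<in>A. eval_term x t = f x))"

lemma linear_on_subset: "linear_on n t A \<Longrightarrow> B \<subseteq> A \<Longrightarrow> linear_on n t B"
  unfolding linear_on_def by blast

lemma cone_partition_subset: "cone_partition A \<V> \<Longrightarrow> V \<in> \<V> \<Longrightarrow> open_cone V \<subseteq> A"
  unfolding cone_partition_def by blast

lemma cone_partition_unimodular: "cone_partition A \<V> \<Longrightarrow> V \<in> \<V> \<Longrightarrow> unimodular V"
  unfolding cone_partition_def by blast

lemma cone_partition_refine_linear:
  assumes part: "cone_partition A \<V>" and r: "\<And>V. V \<in> \<V> \<Longrightarrow> linear_on n r (open_cone V)"
    and s: "\<And>V. unimodular V \<Longrightarrow> \<exists>\<W>. cone_partition (open_cone V) \<W> \<and> (\<forall>W\<in>\<W>. linear_on n s (open_cone W))"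
  obtains \<W> where "cone_partition A \<W>"
    "\<And>W. W \<in> \<W> \<Longrightarrow> linear_on n r (open_cone W) \<and> linear_on n s (open_cone W)"
proof -
  have "\<exists>\<W>. cone_partition A \<W> \<and> (\<forall>W\<in>\<W>. linear_on n r (open_cone W) \<and> linear_on n s (open_cone W))"
  proof (rule cone_partition_refine[OF part])
    fix V assume V: "V \<in> \<V>"
    obtain \<W> where W: "cone_partition (open_cone V) \<W>" "\<forall>W\<in>\<W>. linear_on n s (open_cone W)"
      using s[OF cone_partition_unimodular[OF part V]] by blast
    have "linear_on n r (open_cone W)" if "W \<in> \<W>" for W
      by (rule linear_on_subset[OF r[OF V] cone_partition_subset[OF W(1) that]])
    then show "\<exists>\<W>. cone_partition (open_cone V) \<W> \<and> (\<forall>W\<in>\<W>. linear_on n r (open_cone W) \<and> linear_on n s (open_cone W))"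
      using W by blast
  qed
  then show ?thesis using that by blast
qed

text \<open>Truncated subtraction of two linear functions is linear wherever their difference has
  constant sign. \<open>P\<close> is left open so that the same triple refinement resolves a
  \<open>Monus\<close> and decides a relation.\<close>

lemma joint_sign_split:
  assumes r: "\<And>V. unimodular V \<Longrightarrow> \<exists>\<W>. cone_partition (open_cone V) \<W> \<and> (\<forall>W\<in>\<W>. linear_on n r (open_cone W))"
    and s: "\<And>V. unimodular V \<Longrightarrow> \<exists>\<W>. cone_partition (open_cone V) \<W> \<and> (\<forall>W\<in>\<W>. linear_on n s (open_cone W))"
    and V: "unimodular V"
    and P: "\<And>W f g. integral_form n f \<Longrightarrow> integral_form n g \<Longrightarrow> sign_constant (\<lambda>x. f x - g x) (open_cone W) \<Longrightarrow>
      (\<And>x. x \<in> open_cone W \<Longrightarrow> eval_term x r = f x \<and> eval_term x s = g x) \<Longrightarrow> P W"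
  shows "\<exists>\<W>. cone_partition (open_cone V) \<W> \<and> (\<forall>W\<in>\<W>. P W)"
proof -
  obtain \<V> where V: "cone_partition (open_cone V) \<V>" "\<And>V. V \<in> \<V> \<Longrightarrow> linear_on n r (open_cone V)"
    using r[OF V] by blast
  obtain \<W> where W: "cone_partition (open_cone V) \<W>"
    "\<And>V. V \<in> \<W> \<Longrightarrow> linear_on n r (open_cone V) \<and> linear_on n s (open_cone V)"
    using cone_partition_refine_linear[OF V s] by blast
  show ?thesis
  proof (rule cone_partition_refine[OF W(1)])
    fix U assume U: "U \<in> \<W>"
    obtain f g where fg: "integral_form n f" "integral_form n g"
      "\<And>x. x \<in> open_cone U \<Longrightarrow> eval_term x r = f x" "\<And>x. x \<in> open_cone U \<Longrightarrow> eval_term x s = g x"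
      using W(2)[OF U] unfolding linear_on_def by metis
    obtain \<X> where X: "cone_partition (open_cone U) \<X>"
      "\<And>X. X \<in> \<X> \<Longrightarrow> sign_constant (\<lambda>x. f x - g x) (open_cone X)"
      using sign_split_form[OF integral_form_minus[OF fg(1,2)] cone_partition_unimodular[OF W(1) U]] by blast
    have "P X" if "X \<in> \<X>" for X
      by (rule P[OF fg(1,2) X(2)[OF that]]) (use fg(3,4) cone_partition_subset[OF X(1) that] in blast)
    then show "\<exists>\<X>. cone_partition (open_cone U) \<X> \<and> (\<forall>X\<in>\<X>. P X)" using X(1) by blast
  qed
qed

lemma term_linear_split:
  assumes "vars t \<subseteq> {..<n}" "unimodular V"
  shows "\<exists>\<W>. cone_partition (open_cone V) \<W> \<and> (\<forall>W\<in>\<W>. linear_on n t (open_cone W))"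
  using assms
proof (induction t arbitrary: V)
  case (Var i)
  then have "linear_on n (Var i) (open_cone V)"
    using integral_form_coord[of i n] by (auto simp: linear_on_def)
  then show ?case using cone_partition_singleton[OF Var(2)] by blast
next
  case Zero
  then have "linear_on n Zero (open_cone V)"
    using integral_form_zero by (auto simp: linear_on_def)
  then show ?case using cone_partition_singleton[OF Zero(2)] by blast
next
  case (Plus r s)
  then have rs: "vars r \<subseteq> {..<n}" "vars s \<subseteq> {..<n}" by auto
  show ?case
  proof (rule joint_sign_split[OF Plus.IH(1)[OF rs(1)] Plus.IH(2)[OF rs(2)] Plus.prems(2)])
    fix W f g assume "integral_form n f" "integral_form n g"
      "\<And>x. x \<in> open_cone W \<Longrightarrow> eval_term x r = f x \<and> eval_term x s = g x"
    then show "linear_on n (Plus r s) (open_cone W)"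
      unfolding linear_on_def by (intro exI[of _ "\<lambda>x. f x + g x"]) (simp add: integral_form_plus)
  qed
next
  case (Monus r s)
  then have rs: "vars r \<subseteq> {..<n}" "vars s \<subseteq> {..<n}" by auto
  show ?case
  proof (rule joint_sign_split[OF Monus.IH(1)[OF rs(1)] Monus.IH(2)[OF rs(2)] Monus.prems(2)])
    fix W f g assume fg: "integral_form n f" "integral_form n g"
      and sgn: "sign_constant (\<lambda>x. f x - g x) (open_cone W)"
      and ev: "\<And>x. x \<in> open_cone W \<Longrightarrow> eval_term x r = f x \<and> eval_term x s = g x"
    from sgn consider "\<forall>x\<in>open_cone W. f x - g x \<ge> 0" | "\<forall>x\<in>open_cone W. f x - g x \<le> 0"
      unfolding sign_constant_def by force
    then show "linear_on n (Monus r s) (open_cone W)"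
    proof cases
      case 1
      then show ?thesis unfolding linear_on_def
        by (intro exI[of _ "\<lambda>x. f x - g x"]) (simp add: ev integral_form_minus[OF fg])
    next
      case 2
      then show ?thesis unfolding linear_on_def
        by (intro exI[of _ "\<lambda>_. 0"]) (simp add: ev integral_form_zero)
    qed
  qed
qed

section \<open>The polyhedral solution set of a presentation\<close>

text \<open>Coordinates from \<open>n\<close> on are forced to 0, so points remain functions on all
  naturals and are determined by \<open>n\<close> entries.\<close>

definition orthant :: "nat \<Rightarrow> (nat \<Rightarrow> real) set" where
  "orthant n = {x. (\<forall>i. x i \<ge> 0) \<and> (\<forall>i\<ge>n. x i = 0)}"

text \<open>The pieces are the relatively open coordinate faces, one for each possible support
  \<open>I\<close>, generated by unit vectors.\<close>

lemma orthant_partition: "\<exists>\<V>. cone_partition (orthant n) \<V>"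
proof -
  define e :: "nat \<Rightarrow> nat \<Rightarrow> real" where "e i = (\<lambda>j. if j = i then 1 else 0)" for i
  have e_inj: "inj e" unfolding inj_def e_def by (metis zero_neq_one)
  have comb_e: "comb (e ` I) t = (\<lambda>j. if j \<in> I then t (e j) else 0)" if "finite I" for I t
    using that unfolding comb_def
    by (subst sum.reindex) (auto simp: inj_on_subset[OF e_inj] e_def if_distrib[of "\<lambda>x. _ * x"] sum.delta' sum.delta fun_eq_iff cong: if_cong)
  have cone_e: "open_cone (e ` I) = {x. (\<forall>i\<in>I. x i > 0) \<and> (\<forall>i. i \<notin> I \<longrightarrow> x i = 0)}" if I: "finite I" for I
  proof (intro equalityI subsetI)
    fix x :: "nat \<Rightarrow> real" assume x: "x \<in> {x. (\<forall>i\<in>I. x i > 0) \<and> (\<forall>i. i \<notin> I \<longrightarrow> x i = 0)}"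
    have "x = comb (e ` I) (\<lambda>v. x (inv_into UNIV e v))" using x by (auto simp: comb_e[OF I] inv_f_f[OF e_inj] fun_eq_iff)
    moreover have "\<forall>v\<in>e ` I. x (inv_into UNIV e v) > 0" using x by (auto simp: inv_f_f[OF e_inj])
    ultimately show "x \<in> open_cone (e ` I)"
      using open_coneI[of "e ` I" "\<lambda>v. x (inv_into UNIV e v)"] by metis
  qed (auto simp: open_cone_def comb_e[OF I])
  have fin: "I \<subseteq> {..<n} \<Longrightarrow> finite I" for I by (rule finite_subset) auto
  have "cone_partition (orthant n) ((\<lambda>I. e ` I) ` Pow {..<n})"
    unfolding cone_partition_def
  proof (intro conjI ballI impI)
    fix V assume "V \<in> (\<lambda>I. e ` I) ` Pow {..<n}"
    then obtain I where I: "V = e ` I" "finite I" using fin by blast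
    show "unimodular V" unfolding unimodular_def I comb_e[OF I(2)]
    proof (intro conjI allI impI ballI)
      fix t w assume t: "\<forall>i. (if i \<in> I then t (e i) else 0) \<in> (\<int> :: real set)" and "w \<in> e ` I"
      then obtain i where i: "i \<in> I" "w = e i" by blast
      show "t w \<in> \<int>" using t[rule_format, of i] i by simp
    qed (use I in \<open>auto simp: e_def\<close>)
  next
    fix V W assume "V \<in> (\<lambda>I. e ` I) ` Pow {..<n}" "W \<in> (\<lambda>I. e ` I) ` Pow {..<n}" and ne: "V \<noteq> W"
    then obtain I J where I: "V = e ` I" "finite I" and J: "W = e ` J" "finite J" using fin by blast
    from ne I J obtain i where "i \<in> I \<and> i \<notin> J \<or> i \<notin> I \<and> i \<in> J" by blast
    then show "open_cone V \<inter> open_cone W = {}" unfolding I J cone_e[OF I(2)] cone_e[OF J(2)] by fastforce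
  next
    have "x \<in> orthant n \<longleftrightarrow> (\<exists>I\<in>Pow {..<n}. x \<in> open_cone (e ` I))" for x
    proof
      assume x: "x \<in> orthant n"
      then have I: "{i. x i > 0} \<subseteq> {..<n}" by (auto simp: orthant_def) (metis less_irrefl not_less)
      have "x \<in> open_cone (e ` {i. x i > 0})"
        unfolding cone_e[OF fin[OF I]] using x by (auto simp: orthant_def not_less antisym)
      then show "\<exists>I\<in>Pow {..<n}. x \<in> open_cone (e ` I)" using I by blast
    next
      assume "\<exists>I\<in>Pow {..<n}. x \<in> open_cone (e ` I)"
      then obtain I where I: "I \<subseteq> {..<n}" "x \<in> open_cone (e ` I)" by blast
      then have x: "i \<in> I \<Longrightarrow> x i > 0" "i \<notin> I \<Longrightarrow> x i = 0" for i using cone_e[OF fin[OF I(1)]] by auto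
      have "x i \<ge> 0" for i by (cases "i \<in> I") (simp_all add: x less_imp_le)
      moreover have "x i = 0" if "i \<ge> n" for i using I(1) that by (intro x(2)) auto
      ultimately show "x \<in> orthant n" by (simp add: orthant_def)
    qed
    then show "orthant n = (\<Union>V\<in>(\<lambda>I. e ` I) ` Pow {..<n}. open_cone V)" by blast
  qed simp
  then show ?thesis by blast
qed

text \<open>After this refinement every piece lies inside the solutions of the relation or misses
  them, so solution sets are obtained by selecting pieces.\<close>

lemma relation_split:
  assumes "vars r \<subseteq> {..<n}" "vars s \<subseteq> {..<n}" "unimodular V"
  shows "\<exists>\<W>. cone_partition (open_cone V) \<W> \<and> (\<forall>W\<in>\<W>.
    (\<forall>x\<in>open_cone W. eval_term x r = eval_term x s) \<or> (\<forall>x\<in>open_cone W. eval_term x r \<noteq> eval_term x s))"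
proof (rule joint_sign_split[OF term_linear_split[OF assms(1)] term_linear_split[OF assms(2)] assms(3)])
  fix W f g assume sgn: "sign_constant (\<lambda>x. f x - g x) (open_cone W)"
    and ev: "\<And>x. x \<in> open_cone W \<Longrightarrow> eval_term x r = f x \<and> eval_term x s = g x"
  from sgn consider "\<forall>x\<in>open_cone W. f x = g x" | "\<forall>x\<in>open_cone W. f x \<noteq> g x"
    unfolding sign_constant_def by force
  then show "(\<forall>x\<in>open_cone W. eval_term x r = eval_term x s) \<or> (\<forall>x\<in>open_cone W. eval_term x r \<noteq> eval_term x s)"
    by cases (simp_all add: ev)
qed

definition solution_set :: "nat \<Rightarrow> (nat hoop_term \<times> nat hoop_term) set \<Rightarrow> (nat \<Rightarrow> real) set" where
  "solution_set n R = {x \<in> orthant n. \<forall>(r, s)\<in>R. eval_term x r = eval_term x s}"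

lemma solution_set_partition:
  assumes "finite R" "\<And>r s. (r, s) \<in> R \<Longrightarrow> vars r \<subseteq> {..<n} \<and> vars s \<subseteq> {..<n}"
  shows "\<exists>\<V>. cone_partition (solution_set n R) \<V>"
  using assms
proof (induction R rule: finite_induct)
  case empty
  then show ?case using orthant_partition by (simp add: solution_set_def)
next
  case (insert p R)
  obtain r s where p: "p = (r, s)" by force
  obtain \<V> where V: "cone_partition (solution_set n R) \<V>"
    using insert.IH insert.prems by (meson insertI2)
  have rs: "vars r \<subseteq> {..<n}" "vars s \<subseteq> {..<n}" using insert.prems p by auto
  obtain \<W> where W: "cone_partition (solution_set n R) \<W>" and dich: "\<And>W. W \<in> \<W> \<Longrightarrow>
    (\<forall>x\<in>open_cone W. eval_term x r = eval_term x s) \<or> (\<forall>x\<in>open_cone W. eval_term x r \<noteq> eval_term x s)"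
    using cone_partition_refine[OF V relation_split[OF rs]] cone_partition_unimodular[OF V] by metis
  have "solution_set n (insert p R) = {x \<in> solution_set n R. eval_term x r = eval_term x s}"
    by (auto simp: solution_set_def p)
  also have "\<dots> = (\<Union>W\<in>{W\<in>\<W>. \<forall>x\<in>open_cone W. eval_term x r = eval_term x s}. open_cone W)"
  proof (intro equalityI subsetI)
    fix x assume x: "x \<in> {x \<in> solution_set n R. eval_term x r = eval_term x s}"
    then obtain U where "U \<in> \<W>" "x \<in> open_cone U" using W unfolding cone_partition_def by auto
    then show "x \<in> (\<Union>W\<in>{W\<in>\<W>. \<forall>x\<in>open_cone W. eval_term x r = eval_term x s}. open_cone W)"
      using dich[of U] x by auto
  next
    fix x assume "x \<in> (\<Union>W\<in>{W\<in>\<W>. \<forall>x\<in>open_cone W. eval_term x r = eval_term x s}. open_cone W)"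
    then show "x \<in> {x \<in> solution_set n R. eval_term x r = eval_term x s}"
      using cone_partition_subset[OF W] by auto
  qed
  finally have "cone_partition (solution_set n (insert p R)) {W\<in>\<W>. \<forall>x\<in>open_cone W. eval_term x r = eval_term x s}"
    using W unfolding cone_partition_def by auto
  then show ?case by blast
qed

lemma solution_set_partition_linear:
  assumes "finite R" "\<And>r s. (r, s) \<in> R \<Longrightarrow> vars r \<subseteq> {..<n} \<and> vars s \<subseteq> {..<n}"
    and t: "vars t \<subseteq> {..<n}" "vars t' \<subseteq> {..<n}"
  shows "\<exists>\<V>. cone_partition (solution_set n R) \<V> \<and>
    (\<forall>V\<in>\<V>. linear_on n t (open_cone V) \<and> linear_on n t' (open_cone V))"
proof -
  obtain \<U> where U: "cone_partition (solution_set n R) \<U>" using solution_set_partition[OF assms(1,2)] by blast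
  obtain \<V> where V: "cone_partition (solution_set n R) \<V>" "\<And>V. V \<in> \<V> \<Longrightarrow> linear_on n t (open_cone V)"
    using cone_partition_refine[OF U term_linear_split[OF t(1)]] cone_partition_unimodular[OF U] by metis
  obtain \<W> where W: "cone_partition (solution_set n R) \<W>"
    "\<And>V. V \<in> \<W> \<Longrightarrow> linear_on n t (open_cone V) \<and> linear_on n t' (open_cone V)"
    using cone_partition_refine_linear[OF V term_linear_split[OF t(2)]] by blast
  show ?thesis
    by (rule exI[of _ \<W>]) (use W in simp)
qed

section \<open>Counting integer points\<close>

text \<open>The origin is left out because it is not a positive multiple of any primitive
  point.\<close>

definition natural_points :: "(nat \<Rightarrow> real) set \<Rightarrow> ((nat \<Rightarrow> real) \<Rightarrow> real) \<Rightarrow> nat \<Rightarrow> (nat \<Rightarrow> real) set" where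
  "natural_points A U T = {x \<in> A. (\<forall>i. x i \<in> \<nat>) \<and> x \<noteq> (\<lambda>_. 0) \<and> U x \<le> real T}"

text \<open>Moving far out along a generator with \<open>f w \<le> 0\<close> keeps \<open>f\<close>
  bounded above while some coordinate grows, against \<open>bound\<close>.\<close>

lemma integral_form_generator_pos:
  assumes V: "unimodular V" and w: "w \<in> V" and f: "integral_form n f"
    and bound: "\<And>x i. x \<in> open_cone V \<Longrightarrow> x i \<le> K * f x" and K: "K > 0"
  shows "f w > 0"
proof (rule ccontr)
  assume neg: "\<not> f w > 0"
  obtain i where i: "w i > 0" using unimodular_nonzero[OF V w] by blast
  have fin: "finite V" by (rule unimodularD(1)[OF V])
  define B where "B = (\<Sum>v\<in>V - {w}. f v)"
  \<comment> \<open>Chosen so that \<open>c * w i\<close> equals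
    \<open>K * \<bar>B\<bar> + 1\<close>, just beyond the bound; \<open>B\<close> is the value of
    \<open>f\<close> on the other generators, each with coefficient 1.\<close>
  define c where "c = (K * \<bar>B\<bar> + 1) / w i"
  have c: "c > 0" using i K by (simp add: c_def add_nonneg_pos)
  define t where "t v = (if v = w then c else 1)" for v
  have rest: "(\<Sum>v\<in>V - {w}. t v * g v) = (\<Sum>v\<in>V - {w}. g v)" for g :: "_ \<Rightarrow> real"
    by (intro sum.cong) (auto simp: t_def)
  have "f (comb V t) = c * f w + B"
    using fin w rest by (simp add: integral_form_comb[OF f] sum.remove B_def t_def)
  also have "\<dots> \<le> \<bar>B\<bar>" using mult_nonneg_nonpos[of c "f w"] c neg by linarith
  finally have "K * f (comb V t) \<le> K * \<bar>B\<bar>" using K by (intro mult_left_mono) auto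
  moreover have "comb V t \<in> open_cone V" using c by (intro open_coneI) (simp add: t_def)
  ultimately have "comb V t i \<le> K * \<bar>B\<bar>" using bound order_trans by blast
  moreover have "comb V t i = c * w i + (\<Sum>v\<in>V - {w}. v i)"
    using fin w rest by (simp add: comb_def sum.remove t_def)
  moreover have "(\<Sum>v\<in>V - {w}. v i) \<ge> 0"
    using unimodularD(2)[OF V] by (intro sum_nonneg) (auto simp: Nats_altdef2)
  moreover have "c * w i = K * \<bar>B\<bar> + 1" using i by (simp add: c_def)
  ultimately show False by linarith
qed

lemma sum_in_Nats: "(\<And>x. x \<in> A \<Longrightarrow> f x \<in> \<nat>) \<Longrightarrow> sum f A \<in> (\<nat> :: real set)"
  by (induction A rule: infinite_finite_induct) (auto intro: Nats_add)

text \<open>Unimodularity makes the coefficients of an integer point integers, openness of the cone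
  makes them positive, and \<open>f\<close> becomes the weight of the tuple.\<close>

lemma natural_points_cone_bij:
  assumes V: "unimodular V" "V \<noteq> {}" and f: "integral_form n f"
    and pos: "\<And>w. w \<in> V \<Longrightarrow> f w > 0"
    and Uf: "\<And>x. x \<in> open_cone V \<Longrightarrow> U x = f x"
  shows "bij_betw (\<lambda>t. comb V (\<lambda>w. real (t w)))
    (positive_tuples V (\<lambda>w. nat \<lfloor>f w\<rfloor>) T) (natural_points (open_cone V) U T)"
proof (rule bij_betwI')
  have fin: "finite V" by (rule unimodularD(1)[OF V(1)])
  have fw: "real (nat \<lfloor>f w\<rfloor>) = f w" if "w \<in> V" for w
  proof -
    have "f w \<in> \<int>" using integral_form_Ints[OF f] unimodularD(2)[OF V(1) that] Nats_subset_Ints by blast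
    then show ?thesis using pos[OF that] by (auto elim!: Ints_cases)
  qed
  have fcomb: "f (comb V (\<lambda>w. real (t w))) = real (\<Sum>w\<in>V. nat \<lfloor>f w\<rfloor> * t w)" for t
  proof -
    have "(\<Sum>w\<in>V. real (t w) * f w) = (\<Sum>w\<in>V. real (nat \<lfloor>f w\<rfloor>) * real (t w))"
      using fw by (intro sum.cong) auto
    then show ?thesis by (simp add: integral_form_comb[OF f])
  qed
  have cone: "comb V (\<lambda>w. real (t w)) \<in> open_cone V" if "t \<in> positive_tuples V a T" for t a
    using that by (intro open_coneI) (fastforce simp: positive_tuples_def PiE_def Pi_def)
  show "(comb V (\<lambda>w. real (s w)) = comb V (\<lambda>w. real (t w))) = (s = t)"
    if "s \<in> positive_tuples V (\<lambda>w. nat \<lfloor>f w\<rfloor>) T" "t \<in> positive_tuples V (\<lambda>w. nat \<lfloor>f w\<rfloor>) T" for s t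
  proof
    assume "comb V (\<lambda>w. real (s w)) = comb V (\<lambda>w. real (t w))"
    from unimodular_independent[OF V(1) this] have "s w = t w" if "w \<in> V" for w
      using that by fastforce
    then show "s = t" using that by (auto simp: positive_tuples_def intro: PiE_ext)
  qed simp
  show "comb V (\<lambda>w. real (t w)) \<in> natural_points (open_cone V) U T"
    if t: "t \<in> positive_tuples V (\<lambda>w. nat \<lfloor>f w\<rfloor>) T" for t
  proof -
    have "comb V (\<lambda>w. real (t w)) i \<in> \<nat>" for i
      unfolding comb_def using unimodularD(2)[OF V(1)]
      by (intro sum_in_Nats Nats_mult) auto
    moreover have "comb V (\<lambda>w. real (t w)) \<noteq> (\<lambda>_. 0)"
    proof
      obtain w where w: "w \<in> V" using V(2) by blast
      assume "comb V (\<lambda>w. real (t w)) = (\<lambda>_. 0)"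
      also have "\<dots> = comb V (\<lambda>_. 0)" by (simp add: comb_def)
      finally have "real (t w) = 0" by (rule unimodular_independent[OF V(1) _ w])
      then show False using t w by (force simp: positive_tuples_def PiE_def Pi_def)
    qed
    moreover have "U (comb V (\<lambda>w. real (t w))) \<le> real T"
      using Uf[OF cone[OF t]] t unfolding fcomb by (simp only: of_nat_le_iff) (simp add: positive_tuples_def)
    ultimately show ?thesis using cone[OF t] by (simp add: natural_points_def)
  qed
  show "\<exists>t\<in>positive_tuples V (\<lambda>w. nat \<lfloor>f w\<rfloor>) T. x = comb V (\<lambda>w. real (t w))"
    if x: "x \<in> natural_points (open_cone V) U T" for x
  proof -
    obtain s where s: "x = comb V s" "\<And>w. w \<in> V \<Longrightarrow> s w > 0"
      using x by (auto simp: natural_points_def open_cone_def)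
    have sZ: "s w \<in> \<int>" if "w \<in> V" for w
      using unimodularD(3)[OF V(1) _ that, of s] x s(1) Nats_subset_Ints by (auto simp: natural_points_def)
    define t where "t = restrict (\<lambda>w. nat \<lfloor>s w\<rfloor>) V"
    have st: "s w = real (t w)" if "w \<in> V" for w
      using sZ[OF that] s(2)[OF that] that by (auto simp: t_def elim!: Ints_cases)
    have xt: "x = comb V (\<lambda>w. real (t w))" unfolding s(1) by (rule comb_cong) (rule st)
    have "t w \<ge> 1" if "w \<in> V" for w using s(2)[OF that] st[OF that] by (simp add: Suc_le_eq)
    moreover have "real (\<Sum>w\<in>V. nat \<lfloor>f w\<rfloor> * t w) \<le> real T"
      using x Uf[of x] unfolding fcomb[symmetric] xt[symmetric] by (auto simp: natural_points_def)
    ultimately have "t \<in> positive_tuples V (\<lambda>w. nat \<lfloor>f w\<rfloor>) T"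
      unfolding of_nat_le_iff positive_tuples_def by (auto simp: t_def)
    then show ?thesis using xt by blast
  qed
qed

text \<open>The sum of \<open>h\<close> is a linear combination of coordinate sums over tuples,
  which grow one power of \<open>T\<close> faster than the count.\<close>

lemma cone_counting:
  assumes V: "unimodular V" "V \<noteq> {}" and f: "integral_form n f" and g: "integral_form n g"
    and bound: "\<And>x i. x \<in> open_cone V \<Longrightarrow> x i \<le> K * f x" and K: "K > 0"
    and Uf: "\<And>x. x \<in> open_cone V \<Longrightarrow> U x = f x" and hg: "\<And>x. x \<in> open_cone V \<Longrightarrow> h x = g x"
  shows "\<exists>C>0. (\<lambda>T. real (card (natural_points (open_cone V) U T)) / real T ^ card V) \<longlonglongrightarrow> C"
    and "\<exists>G. (\<lambda>T. (\<Sum>x\<in>natural_points (open_cone V) U T. h x) / real T ^ Suc (card V)) \<longlonglongrightarrow> G"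
    and "finite (natural_points (open_cone V) U T)"
proof -
  define a where "a w = nat \<lfloor>f w\<rfloor>" for w
  have fin: "finite V" by (rule unimodularD(1)[OF V(1)])
  have pos: "f w > 0" if "w \<in> V" for w
    by (rule integral_form_generator_pos[OF V(1) that f bound K])
  have a: "a w > 0" if "w \<in> V" for w
  proof -
    have "f w \<in> \<int>" using integral_form_Ints[OF f] unimodularD(2)[OF V(1) that] Nats_subset_Ints by blast
    then show ?thesis using pos[OF that] by (auto elim!: Ints_cases simp: a_def)
  qed
  have bij: "bij_betw (\<lambda>t. comb V (\<lambda>w. real (t w))) (positive_tuples V a T) (natural_points (open_cone V) U T)" for T
    unfolding a_def by (rule natural_points_cone_bij[OF V f pos Uf])
  show "finite (natural_points (open_cone V) U T)"
  proof -
    have "finite (positive_tuples V a T)" by (rule finite_positive_tuples[OF fin]) (rule a)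
    then show ?thesis using bij_betw_finite[OF bij] by simp
  qed
  show "\<exists>C>0. (\<lambda>T. real (card (natural_points (open_cone V) U T)) / real T ^ card V) \<longlonglongrightarrow> C"
    using card_positive_tuples_asymp[OF fin, of a] a by (simp add: bij_betw_same_card[OF bij, symmetric])
  have "(\<Sum>x\<in>natural_points (open_cone V) U T. h x)
      = (\<Sum>w\<in>V. g w * real (\<Sum>t\<in>positive_tuples V a T. t w))" for T
  proof -
    have "(\<Sum>x\<in>natural_points (open_cone V) U T. h x) = (\<Sum>x\<in>natural_points (open_cone V) U T. g x)"
      using hg by (intro sum.cong) (auto simp: natural_points_def)
    also have "\<dots> = (\<Sum>t\<in>positive_tuples V a T. g (comb V (\<lambda>w. real (t w))))"
      by (rule sum.reindex_bij_betw[OF bij, symmetric])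
    also have "\<dots> = (\<Sum>t\<in>positive_tuples V a T. \<Sum>w\<in>V. real (t w) * g w)"
      by (simp add: integral_form_comb[OF g])
    also have "\<dots> = (\<Sum>w\<in>V. g w * real (\<Sum>t\<in>positive_tuples V a T. t w))"
      by (subst sum.swap) (simp add: sum_distrib_left mult.commute)
    finally show ?thesis .
  qed
  moreover have "\<exists>c. \<forall>w\<in>V. (\<lambda>T. real (\<Sum>t\<in>positive_tuples V a T. t w) / real T ^ Suc (card V)) \<longlonglongrightarrow> c w"
    using sum_positive_tuples_coord_asymp[OF fin, of _ a] a by (intro bchoice) blast
  then obtain c where c: "\<And>w. w \<in> V \<Longrightarrow> (\<lambda>T. real (\<Sum>t\<in>positive_tuples V a T. t w) / real T ^ Suc (card V)) \<longlonglongrightarrow> c w"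
    by blast
  have "(\<lambda>T. \<Sum>w\<in>V. g w * (real (\<Sum>t\<in>positive_tuples V a T. t w) / real T ^ Suc (card V))) \<longlonglongrightarrow> (\<Sum>w\<in>V. g w * c w)"
    by (intro tendsto_intros c)
  ultimately show "\<exists>G. (\<lambda>T. (\<Sum>x\<in>natural_points (open_cone V) U T. h x) / real T ^ Suc (card V)) \<longlonglongrightarrow> G"
    by (auto simp: sum_divide_distrib simp del: of_nat_sum)
qed

lemma tendsto_divide_higher_power:
  fixes s :: "nat \<Rightarrow> real"
  assumes "(\<lambda>T. s T / real T ^ k) \<longlonglongrightarrow> c" "k < d"
  shows "(\<lambda>T. s T / real T ^ d) \<longlonglongrightarrow> 0"
proof -
  have "(\<lambda>T. s T / real T ^ k * inverse (real T) ^ (d - k)) \<longlonglongrightarrow> c * 0 ^ (d - k)"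
    by (intro tendsto_intros assms lim_inverse_n)
  moreover have "s T / real T ^ k * inverse (real T) ^ (d - k) = s T / real T ^ d" for T
    using assms(2) by (simp add: power_inverse divide_inverse power_add[symmetric] flip: inverse_mult_distrib)
  ultimately show ?thesis using assms(2) by (simp add: zero_power)
qed

text \<open>\<open>bound\<close> makes the regions \<open>U x \<le> T\<close> bounded; in the
  application it expresses that \<open>u\<close> is a unit. \<open>nonzero\<close> excludes the cone
  consisting of the origin.\<close>

locale cone_decomposition =
  fixes W :: "(nat \<Rightarrow> real) set" and \<V> :: "(nat \<Rightarrow> real) set set" and n :: nat
    and U h :: "(nat \<Rightarrow> real) \<Rightarrow> real" and K :: real
  assumes part: "cone_partition W \<V>"
    and U_linear: "\<And>V. V \<in> \<V> \<Longrightarrow> \<exists>f. integral_form n f \<and> (\<forall>x\<in>open_cone V. U x = f x)"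
    and h_linear: "\<And>V. V \<in> \<V> \<Longrightarrow> \<exists>f. integral_form n f \<and> (\<forall>x\<in>open_cone V. h x = f x)"
    and K_pos: "K > 0" and bound: "\<And>x i. x \<in> W \<Longrightarrow> x i \<le> K * U x"
    and nonzero: "\<exists>x\<in>W. x \<noteq> (\<lambda>_. 0)"
begin

text \<open>The empty generating set is removed since its cone, the origin, contains no counted
  point.\<close>

definition cone_dim :: nat where "cone_dim = Max (card ` (\<V> - {{}}))"

lemma finite_partition: "finite \<V>" "finite (\<V> - {{}})"
  using part by (auto simp: cone_partition_def)

lemma nonempty_partition: "\<V> - {{}} \<noteq> {}"
proof
  assume "\<V> - {{}} = {}"
  then have "W \<subseteq> open_cone {}" using part by (auto simp: cone_partition_def)
  then show False using nonzero by (auto simp: open_cone_def comb_def)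
qed

lemma card_le_cone_dim: "V \<in> \<V> - {{}} \<Longrightarrow> card V \<le> cone_dim"
  unfolding cone_dim_def using finite_partition by (intro Max_ge) auto

lemma cone_dim_attained: "\<exists>V\<in>\<V> - {{}}. card V = cone_dim"
proof -
  have "cone_dim \<in> card ` (\<V> - {{}})" unfolding cone_dim_def
    using finite_partition nonempty_partition by (intro Max_in) auto
  then show ?thesis by auto
qed

lemma cone_dim_pos: "cone_dim \<ge> 1"
proof -
  obtain V where V: "V \<in> \<V> - {{}}" "card V = cone_dim" using cone_dim_attained by blast
  then have "finite V" using part unimodularD(1) cone_partition_unimodular by blast
  then have "card V \<noteq> 0" using V by auto
  then show ?thesis using V by simp
qed

lemma cone_asymp:
  assumes V: "V \<in> \<V> - {{}}"
  shows "\<exists>C>0. (\<lambda>T. real (card (natural_points (open_cone V) U T)) / real T ^ card V) \<longlonglongrightarrow> C"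
    and "\<exists>G. (\<lambda>T. (\<Sum>x\<in>natural_points (open_cone V) U T. h x) / real T ^ Suc (card V)) \<longlonglongrightarrow> G"
    and "finite (natural_points (open_cone V) U T)"
proof -
  have VV: "V \<in> \<V>" "V \<noteq> {}" using V by auto
  obtain f where f: "integral_form n f" "\<And>x. x \<in> open_cone V \<Longrightarrow> U x = f x" using U_linear[OF VV(1)] by blast
  obtain g where g: "integral_form n g" "\<And>x. x \<in> open_cone V \<Longrightarrow> h x = g x" using h_linear[OF VV(1)] by blast
  have b: "x i \<le> K * f x" if "x \<in> open_cone V" for x i
    using bound[of x i] cone_partition_subset[OF part VV(1)] f(2)[OF that] that by auto
  note * = cone_counting[OF cone_partition_unimodular[OF part VV(1)] VV(2) f(1) g(1) b K_pos f(2) g(2)]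
  show "\<exists>C>0. (\<lambda>T. real (card (natural_points (open_cone V) U T)) / real T ^ card V) \<longlonglongrightarrow> C"
    by (rule *(1))
  show "\<exists>G. (\<lambda>T. (\<Sum>x\<in>natural_points (open_cone V) U T. h x) / real T ^ Suc (card V)) \<longlonglongrightarrow> G"
    by (rule *(2))
  show "finite (natural_points (open_cone V) U T)" by (rule *(3))
qed

lemma natural_points_Union: "natural_points W U T = (\<Union>V\<in>\<V> - {{}}. natural_points (open_cone V) U T)"
proof -
  have "natural_points (open_cone {}) U T = {}" by (auto simp: natural_points_def open_cone_def comb_def)
  moreover have "natural_points W U T = (\<Union>V\<in>\<V>. natural_points (open_cone V) U T)"
    using part by (auto simp: cone_partition_def natural_points_def)
  ultimately show ?thesis by blast
qed

lemma finite_natural_points: "finite (natural_points W U T)"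
  unfolding natural_points_Union using finite_partition cone_asymp(3) by blast

lemma sum_natural_points:
  "(\<Sum>x\<in>natural_points W U T. F x) = (\<Sum>V\<in>\<V> - {{}}. \<Sum>x\<in>natural_points (open_cone V) U T. F x)"
  unfolding natural_points_Union
proof (rule sum.UNION_disjoint)
  show "\<forall>V\<in>\<V> - {{}}. \<forall>V'\<in>\<V> - {{}}. V \<noteq> V' \<longrightarrow>
      natural_points (open_cone V) U T \<inter> natural_points (open_cone V') U T = {}"
  proof (intro ballI impI)
    fix V V' assume "V \<in> \<V> - {{}}" "V' \<in> \<V> - {{}}" "V \<noteq> V'"
    then have "open_cone V \<inter> open_cone V' = {}" using part unfolding cone_partition_def by simp
    then show "natural_points (open_cone V) U T \<inter> natural_points (open_cone V') U T = {}"
      by (auto simp: natural_points_def)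
  qed
qed (use finite_partition cone_asymp(3) in auto)

text \<open>Cones with fewer than \<open>cone_dim\<close> generators contribute lower powers of
  \<open>T\<close> and drop out. The shift \<open>j\<close> is 0 for counts and 1 for sums of
  \<open>h\<close>.\<close>

lemma sum_natural_points_limit:
  assumes c: "\<And>V. V \<in> \<V> - {{}} \<Longrightarrow>
    (\<lambda>T. (\<Sum>x\<in>natural_points (open_cone V) U T. F x) / real T ^ (card V + j)) \<longlonglongrightarrow> c V"
  shows "(\<lambda>T. (\<Sum>x\<in>natural_points W U T. F x) / real T ^ (cone_dim + j))
    \<longlonglongrightarrow> (\<Sum>V\<in>\<V> - {{}}. if card V = cone_dim then c V else 0)"
proof -
  have "(\<lambda>T. (\<Sum>x\<in>natural_points (open_cone V) U T. F x) / real T ^ (cone_dim + j))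
      \<longlonglongrightarrow> (if card V = cone_dim then c V else 0)" if V: "V \<in> \<V> - {{}}" for V
  proof (cases "card V = cone_dim")
    case False
    then have "card V + j < cone_dim + j" using card_le_cone_dim[OF V] by simp
    from tendsto_divide_higher_power[OF c[OF V] this] False show ?thesis by simp
  qed (use c[OF V] in simp)
  then show ?thesis unfolding sum_natural_points sum_divide_distrib by (rule tendsto_sum)
qed

lemma card_natural_points_asymp:
  "\<exists>C>0. (\<lambda>T. real (card (natural_points W U T)) / real T ^ cone_dim) \<longlonglongrightarrow> C"
proof -
  obtain C where C: "\<And>V. V \<in> \<V> - {{}} \<Longrightarrow> C V > 0 \<and>
    (\<lambda>T. real (card (natural_points (open_cone V) U T)) / real T ^ card V) \<longlonglongrightarrow> C V"
    using cone_asymp(1) by metis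
  obtain V where V: "V \<in> \<V> - {{}}" "card V = cone_dim" using cone_dim_attained by blast
  have "(\<Sum>V\<in>\<V> - {{}}. if card V = cone_dim then C V else 0) > 0"
    by (rule sum_pos2[OF finite_partition(2) V(1)]) (use C V less_imp_le in auto)
  moreover have "(\<lambda>T. real (card (natural_points W U T)) / real T ^ cone_dim)
      \<longlonglongrightarrow> (\<Sum>V\<in>\<V> - {{}}. if card V = cone_dim then C V else 0)"
    using sum_natural_points_limit[of "\<lambda>_. 1" 0 C] C by simp
  ultimately show ?thesis by blast
qed

lemma sum_natural_points_asymp:
  "\<exists>G. (\<lambda>T. (\<Sum>x\<in>natural_points W U T. h x) / real T ^ Suc cone_dim) \<longlonglongrightarrow> G"
proof -
  have "\<exists>c. \<forall>V\<in>\<V> - {{}}.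
    (\<lambda>T. (\<Sum>x\<in>natural_points (open_cone V) U T. h x) / real T ^ Suc (card V)) \<longlonglongrightarrow> c V"
    by (intro bchoice ballI cone_asymp(2))
  then obtain c where "\<And>V. V \<in> \<V> - {{}} \<Longrightarrow>
    (\<lambda>T. (\<Sum>x\<in>natural_points (open_cone V) U T. h x) / real T ^ (card V + 1)) \<longlonglongrightarrow> c V"
    by (auto simp del: power_Suc)
  from sum_natural_points_limit[OF this] show ?thesis by (auto simp del: power_Suc)
qed

text \<open>Integral because \<open>U\<close> agrees with an integral form on the piece of
  \<open>x\<close>; positive because by \<open>bound\<close> it dominates a positive
  coordinate.\<close>

lemma natural_points_value:
  assumes "x \<in> natural_points W U T"
  shows "\<exists>b\<in>{1..T}. U x = real b"
proof -
  have x: "x \<in> W" "\<And>i. x i \<in> \<nat>" "x \<noteq> (\<lambda>_. 0)" "U x \<le> real T" using assms by (auto simp: natural_points_def)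
  obtain V where V: "V \<in> \<V>" "x \<in> open_cone V" using x(1) part by (auto simp: cone_partition_def)
  obtain f where "integral_form n f" "U x = f x" using U_linear[OF V(1)] V(2) by blast
  then have UZ: "U x \<in> \<int>" using integral_form_Ints x(2) Nats_subset_Ints by (metis subsetD)
  obtain i where "x i \<noteq> 0" using x(3) by auto
  then have "x i > 0" using x(2)[of i] by (auto elim!: Nats_cases)
  then have "K * U x > 0" using bound[OF x(1), of i] by linarith
  then have "U x > 0" using K_pos by (simp add: zero_less_mult_iff)
  with UZ obtain k :: int where k: "U x = of_int k" "k > 0" by (auto elim!: Ints_cases)
  then have "U x = real (nat k)" "nat k \<in> {1..T}" using x(4) by auto
  then show ?thesis by blast
qed

text \<open>Points are grouped by the integer value \<open>b\<close> of \<open>U\<close>. The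
  partial sums of the level sums \<open>g b\<close> are the known sums of \<open>h\<close>, and Abel
  summation inserts the factor \<open>1 / b\<close>.\<close>

lemma sum_natural_points_quotient_asymp:
  "\<exists>G. (\<lambda>T. (\<Sum>x\<in>natural_points W U T. h x / U x) / real T ^ cone_dim) \<longlonglongrightarrow> G"
proof -
  define g where "g b = (\<Sum>x\<in>{x\<in>natural_points W U b. U x = real b}. h x)" for b
  have level: "{x\<in>natural_points W U b. U x = real b} = {x\<in>natural_points W U T. U x = real b}" if "b \<le> T" for b T
    using that by (auto simp: natural_points_def)
  have lev: "(\<Sum>b=1..T. \<Sum>x\<in>{x\<in>natural_points W U b. U x = real b}. F x) = (\<Sum>x\<in>natural_points W U T. F x)"
    for T and F :: "_ \<Rightarrow> real"
  proof -
    have "(\<Sum>b=1..T. \<Sum>x\<in>{x\<in>natural_points W U b. U x = real b}. F x)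
        = (\<Sum>b=1..T. \<Sum>x\<in>{x\<in>natural_points W U T. U x = real b}. F x)"
      using level by (intro sum.cong) auto
    also have "\<dots> = (\<Sum>x\<in>(\<Union>b\<in>{1..T}. {x\<in>natural_points W U T. U x = real b}). F x)"
      using finite_natural_points by (subst sum.UNION_disjoint) auto
    also have "(\<Union>b\<in>{1..T}. {x\<in>natural_points W U T. U x = real b}) = natural_points W U T"
      using natural_points_value by blast
    finally show ?thesis .
  qed
  obtain k where k: "cone_dim = Suc k" using cone_dim_pos by (cases cone_dim) auto
  obtain G where "(\<lambda>T. (\<Sum>x\<in>natural_points W U T. h x) / real T ^ Suc (Suc k)) \<longlonglongrightarrow> G"
    using sum_natural_points_asymp unfolding k by blast
  then have "(\<lambda>T. (\<Sum>b=1..T. g b) / real T ^ Suc (Suc k)) \<longlonglongrightarrow> G" by (simp only: g_def lev)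
  from abel_summation_asymp[OF this]
  have "(\<lambda>T. (\<Sum>b=1..T. g b / real b) / real T ^ Suc k) \<longlonglongrightarrow> G + G / real (Suc k)" .
  moreover have "(\<Sum>b=1..T. g b / real b) = (\<Sum>x\<in>natural_points W U T. h x / U x)" for T
  proof -
    have "g b / real b = (\<Sum>x\<in>{x\<in>natural_points W U b. U x = real b}. h x / U x)" for b
      by (simp add: g_def sum_divide_distrib)
    then show ?thesis by (simp only: lev)
  qed
  ultimately show ?thesis unfolding k by auto
qed

end

section \<open>Primitive points\<close>

text \<open>Natural entries with greatest common divisor 1; the zero vector fails already at
  \<open>k = 2\<close>.\<close>

definition primitive :: "(nat \<Rightarrow> real) \<Rightarrow> bool" where
  "primitive x \<longleftrightarrow> (\<forall>i. x i \<in> \<nat>) \<and> (\<forall>k::nat. k \<ge> 1 \<longrightarrow> (\<forall>i. x i / real k \<in> \<nat>) \<longrightarrow> k = 1)"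

definition primitive_points :: "(nat \<Rightarrow> real) set \<Rightarrow> ((nat \<Rightarrow> real) \<Rightarrow> real) \<Rightarrow> nat \<Rightarrow> (nat \<Rightarrow> real) set" where
  "primitive_points A U T = {x \<in> A. primitive x \<and> U x \<le> real T}"

lemma primitive_nonzero: "primitive x \<Longrightarrow> x \<noteq> (\<lambda>_. 0)"
proof
  assume "primitive x" "x = (\<lambda>_. 0)"
  then have "(2::nat) = 1" unfolding primitive_def by (elim conjE allE[of _ 2]) auto
  then show False by simp
qed

text \<open>Division by the largest common divisor of the entries; any nonzero entry bounds the
  candidates.\<close>

lemma ex_primitive_multiple:
  assumes x: "\<And>i. x i \<in> \<nat>" "x \<noteq> (\<lambda>_. 0)"
  shows "\<exists>k\<ge>1. \<exists>p. primitive p \<and> x = (\<lambda>i. real k * p i)"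
proof -
  obtain j where "x j \<noteq> 0" using x(2) by auto
  then obtain m where m: "x j = real m" "m > 0" using x(1)[of j] by (auto elim!: Nats_cases)
  define P where "P k \<longleftrightarrow> k \<ge> 1 \<and> (\<forall>i. x i / real k \<in> \<nat>)" for k :: nat
  have "k \<le> m" if k: "P k" for k
  proof -
    have "x j / real k \<in> \<nat>" using k by (simp add: P_def)
    then obtain q where "x j / real k = real q" by (auto elim: Nats_cases)
    then have "real m = real (q * k)" using k m by (simp add: P_def field_simps)
    then have "m = q * k" by (simp only: of_nat_eq_iff)
    then show ?thesis using m by simp
  qed
  then have le: "\<forall>k. P k \<longrightarrow> k \<le> m" by blast
  have P1: "P 1" using x(1) by (simp add: P_def)
  define k where "k = Greatest P"
  have k: "P k" "P l \<Longrightarrow> l \<le> k" for l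
    unfolding k_def using le P1 by (metis GreatestI_nat, metis Greatest_le_nat)
  have "primitive (\<lambda>i. x i / real k)"
    unfolding primitive_def
  proof (intro conjI allI impI)
    show "x i / real k \<in> \<nat>" for i using k(1) by (simp add: P_def)
    fix l :: nat assume l: "1 \<le> l" "\<forall>i. x i / real k / real l \<in> \<nat>"
    then have "P (k * l)" using k(1) by (auto simp: P_def)
    then have "k * l \<le> k" by (rule k(2))
    then show "l = 1" using l(1) k(1) by (simp add: P_def)
  qed
  then show ?thesis using k(1)
    by (intro exI[of _ k]) (auto simp: P_def intro!: exI[of _ "\<lambda>i. x i / real k"])
qed

text \<open>With \<open>k / l = a / b\<close> in lowest terms, \<open>a * p i = b * q i\<close>
  makes \<open>b\<close> divide every entry of \<open>p\<close> and \<open>a\<close> every entry of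
  \<open>q\<close>, so both are 1.\<close>

lemma primitive_multiple_unique:
  assumes p: "primitive p" and q: "primitive q" and k: "k \<ge> 1" "l \<ge> 1"
    and eq: "(\<lambda>i. real k * p i) = (\<lambda>i. real l * q i)"
  shows "k = l \<and> p = q"
proof -
  have half: "a = 1"
    if p: "primitive p" and ab: "coprime a b" "a \<ge> 1" and eq: "\<And>i. real b * p i = real a * q i"
      and q: "primitive q" for p q and a b :: nat
  proof -
    have "p i / real a \<in> \<nat>" for i
    proof -
      obtain m m' where m: "p i = real m" "q i = real m'"
        using p q unfolding primitive_def by (metis Nats_cases)
      then have "real (b * m) = real (a * m')" using eq[of i] by simp
      then have "b * m = a * m'" by (simp only: of_nat_eq_iff)
      then have "a dvd m" using ab(1) by (metis coprime_dvd_mult_right_iff dvd_triv_left)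
      then show ?thesis using m ab(2) by (auto elim!: dvdE)
    qed
    then show ?thesis using p ab(2) unfolding primitive_def by blast
  qed
  define a b where "a = k div gcd k l" and "b = l div gcd k l"
  have g: "gcd k l > 0" using k by simp
  have kl: "k = gcd k l * a" "l = gcd k l * b" by (simp_all add: a_def b_def)
  have "a \<noteq> 0" "b \<noteq> 0" using kl k by (auto intro!: Nat.gr0I)
  moreover have "coprime a b" unfolding a_def b_def using k by (intro div_gcd_coprime) auto
  ultimately have ab: "k = gcd k l * a" "l = gcd k l * b" "coprime a b" "a \<ge> 1" "b \<ge> 1"
    using kl by auto
  have "real (gcd k l) * (real a * p i) = real (gcd k l) * (real b * q i)" for i
    using fun_cong[OF eq, of i] ab(1,2) by (metis mult.assoc of_nat_mult)
  moreover have "real (gcd k l) \<noteq> 0" using g by (metis of_nat_eq_0_iff less_irrefl)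
  ultimately have eq': "real a * p i = real b * q i" for i by (metis mult_left_cancel)
  have "b = 1" by (rule half[OF p _ ab(5) eq' q]) (use ab(3) in \<open>simp add: coprime_commute\<close>)
  moreover have "a = 1" by (rule half[OF q ab(3,4) eq'[symmetric] p])
  ultimately show ?thesis using ab(1,2) eq' by auto
qed

text \<open>Every counted point is \<open>k\<close> times \<open>p\<close> for a unique
  \<open>k\<close> and a unique primitive \<open>p\<close>. As \<open>U p\<close> is an integer,
  \<open>k * U p \<le> T\<close> means \<open>U p \<le> T div k\<close>, and \<open>F\<close> is
  constant along rays.\<close>

lemma sum_natural_points_primitive:
  assumes scale: "\<And>x c. x \<in> A \<Longrightarrow> c > 0 \<Longrightarrow> (\<lambda>i. c * x i) \<in> A \<and> U (\<lambda>i. c * x i) = c * U x \<and> F (\<lambda>i. c * x i) = (F x :: real)"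
    and fin: "\<And>T. finite (natural_points A U T)"
    and val: "\<And>x T. x \<in> natural_points A U T \<Longrightarrow> \<exists>b\<in>{1..T}. U x = real b"
  shows "(\<Sum>x\<in>natural_points A U T. F x) = (\<Sum>k=1..T. \<Sum>p\<in>primitive_points A U (T div k). F p)"
    and "finite (primitive_points A U T)"
proof -
  have sub: "primitive_points A U T \<subseteq> natural_points A U T" for T
    using primitive_nonzero by (auto simp: primitive_points_def natural_points_def) (auto simp: primitive_def)
  show finp: "finite (primitive_points A U T)" for T using finite_subset[OF sub fin] .
  define S where "S = (SIGMA k:{1..T}. primitive_points A U (T div k))"
  have bij: "bij_betw (\<lambda>(k, p) i. real k * p i) S (natural_points A U T)"
  proof (rule bij_betwI')
    show "((case c of (k, p) \<Rightarrow> \<lambda>i. real k * p i) = (case d of (k, p) \<Rightarrow> \<lambda>i. real k * p i)) = (c = d)"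
      if "c \<in> S" "d \<in> S" for c d
      using that primitive_multiple_unique by (auto simp: S_def primitive_points_def)
    show "(case c of (k, p) \<Rightarrow> \<lambda>i. real k * p i) \<in> natural_points A U T" if cS: "c \<in> S" for c
    proof -
      obtain k p where c: "c = (k, p)" "k \<in> {1..T}" "p \<in> primitive_points A U (T div k)"
        using cS by (auto simp: S_def)
      then have p: "p \<in> A" "primitive p" "U p \<le> real (T div k)" by (auto simp: primitive_points_def)
      have "real k * U p \<le> real k * real (T div k)" using p(3) by (intro mult_left_mono) auto
      also have "\<dots> \<le> real T" by (metis of_nat_le_iff of_nat_mult times_div_less_eq_dividend)
      finally have "U (\<lambda>i. real k * p i) \<le> real T" using scale[OF p(1), of "real k"] c(2) by simp
      moreover have "(\<lambda>i. real k * p i) \<noteq> (\<lambda>_. 0)"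
        using primitive_nonzero[OF p(2)] c(2) by (auto simp: fun_eq_iff)
      ultimately show ?thesis using scale[OF p(1), of "real k"] c p(2)
        by (auto simp: natural_points_def primitive_def)
    qed
    show "\<exists>c\<in>S. x = (case c of (k, p) \<Rightarrow> \<lambda>i. real k * p i)" if x: "x \<in> natural_points A U T" for x
    proof -
      obtain k p where p: "k \<ge> 1" "primitive p" "x = (\<lambda>i. real k * p i)"
        using ex_primitive_multiple[of x] x by (auto simp: natural_points_def)
      have xA: "x \<in> A" "U x \<le> real T" using x by (auto simp: natural_points_def)
      have px: "p = (\<lambda>i. 1 / real k * x i)" using p(1,3) by auto
      then have pA: "p \<in> A" using scale[OF xA(1), of "1 / real k"] p(1) by simp
      have Ux: "U x = real k * U p" using scale[OF pA, of "real k"] p(1,3) by simp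
      \<comment> \<open>The level is rounded up merely to make \<open>val\<close> applicable, which
        shows that \<open>U p\<close> is an integer.\<close>
      have "p \<in> natural_points A U (nat \<lceil>U p\<rceil>)"
        using pA p(2) primitive_nonzero[OF p(2)] by (auto simp: natural_points_def primitive_def real_nat_ceiling_ge)
      from val[OF this] obtain b where b: "b \<ge> 1" "U p = real b" by auto
      have "real (b * k) \<le> real T" using Ux xA(2) b by (simp add: mult.commute)
      then have "b * k \<le> T" by (simp only: of_nat_le_iff)
      then have "b \<le> T div k" using p(1) by (simp add: less_eq_div_iff_mult_less_eq)
      moreover have "k \<le> b * k" using b by simp
      then have "k \<le> T" using \<open>b * k \<le> T\<close> by linarith
      ultimately have "(k, p) \<in> S" using pA p b by (simp add: S_def primitive_points_def)
      then show ?thesis using p(3) by (intro bexI[of _ "(k, p)"]) auto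
    qed
  qed
  have "(\<Sum>k=1..T. \<Sum>p\<in>primitive_points A U (T div k). F p) = (\<Sum>(k, p)\<in>S. F p)"
    unfolding S_def using finp by (subst sum.Sigma) auto
  also have "\<dots> = (\<Sum>c\<in>S. F (case c of (k, p) \<Rightarrow> \<lambda>i. real k * p i))"
    using scale by (intro sum.cong refl) (auto simp: S_def primitive_points_def)
  also have "\<dots> = (\<Sum>x\<in>natural_points A U T. F x)"
    by (rule sum.reindex_bij_betw[OF bij])
  finally show "(\<Sum>x\<in>natural_points A U T. F x) = (\<Sum>k=1..T. \<Sum>p\<in>primitive_points A U (T div k). F p)" by simp
qed

context cone_decomposition
begin

text \<open>Integer points of a unimodular ray are integer multiples of its generator, so no other
  point of the ray can be primitive.\<close>

lemma card_primitive_cone_le_1: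
  assumes V: "V \<in> \<V>" "card V \<le> 1"
  shows "{x \<in> open_cone V. primitive x} \<subseteq> V"
proof
  fix x assume "x \<in> {x \<in> open_cone V. primitive x}"
  then obtain t where x: "x = comb V t" "\<And>w. w \<in> V \<Longrightarrow> t w > 0" "primitive x" by (auto simp: open_cone_def)
  have uV: "unimodular V" by (rule cone_partition_unimodular[OF part V(1)])
  have "V \<noteq> {}" using x(1) primitive_nonzero[OF x(3)] by (auto simp: comb_def)
  then have "card V = 1" using V(2) unimodularD(1)[OF uV] by (simp add: le_Suc_eq)
  then obtain w where w: "V = {w}" by (auto simp: card_1_singleton_iff)
  have xw: "x = (\<lambda>i. t w * w i)" using x(1) by (simp add: w comb_def)
  have "comb V t i \<in> \<int>" for i using x(1,3) Nats_subset_Ints by (auto simp: primitive_def)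
  from unimodularD(3)[OF uV this] have "t w \<in> \<int>" by (simp add: w)
  then obtain m :: int where m: "t w = of_int m" by (auto elim: Ints_cases)
  have mpos: "m > 0" using x(2)[of w] m w by simp
  have "x i / real (nat m) \<in> \<nat>" for i
    using mpos unimodularD(2)[OF uV, of w i] w by (simp add: xw m)
  then have "nat m = 1" using x(3) mpos unfolding primitive_def by auto
  then have "m = 1" using mpos by linarith
  then have "x = w" by (simp add: xw m)
  then show "x \<in> V" using w by simp
qed

text \<open>If all pieces were rays or the origin, the finitely many generators would exhaust the
  primitive points. The bound secures the convergence of the zeta series.\<close>

lemma cone_dim_ge_2:
  assumes "infinite {x \<in> W. primitive x}"
  shows "cone_dim \<ge> 2"
proof (rule ccontr)
  assume "\<not> cone_dim \<ge> 2"
  then have "card V \<le> 1" if "V \<in> \<V>" for V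
    using card_le_cone_dim[of V] that by (cases "V = {}") auto
  then have "{x \<in> W. primitive x} \<subseteq> \<Union>\<V>"
    using card_primitive_cone_le_1 part by (fastforce simp: cone_partition_def)
  moreover have "finite (\<Union>\<V>)"
    using finite_partition part unimodularD(1) by (auto simp: cone_partition_def)
  ultimately show False using assms finite_subset by blast
qed

text \<open>The sum of the generators of a nonempty piece, divided by the greatest common divisor of
  its entries.\<close>

lemma primitive_exists: "\<exists>x\<in>W. primitive x"
  if scale: "\<And>x c. x \<in> W \<Longrightarrow> c > 0 \<Longrightarrow> (\<lambda>i. c * x i) \<in> W"
proof -
  obtain V where V: "V \<in> \<V>" "V \<noteq> {}" using nonempty_partition by blast
  have uV: "unimodular V" by (rule cone_partition_unimodular[OF part V(1)])
  define x where "x = comb V (\<lambda>_. 1)"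
  have "x i \<in> \<nat>" for i unfolding x_def comb_def using unimodularD(2)[OF uV] by (intro sum_in_Nats) auto
  moreover have "x \<noteq> (\<lambda>_. 0)"
  proof
    assume "x = (\<lambda>_. 0)"
    then have eq: "comb V (\<lambda>_. 1) = comb V (\<lambda>_. 0)" by (simp add: x_def comb_def)
    show False using unimodular_independent[OF uV eq] V(2) by auto
  qed
  ultimately obtain k p where p: "k \<ge> 1" "primitive p" "x = (\<lambda>i. real k * p i)"
    using ex_primitive_multiple by blast
  have "x \<in> open_cone V" unfolding x_def by (rule open_coneI) simp
  then have "x \<in> W" using cone_partition_subset[OF part V(1)] by blast
  from scale[OF this, of "1 / real k"] have "p \<in> W" using p(1,3) by simp
  then show ?thesis using p(2) by blast
qed

text \<open>Passing to primitive points divides both leading coefficients by the same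
  \<open>\<zeta>\<close>, so the exponent stays common and the factor cancels in
  \<open>L / C\<close>.\<close>

lemma primitive_asymp:
  assumes scale: "\<And>x c. x \<in> W \<Longrightarrow> c > 0 \<Longrightarrow>
      (\<lambda>i. c * x i) \<in> W \<and> U (\<lambda>i. c * x i) = c * U x \<and> h (\<lambda>i. c * x i) = c * h x"
    and nonneg: "\<And>x. x \<in> W \<Longrightarrow> h x \<ge> 0"
    and inf: "infinite {x \<in> W. primitive x}"
  shows "\<exists>d L C. C > 0 \<and> (\<lambda>T. real (card (primitive_points W U T)) / real T ^ d) \<longlonglongrightarrow> C
    \<and> (\<lambda>T. (\<Sum>p\<in>primitive_points W U T. h p / U p) / real T ^ d) \<longlonglongrightarrow> L"
proof -
  define \<zeta> :: real where "\<zeta> = (\<Sum>k. 1 / real (Suc k) ^ cone_dim)"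
  have d: "cone_dim \<ge> 2" by (rule cone_dim_ge_2[OF inf])
  have \<zeta>: "\<zeta> > 0" unfolding \<zeta>_def by (rule suminf_pos[OF summable_inverse_Suc_power[OF d]]) simp
  have inversion: "(\<lambda>T. (\<Sum>p\<in>primitive_points W U T. F p) / real T ^ cone_dim) \<longlonglongrightarrow> c / \<zeta>"
    if hom: "\<And>x c. x \<in> W \<Longrightarrow> c > 0 \<Longrightarrow> F (\<lambda>i. c * x i) = F x"
      and F: "\<And>x. x \<in> W \<Longrightarrow> primitive x \<Longrightarrow> F x \<ge> 0"
      and lim: "(\<lambda>T. (\<Sum>x\<in>natural_points W U T. F x) / real T ^ cone_dim) \<longlonglongrightarrow> c" for F :: "_ \<Rightarrow> real" and c
    unfolding \<zeta>_def
  proof (rule divisor_sum_inversion[OF d _ _ _ lim])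
    show "(\<Sum>p\<in>primitive_points W U T. F p) \<ge> 0" for T
      using F by (intro sum_nonneg) (auto simp: primitive_points_def)
    have "natural_points W U 0 = {}" using natural_points_value[of _ 0] by auto
    moreover have "primitive_points W U 0 \<subseteq> natural_points W U 0"
      using primitive_nonzero by (auto simp: primitive_points_def natural_points_def) (auto simp: primitive_def)
    ultimately show "(\<Sum>p\<in>primitive_points W U 0. F p) = 0" by simp
    show "(\<Sum>x\<in>natural_points W U T. F x) = (\<Sum>k=1..T. \<Sum>p\<in>primitive_points W U (T div k). F p)" for T
      by (rule sum_natural_points_primitive(1)[OF _ finite_natural_points natural_points_value])
        (use scale hom in auto)
  qed
  obtain C where C: "C > 0" "(\<lambda>T. real (card (natural_points W U T)) / real T ^ cone_dim) \<longlonglongrightarrow> C"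
    using card_natural_points_asymp by blast
  have "(\<lambda>T. real (card (primitive_points W U T)) / real T ^ cone_dim) \<longlonglongrightarrow> C / \<zeta>"
    using inversion[of "\<lambda>_. 1" C] C(2) by simp
  moreover obtain G where G: "(\<lambda>T. (\<Sum>x\<in>natural_points W U T. h x / U x) / real T ^ cone_dim) \<longlonglongrightarrow> G"
    using sum_natural_points_quotient_asymp by blast
  have "(\<lambda>T. (\<Sum>p\<in>primitive_points W U T. h p / U p) / real T ^ cone_dim) \<longlonglongrightarrow> G / \<zeta>"
  proof (rule inversion[OF _ _ G])
    show "h (\<lambda>i. c * x i) / U (\<lambda>i. c * x i) = h x / U x" if "x \<in> W" "c > 0" for x c
      using scale[OF that] that(2) by simp
    fix x assume x: "x \<in> W" "primitive x"
    have "x \<in> natural_points W U (nat \<lceil>U x\<rceil>)"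
      using x primitive_nonzero[OF x(2)] by (auto simp: natural_points_def primitive_def real_nat_ceiling_ge)
    then have "U x \<ge> 0" using natural_points_value by fastforce
    then show "h x / U x \<ge> 0" using nonneg[OF x(1)] by simp
  qed
  moreover have "C / \<zeta> > 0" using C \<zeta> by simp
  ultimately show ?thesis by blast
qed

end

text \<open>Between consecutive values of the denominator the partial sums are squeezed between the sums over
  full denominator levels.\<close>

lemma cesaro_mean_by_levels:
  fixes den :: "'s \<Rightarrow> nat" and F :: "'s \<Rightarrow> real" and e :: "nat \<Rightarrow> 's"
  assumes e: "bij_betw e {1..} D" and mono: "\<And>s t. 1 \<le> s \<Longrightarrow> s \<le> t \<Longrightarrow> den (e s) \<le> den (e t)"
    and fin: "\<And>T. finite {x \<in> D. den x \<le> T}"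
    and F: "\<And>x. x \<in> D \<Longrightarrow> F x \<ge> 0"
    and C: "C > 0" "(\<lambda>T. real (card {x \<in> D. den x \<le> T}) / real T ^ d) \<longlonglongrightarrow> C"
    and L: "(\<lambda>T. (\<Sum>x | x \<in> D \<and> den x \<le> T. F x) / real T ^ d) \<longlonglongrightarrow> L"
  shows "(\<lambda>k. (\<Sum>t=1..k. F (e t)) / real k) \<longlonglongrightarrow> L / C"
proof -
  define N where "N T = real (card {x \<in> D. den x \<le> T})" for T
  define A where "A T = (\<Sum>x | x \<in> D \<and> den x \<le> T. F x)" for T
  define b where "b k = den (e k)" for k
  have inj: "inj_on e {1..}" and img: "e ` {1..} = D" using e by (auto simp: bij_betw_def)
  have injk: "inj_on e {1..k}" for k using inj by (rule inj_on_subset) auto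
  have up: "e ` {1..k} \<subseteq> {x \<in> D. den x \<le> b k}" for k
    using img mono by (auto simp: b_def)
  \<comment> \<open>States with denominator strictly below that of \<open>e k\<close> have all been
    listed by index \<open>k\<close>; those of equal denominator may come before or after.\<close>
  have low: "{x \<in> D. den x \<le> T} \<subseteq> e ` {1..k}" if "T < b k" "k \<ge> 1" for T k
  proof
    fix x assume x: "x \<in> {x \<in> D. den x \<le> T}"
    then obtain t where t: "t \<ge> 1" "x = e t" using img by auto
    have "t \<le> k"
    proof (rule ccontr)
      assume "\<not> t \<le> k"
      then have "b k \<le> den (e t)" unfolding b_def using that(2) by (intro mono) auto
      then show False using x t that by simp
    qed
    then show "x \<in> e ` {1..k}" using t by auto
  qed
  have sum_e: "(\<Sum>t=1..k. F (e t)) = (\<Sum>x\<in>e ` {1..k}. F x)" for k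
    using sum.reindex[OF injk, of F k] by simp
  have card_e: "card (e ` {1..k}) = k" for k using card_image[OF injk, of k] by simp
  \<comment> \<open>Finiteness of the levels forces the denominators to infinity, so limits in
    \<open>T\<close> may be taken along \<open>b k\<close>.\<close>
  have b_inf: "filterlim b at_top sequentially"
    unfolding filterlim_at_top
  proof
    fix Z
    have "card {x \<in> D. den x \<le> Z} < k \<Longrightarrow> Z \<le> b k" for k
    proof (rule ccontr)
      assume k: "card {x \<in> D. den x \<le> Z} < k" and "\<not> Z \<le> b k"
      then have "e ` {1..k} \<subseteq> {x \<in> D. den x \<le> Z}" using up[of k] by auto
      from card_mono[OF fin this] card_e k show False by simp
    qed
    then show "eventually (\<lambda>k. Z \<le> b k) sequentially"
      using eventually_gt_at_top by (metis (mono_tags, lifting) eventually_mono)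
  qed
  have q: "(\<lambda>T. real (T - 1) / real T) \<longlonglongrightarrow> 1"
  proof (rule Lim_transform_eventually)
    show "(\<lambda>T. 1 - inverse (real T)) \<longlonglongrightarrow> 1" using tendsto_diff[OF tendsto_const lim_inverse_n, of "1::real"] by simp
  qed (auto intro!: eventually_sequentiallyI[of 1] simp: of_nat_diff field_simps)
  \<comment> \<open>Power growth does not notice the step from \<open>T\<close> to
    \<open>T - 1\<close>, hence both sides of the final sandwich have the same limit.\<close>
  have shift: "(\<lambda>T. s (T - 1) / real T ^ d) \<longlonglongrightarrow> l" if "(\<lambda>T. s T / real T ^ d) \<longlonglongrightarrow> l" for s :: "nat \<Rightarrow> real" and l
  proof (rule Lim_transform_eventually)
    have "filterlim (\<lambda>T::nat. T - 1) at_top sequentially" by (rule filterlim_minus_const_nat_at_top)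
    from filterlim_compose[OF that this] have "(\<lambda>T. s (T - 1) / real (T - 1) ^ d) \<longlonglongrightarrow> l" .
    from tendsto_mult[OF this tendsto_power[OF q, of d]]
    show "(\<lambda>T. s (T - 1) / real (T - 1) ^ d * (real (T - 1) / real T) ^ d) \<longlonglongrightarrow> l" by simp
    show "\<forall>\<^sub>F T in sequentially. s (T - 1) / real (T - 1) ^ d * (real (T - 1) / real T) ^ d = s (T - 1) / real T ^ d"
    proof (rule eventually_sequentiallyI[of 2])
      fix T :: nat assume "T \<ge> 2"
      then have "real (T - 1) ^ d \<noteq> 0" by simp
      then show "s (T - 1) / real (T - 1) ^ d * (real (T - 1) / real T) ^ d = s (T - 1) / real T ^ d"
        unfolding power_divide by (simp del: of_nat_diff)
    qed
  qed
  have ratio: "(\<lambda>k. r (b k) / s (b k)) \<longlonglongrightarrow> L / C"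
    if "(\<lambda>T. r T / real T ^ d) \<longlonglongrightarrow> L" "(\<lambda>T. s T / real T ^ d) \<longlonglongrightarrow> C" for r s :: "nat \<Rightarrow> real"
  proof -
    have "(\<lambda>T. r T / s T) \<longlonglongrightarrow> L / C"
    proof (rule Lim_transform_eventually)
      show "(\<lambda>T. (r T / real T ^ d) / (s T / real T ^ d)) \<longlonglongrightarrow> L / C"
        using that C(1) by (intro tendsto_divide) auto
      show "\<forall>\<^sub>F T in sequentially. (r T / real T ^ d) / (s T / real T ^ d) = r T / s T"
        by (rule eventually_sequentiallyI[of 1]) simp
    qed
    then show ?thesis by (rule filterlim_compose[OF _ b_inf])
  qed
  have NC: "(\<lambda>T. N T / real T ^ d) \<longlonglongrightarrow> C" using C(2) by (simp add: N_def)
  have AL: "(\<lambda>T. A T / real T ^ d) \<longlonglongrightarrow> L" using L by (simp add: A_def)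
  have A0: "A T \<ge> 0" for T unfolding A_def using F by (intro sum_nonneg) auto
  have ev: "eventually (\<lambda>T. N (T - 1) > 0) sequentially"
  proof -
    have "eventually (\<lambda>T. N (T - 1) / real T ^ d > 0) sequentially"
      using shift[OF NC] C(1) by (rule order_tendstoD)
    then show ?thesis by eventually_elim (auto simp: N_def zero_less_divide_iff)
  qed
  have bpos: "eventually (\<lambda>k. b k \<ge> 1 \<and> N (b k - 1) > 0) sequentially"
    using eventually_compose_filterlim[OF eventually_conj[OF eventually_ge_at_top[of 1] ev] b_inf] .
  \<comment> \<open>Numerator and denominator are estimated separately: the sum lies between
    \<open>A (b k - 1)\<close> and \<open>A (b k)\<close>, and \<open>k\<close> between
    \<open>N (b k - 1)\<close> and \<open>N (b k)\<close>.\<close>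
  show ?thesis
  proof (rule tendsto_sandwich)
    show "(\<lambda>k. A (b k - 1) / N (b k)) \<longlonglongrightarrow> L / C" by (rule ratio[OF shift[OF AL] NC])
    show "(\<lambda>k. A (b k) / N (b k - 1)) \<longlonglongrightarrow> L / C" by (rule ratio[OF AL shift[OF NC]])
    have main: "A (b k - 1) \<le> (\<Sum>t=1..k. F (e t)) \<and> (\<Sum>t=1..k. F (e t)) \<le> A (b k)
        \<and> N (b k - 1) \<le> real k \<and> real k \<le> N (b k)"
      if k: "k \<ge> 1" and bk: "b k \<ge> 1" for k
    proof (intro conjI)
      have lo: "{x \<in> D. den x \<le> b k - 1} \<subseteq> e ` {1..k}" by (rule low) (use k bk in auto)
      show "A (b k - 1) \<le> (\<Sum>t=1..k. F (e t))"
        unfolding sum_e A_def using lo F img by (intro sum_mono2) auto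
      show "(\<Sum>t=1..k. F (e t)) \<le> A (b k)"
        unfolding sum_e A_def using up[of k] F fin by (intro sum_mono2) auto
      have "card {x \<in> D. den x \<le> b k - 1} \<le> k"
        using card_mono[OF _ lo] card_e[of k] by simp
      then show "N (b k - 1) \<le> real k" unfolding N_def by simp
      have "k \<le> card {x \<in> D. den x \<le> b k}"
        using card_mono[OF fin up[of k]] card_e[of k] by simp
      then show "real k \<le> N (b k)" unfolding N_def by simp
    qed
    show "\<forall>\<^sub>F k in sequentially. A (b k - 1) / N (b k) \<le> (\<Sum>t=1..k. F (e t)) / real k"
      using bpos eventually_ge_at_top[of 1]
    proof eventually_elim
      case (elim k)
      then show ?case using main[of k] A0[of "b k - 1"] by (intro frac_le) auto
    qed
    show "\<forall>\<^sub>F k in sequentially. (\<Sum>t=1..k. F (e t)) / real k \<le> A (b k) / N (b k - 1)"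
      using bpos eventually_ge_at_top[of 1]
    proof eventually_elim
      case (elim k)
      then show ?case using main[of k] A0[of "b k"] by (intro frac_le) auto
    qed
  qed
qed

section \<open>Presentations\<close>

text \<open>Congruences are also generated on the algebra of terms, which is no hoop; closure is all
  that may be assumed there.\<close>

definition closed_operations :: "('a, 'b) hoop_scheme \<Rightarrow> bool" where
  "closed_operations A \<longleftrightarrow> \<one>\<^bsub>A\<^esub> \<in> carrier A \<and>
     (\<forall>x\<in>carrier A. \<forall>y\<in>carrier A. x \<otimes>\<^bsub>A\<^esub> y \<in> carrier A \<and> x \<setminus>\<^bsub>A\<^esub> y \<in> carrier A)"

lemma hoop_congruence_kernel:
  assumes A: "closed_operations A"
    and f: "\<And>x y. x \<in> carrier A \<Longrightarrow> y \<in> carrier A \<Longrightarrow> f (x \<otimes>\<^bsub>A\<^esub> y) = p (f x) (f y)"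
      "\<And>x y. x \<in> carrier A \<Longrightarrow> y \<in> carrier A \<Longrightarrow> f (x \<setminus>\<^bsub>A\<^esub> y) = q (f x) (f y)"
  shows "hoop_congruence A {(x, y) \<in> carrier A \<times> carrier A. f x = f y}"
  using A unfolding hoop_congruence_def closed_operations_def
  by (auto intro!: equivI refl_onI symI transI simp: f)

lemma generated_congruence:
  assumes A: "closed_operations A" and R: "R \<subseteq> carrier A \<times> carrier A"
  shows "hoop_congruence A (generated_congruence A R)" "R \<subseteq> generated_congruence A R"
proof -
  \<comment> \<open>The total relation belongs to the intersected family and thereby confines the
    intersection to the carrier.\<close>
  have top: "hoop_congruence A (carrier A \<times> carrier A)"
    using A unfolding hoop_congruence_def closed_operations_def
    by (auto intro!: equivI refl_onI symI transI)
  show "R \<subseteq> generated_congruence A R" by (auto simp: generated_congruence_def)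
  have eq: "equiv (carrier A) \<theta>" if "hoop_congruence A \<theta>" for \<theta>
    using that by (simp add: hoop_congruence_def)
  have "equiv (carrier A) (generated_congruence A R)"
  proof (rule equivI)
    show "generated_congruence A R \<subseteq> carrier A \<times> carrier A"
      using top R by (auto simp: generated_congruence_def)
    show "refl_on (carrier A) (generated_congruence A R)"
      using eq by (auto simp: generated_congruence_def refl_on_def equiv_def)
    show "sym (generated_congruence A R)"
      using eq by (auto simp: generated_congruence_def sym_def equiv_def)
    show "trans (generated_congruence A R)"
      using eq unfolding generated_congruence_def trans_def equiv_def by blast
  qed
  then show "hoop_congruence A (generated_congruence A R)"
    unfolding hoop_congruence_def generated_congruence_def by blast
qed

lemma generated_congruence_least:
  "hoop_congruence A \<theta> \<Longrightarrow> R \<subseteq> \<theta> \<Longrightarrow> generated_congruence A R \<subseteq> \<theta>"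
  by (auto simp: generated_congruence_def)

lemma quotient_hoop_operations:
  assumes \<theta>: "hoop_congruence A \<theta>" and x: "x \<in> carrier A" "y \<in> carrier A"
  shows "\<theta> `` {x} \<otimes>\<^bsub>quotient_hoop A \<theta>\<^esub> \<theta> `` {y} = \<theta> `` {x \<otimes>\<^bsub>A\<^esub> y}"
    and "\<theta> `` {x} \<setminus>\<^bsub>quotient_hoop A \<theta>\<^esub> \<theta> `` {y} = \<theta> `` {x \<setminus>\<^bsub>A\<^esub> y}"
proof -
  have eq: "equiv (carrier A) \<theta>" using \<theta> by (simp add: hoop_congruence_def)
  have self: "x \<in> \<theta> `` {x}" "y \<in> \<theta> `` {y}" using equiv_class_self[OF eq] x by auto
  have "\<theta> `` {x' \<otimes>\<^bsub>A\<^esub> y'} = \<theta> `` {x \<otimes>\<^bsub>A\<^esub> y} \<and> \<theta> `` {x' \<setminus>\<^bsub>A\<^esub> y'} = \<theta> `` {x \<setminus>\<^bsub>A\<^esub> y}"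
    if "x' \<in> \<theta> `` {x}" "y' \<in> \<theta> `` {y}" for x' y'
  proof -
    have "(x \<otimes>\<^bsub>A\<^esub> y, x' \<otimes>\<^bsub>A\<^esub> y') \<in> \<theta> \<and> (x \<setminus>\<^bsub>A\<^esub> y, x' \<setminus>\<^bsub>A\<^esub> y') \<in> \<theta>"
      using \<theta> that unfolding hoop_congruence_def by blast
    then show ?thesis using equiv_class_eq[OF eq] by metis
  qed
  then have "(\<Union>x'\<in>\<theta> `` {x}. \<Union>y'\<in>\<theta> `` {y}. \<theta> `` {x' \<otimes>\<^bsub>A\<^esub> y'}) = (\<Union>x'\<in>\<theta> `` {x}. \<Union>y'\<in>\<theta> `` {y}. \<theta> `` {x \<otimes>\<^bsub>A\<^esub> y})"
    "(\<Union>x'\<in>\<theta> `` {x}. \<Union>y'\<in>\<theta> `` {y}. \<theta> `` {x' \<setminus>\<^bsub>A\<^esub> y'}) = (\<Union>x'\<in>\<theta> `` {x}. \<Union>y'\<in>\<theta> `` {y}. \<theta> `` {x \<setminus>\<^bsub>A\<^esub> y})"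
    by (intro SUP_cong refl; simp)+
  then show "\<theta> `` {x} \<otimes>\<^bsub>quotient_hoop A \<theta>\<^esub> \<theta> `` {y} = \<theta> `` {x \<otimes>\<^bsub>A\<^esub> y}"
    "\<theta> `` {x} \<setminus>\<^bsub>quotient_hoop A \<theta>\<^esub> \<theta> `` {y} = \<theta> `` {x \<setminus>\<^bsub>A\<^esub> y}"
    unfolding quotient_hoop_def using self by (simp_all, blast+)
qed

lemma quotient_hoop_carrier: "carrier (quotient_hoop A \<theta>) = (\<lambda>x. \<theta> `` {x}) ` carrier A"
  by (auto simp: quotient_hoop_def quotient_def)

lemma closed_operations_quotient:
  assumes \<theta>: "hoop_congruence A \<theta>" and A: "closed_operations A"
  shows "closed_operations (quotient_hoop A \<theta>)"
  using A unfolding closed_operations_def quotient_hoop_carrier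
  by (auto simp: quotient_hoop_operations[OF \<theta>]) (auto simp: quotient_hoop_def)

lemma closed_operations_term_hoop: "closed_operations (term_hoop X)"
  by (simp add: closed_operations_def term_hoop_def)

lemma hoop_identities_vars: "hoop_identities X \<subseteq> carrier (term_hoop X) \<times> carrier (term_hoop X)"
proof (rule subrelI)
  fix a b assume "(a, b) \<in> hoop_identities X"
  then show "(a, b) \<in> carrier (term_hoop X) \<times> carrier (term_hoop X)"
    by cases (auto simp: term_hoop_def)
qed

lemma eval_term_nonneg: "(\<And>i. x i \<ge> 0) \<Longrightarrow> eval_term x t \<ge> 0"
  by (induction t) auto

lemma hoop_identities_eval:
  assumes "(r, s) \<in> hoop_identities X" "\<And>i. x i \<ge> 0"
  shows "eval_term x r = eval_term x s"
proof -
  have nonneg: "eval_term x t \<ge> 0" for t by (rule eval_term_nonneg) (rule assms(2))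
  \<comment> \<open>Nonnegativity of \<open>c\<close> matters: for \<open>a < b\<close> and
    \<open>c < 0\<close> the left side is positive and the right side smaller.\<close>
  have m1: "max 0 (max 0 (a - b) - c) = max 0 (a - (b + c))" if "c \<ge> 0" for a b c :: real
    using that by linarith
  have m2: "a + max 0 (b - a) = b + max 0 (a - b)" for a b :: real by linarith
  from assms(1) show ?thesis by cases (simp_all add: m1 m2 nonneg)
qed

text \<open>Flattens the two successive quotients and the isomorphism into one map \<pi> on terms.
  Freeness survives as \<open>universal\<close>: a point satisfying the relations gives equal values
  to terms naming the same element.\<close>

locale presented_hoop =
  fixes H :: "('a, 'b) hoop_scheme" (structure)
    and n :: nat and R :: "(nat hoop_term \<times> nat hoop_term) set" and \<pi> :: "nat hoop_term \<Rightarrow> 'a"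
  assumes finite_relations: "finite R"
    and relation_vars: "(r, s) \<in> R \<Longrightarrow> vars r \<subseteq> {..<n} \<and> vars s \<subseteq> {..<n}"
    and relation_holds: "(r, s) \<in> R \<Longrightarrow> \<pi> r = \<pi> s"
    and onto: "\<pi> ` {t. vars t \<subseteq> {..<n}} = carrier H"
    and map_Zero: "\<pi> Zero = \<one>"
    and map_Plus: "vars s \<subseteq> {..<n} \<Longrightarrow> vars t \<subseteq> {..<n} \<Longrightarrow> \<pi> (Plus s t) = \<pi> s \<otimes> \<pi> t"
    and map_Monus: "vars s \<subseteq> {..<n} \<Longrightarrow> vars t \<subseteq> {..<n} \<Longrightarrow> \<pi> (Monus s t) = \<pi> s \<setminus> \<pi> t"
    and universal: "\<lbrakk>\<And>i. x i \<ge> 0; \<And>r s. (r, s) \<in> R \<Longrightarrow> eval_term x r = eval_term x s;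
      vars s \<subseteq> {..<n}; vars t \<subseteq> {..<n}; \<pi> s = \<pi> t\<rbrakk> \<Longrightarrow> eval_term x s = eval_term x t"

text \<open>Relations between classes of the free hoop are lifted to relations between terms by
  choosing representatives.\<close>

lemma finitely_presented_imp_presented_hoop:
  fixes H :: "('a, 'b) hoop_scheme"
  assumes "finitely_presented H"
  shows "\<exists>n R \<pi>. presented_hoop H n R \<pi>"
proof -
  obtain n :: nat and R \<phi> where R: "finite R" "R \<subseteq> carrier (free_hoop {..<n}) \<times> carrier (free_hoop {..<n})"
    and iso: "\<phi> \<in> hoop_iso (quotient_hoop (free_hoop {..<n}) (generated_congruence (free_hoop {..<n}) R)) H"
    using assms unfolding finitely_presented_def by blast
  define T where "T = term_hoop {..<n}"
  define \<theta> where "\<theta> = generated_congruence T (hoop_identities {..<n})"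
  define F where "F = free_hoop {..<n}"
  define \<eta> where "\<eta> = generated_congruence F R"
  define Q where "Q = quotient_hoop F \<eta>"
  have F: "F = quotient_hoop T \<theta>" by (simp add: F_def free_hoop_def T_def \<theta>_def)
  have Tc: "closed_operations T" by (simp add: T_def closed_operations_term_hoop)
  have \<theta>: "hoop_congruence T \<theta>" "hoop_identities {..<n} \<subseteq> \<theta>"
    using generated_congruence[OF Tc] hoop_identities_vars unfolding \<theta>_def T_def by blast+
  have Fc: "closed_operations F" unfolding F by (rule closed_operations_quotient[OF \<theta>(1) Tc])
  have \<eta>: "hoop_congruence F \<eta>" "R \<subseteq> \<eta>"
    using generated_congruence[OF Fc] R(2) unfolding \<eta>_def F_def by blast+
  have \<phi>: "bij_betw \<phi> (carrier Q) (carrier H)" "\<phi> \<one>\<^bsub>Q\<^esub> = \<one>\<^bsub>H\<^esub>"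
    "\<And>x y. x \<in> carrier Q \<Longrightarrow> y \<in> carrier Q \<Longrightarrow> \<phi> (x \<otimes>\<^bsub>Q\<^esub> y) = \<phi> x \<otimes>\<^bsub>H\<^esub> \<phi> y"
    "\<And>x y. x \<in> carrier Q \<Longrightarrow> y \<in> carrier Q \<Longrightarrow> \<phi> (x \<setminus>\<^bsub>Q\<^esub> y) = \<phi> x \<setminus>\<^bsub>H\<^esub> \<phi> y"
    using iso by (auto simp: hoop_iso_def hoop_hom_def hom_def Q_def F_def \<eta>_def)
  have Tcar: "carrier T = {t. vars t \<subseteq> {..<n}}" by (simp add: T_def term_hoop_def)
  define cl where "cl t = \<theta> `` {t}" for t
  define \<pi> where "\<pi> t = \<phi> (\<eta> `` {cl t})" for t
  define rep where "rep X = (SOME t. t \<in> carrier T \<and> cl t = X)" for X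
  have Fcar: "carrier F = cl ` carrier T" by (simp add: F quotient_hoop_carrier cl_def)
  have Qcar: "carrier Q = (\<lambda>X. \<eta> `` {X}) ` carrier F" by (simp add: Q_def quotient_hoop_carrier)
  have rep: "rep X \<in> carrier T \<and> cl (rep X) = X" if "X \<in> carrier F" for X
    unfolding rep_def by (rule someI_ex) (use that in \<open>auto simp: Fcar\<close>)
  have clF: "cl t \<in> carrier F" if "t \<in> carrier T" for t using that by (simp add: Fcar)
  have clQ: "\<eta> `` {cl t} \<in> carrier Q" if "t \<in> carrier T" for t using clF[OF that] by (simp add: Qcar)
  have cl_ops: "cl (Plus s t) = cl s \<otimes>\<^bsub>F\<^esub> cl t" "cl (Monus s t) = cl s \<setminus>\<^bsub>F\<^esub> cl t"
    if "s \<in> carrier T" "t \<in> carrier T" for s t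
    using quotient_hoop_operations[OF \<theta>(1) that, folded F] by (simp_all add: cl_def T_def term_hoop_def)
  define R' where "R' = (\<lambda>(X, Y). (rep X, rep Y)) ` R"
  have \<theta>eq: "equiv (carrier T) \<theta>" and \<eta>eq: "equiv (carrier F) \<eta>"
    using \<theta>(1) \<eta>(1) by (simp_all add: hoop_congruence_def)
  have "presented_hoop H n R' \<pi>"
  proof
    show "finite R'" using R(1) by (simp add: R'_def)
    show "vars r \<subseteq> {..<n} \<and> vars s \<subseteq> {..<n}" if rs: "(r, s) \<in> R'" for r s
      using rs rep R(2) by (fastforce simp: R'_def Tcar F_def)
    show "\<pi> r = \<pi> s" if rs: "(r, s) \<in> R'" for r s
    proof -
      obtain X Y where XY: "(X, Y) \<in> R" "r = rep X" "s = rep Y" using rs by (auto simp: R'_def)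
      then have "X \<in> carrier F" "Y \<in> carrier F" using R(2) by (auto simp: F_def)
      moreover have "\<eta> `` {X} = \<eta> `` {Y}" using equiv_class_eq[OF \<eta>eq] XY(1) \<eta>(2) by blast
      ultimately show ?thesis using rep XY by (simp add: \<pi>_def)
    qed
    show "\<pi> ` {t. vars t \<subseteq> {..<n}} = carrier H"
    proof -
      have "\<pi> ` carrier T = \<phi> ` carrier Q" by (auto simp: \<pi>_def Qcar Fcar)
      then show ?thesis using \<phi>(1) by (simp add: Tcar bij_betw_def)
    qed
    have "\<eta> `` {cl Zero} = \<one>\<^bsub>Q\<^esub>"
      by (simp add: Q_def quotient_hoop_def F cl_def T_def term_hoop_def)
    then show "\<pi> Zero = \<one>\<^bsub>H\<^esub>" by (simp add: \<pi>_def \<phi>(2))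
    fix s t assume "vars s \<subseteq> {..<n}" "vars t \<subseteq> {..<n}"
    then have st: "s \<in> carrier T" "t \<in> carrier T" by (simp_all add: Tcar)
    show "\<pi> (Plus s t) = \<pi> s \<otimes>\<^bsub>H\<^esub> \<pi> t"
      using quotient_hoop_operations(1)[OF \<eta>(1) clF[OF st(1)] clF[OF st(2)], folded Q_def]
        \<phi>(3)[OF clQ[OF st(1)] clQ[OF st(2)]] by (simp add: \<pi>_def cl_ops[OF st])
    show "\<pi> (Monus s t) = \<pi> s \<setminus>\<^bsub>H\<^esub> \<pi> t"
      using quotient_hoop_operations(2)[OF \<eta>(1) clF[OF st(1)] clF[OF st(2)], folded Q_def]
        \<phi>(4)[OF clQ[OF st(1)] clQ[OF st(2)]] by (simp add: \<pi>_def cl_ops[OF st])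
    fix x :: "nat \<Rightarrow> real" assume x: "\<And>i. x i \<ge> 0"
      and sat: "\<And>r s. (r, s) \<in> R' \<Longrightarrow> eval_term x r = eval_term x s" and eq: "\<pi> s = \<pi> t"
    \<comment> \<open>Minimality of the generated congruences is used twice: the kernel of
      evaluation on terms contains the hoop identities and so \<open>\<theta>\<close>; the kernel of
      the induced function \<open>f\<close> on the free hoop contains \<open>R\<close> and so
      \<open>\<eta>\<close>.\<close>
    have "hoop_congruence T {(r, s) \<in> carrier T \<times> carrier T. eval_term x r = eval_term x s}"
      by (rule hoop_congruence_kernel[OF Tc, where p = "(+)" and q = "\<lambda>a b. max 0 (a - b)"])
        (auto simp: T_def term_hoop_def)
    moreover have "hoop_identities {..<n} \<subseteq> {(r, s) \<in> carrier T \<times> carrier T. eval_term x r = eval_term x s}"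
      using hoop_identities_vars hoop_identities_eval[of _ _ _ x, OF _ x] unfolding T_def by blast
    ultimately have "\<theta> \<subseteq> {(r, s) \<in> carrier T \<times> carrier T. eval_term x r = eval_term x s}"
      unfolding \<theta>_def by (rule generated_congruence_least)
    then have \<theta>eval: "eval_term x r = eval_term x s" if "(r, s) \<in> \<theta>" for r s using that by blast
    define f where "f X = eval_term x (rep X)" for X
    have f: "f (cl t) = eval_term x t" if "t \<in> carrier T" for t
    proof -
      have "cl (rep (cl t)) = cl t" "rep (cl t) \<in> carrier T" using rep[OF clF[OF that]] by auto
      then have "(rep (cl t), t) \<in> \<theta>" using eq_equiv_class[OF _ \<theta>eq that] by (simp add: cl_def)
      then show ?thesis unfolding f_def by (rule \<theta>eval)
    qed
    have "hoop_congruence F {(X, Y) \<in> carrier F \<times> carrier F. f X = f Y}"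
    proof (rule hoop_congruence_kernel[OF Fc, where p = "(+)" and q = "\<lambda>a b. max 0 (a - b)"])
      fix X Y assume "X \<in> carrier F" "Y \<in> carrier F"
      then obtain r s where rs: "r \<in> carrier T" "s \<in> carrier T" "X = cl r" "Y = cl s" by (auto simp: Fcar)
      have "Plus r s \<in> carrier T" "Monus r s \<in> carrier T" using rs(1,2) by (auto simp: Tcar)
      then show "f (X \<otimes>\<^bsub>F\<^esub> Y) = f X + f Y" "f (X \<setminus>\<^bsub>F\<^esub> Y) = max 0 (f X - f Y)"
        using f rs cl_ops[OF rs(1,2)] by (metis eval_term.simps(3), metis eval_term.simps(4))
    qed
    moreover have "R \<subseteq> {(X, Y) \<in> carrier F \<times> carrier F. f X = f Y}"
    proof (rule subrelI)
      fix X Y assume XY: "(X, Y) \<in> R"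
      then have "(rep X, rep Y) \<in> R'" by (force simp: R'_def)
      then have "f X = f Y" unfolding f_def by (rule sat)
      then show "(X, Y) \<in> {(X, Y) \<in> carrier F \<times> carrier F. f X = f Y}"
        using XY R(2) by (auto simp: F_def)
    qed
    ultimately have "\<eta> \<subseteq> {(X, Y) \<in> carrier F \<times> carrier F. f X = f Y}"
      unfolding \<eta>_def by (rule generated_congruence_least)
    moreover have "\<eta> `` {cl s} = \<eta> `` {cl t}"
      using eq \<phi>(1) clQ st by (auto simp: \<pi>_def bij_betw_def dest: inj_onD)
    then have "(cl s, cl t) \<in> \<eta>" using eq_equiv_class[OF _ \<eta>eq clF[OF st(2)]] by blast
    ultimately show "eval_term x s = eval_term x t" using f st by auto
  qed
  then show ?thesis by blast
qed

section \<open>Discrete states as primitive points\<close>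

lemma real_hoop_simps [simp]:
  "carrier real_hoop = {0..}" "x \<otimes>\<^bsub>real_hoop\<^esub> y = x + y" "\<one>\<^bsub>real_hoop\<^esub> = 0"
  "x \<setminus>\<^bsub>real_hoop\<^esub> y = max 0 (x - y)"
  by (simp_all add: real_hoop_def)

lemma eval_term_scale:
  assumes "c \<ge> 0" shows "eval_term (\<lambda>i. c * x i) t = c * eval_term x t"
proof (induction t)
  case (Monus r s)
  have "max 0 (c * a - c * b) = c * max 0 (a - b)" for a b
    using assms max_mult_distrib_left[of c 0 "a - b"] by (simp add: right_diff_distrib)
  then show ?case using Monus by simp
qed (auto simp: distrib_left)

lemma eval_term_Nats:
  assumes "\<And>i. x i \<in> \<nat>" shows "eval_term x t \<in> \<nat>"
proof (induction t)
  case (Monus r s)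
  then obtain a b :: nat where "eval_term x r = real a" "eval_term x s = real b" by (auto elim!: Nats_cases)
  then have "eval_term x (Monus r s) = real (a - b)" by (simp add: max_def)
  then show ?case by simp
qed (auto simp: assms intro: Nats_add)

lemma solution_set_scale:
  assumes x: "x \<in> solution_set n R" and c: "c \<ge> 0"
  shows "(\<lambda>i. c * x i) \<in> solution_set n R"
proof -
  have "eval_term (\<lambda>i. c * x i) r = eval_term (\<lambda>i. c * x i) s" if "(r, s) \<in> R" for r s
    using x that by (auto simp: eval_term_scale[OF c] solution_set_def)
  then show ?thesis using x c by (auto simp: solution_set_def orthant_def)
qed

text \<open>\<open>1 / d\<close> being a multiple of \<open>1 / a\<close> forces \<open>d\<close> to
  divide \<open>a\<close>. This makes the description in \<open>denominator\<close>
  definite.\<close>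

lemma range_quotient_unique:
  fixes b c :: nat
  assumes "b \<ge> 1" "c \<ge> 1" and eq: "range (\<lambda>n::nat. real n / real b) = range (\<lambda>n::nat. real n / real c)"
  shows "b = c"
proof -
  have half: "d dvd a" if "a \<ge> 1" "d \<ge> 1" "range (\<lambda>n::nat. real n / real d) \<subseteq> range (\<lambda>n::nat. real n / real a)" for a d :: nat
  proof -
    have "1 / real d \<in> range (\<lambda>n::nat. real n / real d)" by (rule range_eqI[of _ _ 1]) simp
    then have "1 / real d \<in> range (\<lambda>n::nat. real n / real a)" using that(3) by blast
    then obtain k :: nat where "1 / real d = real k / real a" by blast
    then have "real a = real (k * d)" using that(1,2) by (simp add: field_simps)
    then have "a = k * d" by (simp only: of_nat_eq_iff)
    then show ?thesis by simp
  qed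
  show ?thesis using half[of b c] half[of c b] assms by (auto intro: dvd_antisym)
qed

text \<open>Two elements of a discrete positive cone differ by at least the isolation radius of \<open>0\<close>, so the
  infimum of the positive elements is attained.\<close>

lemma discrete_cone_cyclic:
  fixes M :: "real set"
  assumes nonneg: "M \<subseteq> {0..}" and one: "1 \<in> M"
    and plus: "\<And>x y. x \<in> M \<Longrightarrow> y \<in> M \<Longrightarrow> x + y \<in> M"
    and monus: "\<And>x y. x \<in> M \<Longrightarrow> y \<in> M \<Longrightarrow> max 0 (x - y) \<in> M"
    and discrete: "discrete M"
  shows "\<exists>b::nat. b \<ge> 1 \<and> M = range (\<lambda>n::nat. real n / real b)"
proof -
  have zero: "0 \<in> M" using monus[OF one one] by simp
  obtain \<epsilon> where \<epsilon>: "\<epsilon> > 0" "\<And>y. y \<in> M \<Longrightarrow> y < \<epsilon> \<Longrightarrow> y = 0"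
  proof -
    obtain \<epsilon> where "\<epsilon> > 0" "\<forall>y\<in>M. dist 0 y < \<epsilon> \<longrightarrow> y = 0"
      using discreteD[OF discrete zero] unfolding isolated_in_dist_Ex_iff by blast
    then show ?thesis using that[of \<epsilon>] nonneg by (force simp: dist_norm)
  qed
  define P where "P = {y\<in>M. y > 0}"
  have P: "P \<noteq> {}" "bdd_below P" using one by (auto simp: P_def intro!: bdd_belowI[of _ 0])
  \<comment> \<open>A positive \<open>y\<close> in \<open>M\<close> below \<open>\<delta>\<close>
    would leave the positive difference \<open>\<delta> - y\<close> in \<open>M\<close> below
    \<open>\<epsilon>\<close>; so this near-infimum is already the minimum.\<close>
  obtain \<delta> where \<delta>: "\<delta> \<in> P" "\<delta> < Inf P + \<epsilon>" using cInf_lessD[OF P(1), of "Inf P + \<epsilon>"] \<epsilon>(1) by auto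
  have min: "y \<ge> \<delta>" if y: "y \<in> M" "y > 0" for y
  proof (rule ccontr)
    assume "\<not> y \<ge> \<delta>"
    moreover have "Inf P \<le> y" using P y by (intro cInf_lower) (auto simp: P_def)
    moreover have "max 0 (\<delta> - y) \<in> M" using \<delta> y by (intro monus) (auto simp: P_def)
    ultimately show False using \<epsilon>(2)[of "max 0 (\<delta> - y)"] \<delta> by auto
  qed
  have \<delta>pos: "\<delta> > 0" "\<delta> \<in> M" using \<delta> by (auto simp: P_def)
  have mult: "real k * \<delta> \<in> M" for k
  proof (induction k)
    case (Suc k)
    then show ?case using plus[OF Suc \<delta>pos(2)] by (simp add: algebra_simps)
  qed (simp add: zero)
  \<comment> \<open>Division with remainder: the remainder lies in \<open>M\<close> and below
    \<open>\<delta>\<close>, hence is 0.\<close>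
  have M: "\<exists>k::nat. y = real k * \<delta>" if y: "y \<in> M" for y
  proof -
    define k where "k = nat \<lfloor>y / \<delta>\<rfloor>"
    have "y / \<delta> \<ge> 0" using y nonneg \<delta>pos by auto
    then have "real k \<le> y / \<delta>" "y / \<delta> < real k + 1" by (auto simp: k_def)
    then have k: "real k * \<delta> \<le> y" "y < real k * \<delta> + \<delta>" using \<delta>pos by (simp_all add: field_simps)
    have "max 0 (y - real k * \<delta>) \<in> M" using y mult by (rule monus)
    have "\<not> real k * \<delta> < y"
    proof
      assume less: "real k * \<delta> < y"
      then have "y - real k * \<delta> \<in> M" using \<open>max 0 (y - real k * \<delta>) \<in> M\<close> by simp
      from min[OF this] less k(2) show False by linarith
    qed
    then have "y = real k * \<delta>" using k(1) by linarith
    then show ?thesis by blast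
  qed
  \<comment> \<open>Since \<open>1\<close> is in \<open>M\<close>, the generator
    \<open>\<delta>\<close> is the reciprocal of an integer.\<close>
  obtain b :: nat where b: "1 = real b * \<delta>" using M[OF one] by blast
  then have bpos: "b \<ge> 1" by (cases b) auto
  have \<delta>b: "\<delta> = 1 / real b" using b bpos by (simp add: field_simps)
  have "M = range (\<lambda>n::nat. real n / real b)"
    using M mult by (auto simp: \<delta>b)
  then show ?thesis using bpos by blast
qed

lemma discrete_range_quotient:
  assumes "M \<subseteq> range (\<lambda>n::nat. real n / real b)"
  shows "discrete M"
proof (cases "b = 0")
  \<comment> \<open>Division by zero collapses the range to the point 0.\<close>
  case True
  then have "M \<subseteq> {0}" using assms by auto
  then have "M = {} \<or> M = {0}" by blast
  then show ?thesis unfolding discrete_def isolated_in_dist_Ex_iff by (auto intro: zero_less_one)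
next
  case False
  show ?thesis
  proof (rule discreteI)
    fix x assume x: "x \<in> M"
    show "x isolated_in M"
      unfolding isolated_in_dist_Ex_iff
    proof (intro conjI exI[of _ "1 / real b"] ballI impI x)
      show "1 / real b > 0" using False by simp
      fix y assume y: "y \<in> M" "dist x y < 1 / real b"
      obtain k l :: nat where kl: "x = real k / real b" "y = real l / real b" using x y assms by blast
      have "\<bar>real k - real l\<bar> < 1"
        using y(2) False by (simp add: kl dist_norm diff_divide_distrib[symmetric] abs_divide divide_less_cancel)
      then show "y = x" using kl by auto
    qed
  qed
qed

section \<open>The correspondence between points and states\<close>

locale unital_presented_hoop = presented_hoop H n R \<pi> + cancellative_hoop H
  for H :: "('a, 'b) hoop_scheme" (structure) and n R \<pi> +
  fixes u :: 'a and \<upsilon> :: "nat hoop_term"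
  assumes unit: "hoop_unit H u" and \<upsilon>: "vars \<upsilon> \<subseteq> {..<n}" "\<pi> \<upsilon> = u"
begin

abbreviation W :: "(nat \<Rightarrow> real) set" where "W \<equiv> solution_set n R"

abbreviation U :: "(nat \<Rightarrow> real) \<Rightarrow> real" where "U x \<equiv> eval_term x \<upsilon>"

lemma W_nonneg: "x \<in> W \<Longrightarrow> x i \<ge> 0" and W_outside: "x \<in> W \<Longrightarrow> i \<ge> n \<Longrightarrow> x i = 0"
  by (auto simp: solution_set_def orthant_def)

lemma ex_term:
  assumes "h \<in> carrier H" shows "\<exists>t. vars t \<subseteq> {..<n} \<and> h = \<pi> t"
proof -
  have "h \<in> \<pi> ` {t. vars t \<subseteq> {..<n}}" using assms onto by simp
  then show ?thesis by blast
qed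

definition some_term :: "'a \<Rightarrow> nat hoop_term" where
  "some_term h = (SOME t. vars t \<subseteq> {..<n} \<and> \<pi> t = h)"

lemma some_term:
  assumes "h \<in> carrier H" shows "vars (some_term h) \<subseteq> {..<n} \<and> \<pi> (some_term h) = h"
proof -
  obtain t where "vars t \<subseteq> {..<n} \<and> \<pi> t = h" using ex_term[OF assms] by blast
  then show ?thesis unfolding some_term_def by (rule someI)
qed

text \<open>The choice of term is immaterial at points of \<open>W\<close>, by
  \<open>universal\<close>.\<close>

definition eval_hom :: "(nat \<Rightarrow> real) \<Rightarrow> 'a \<Rightarrow> real" where
  "eval_hom x h = eval_term x (some_term h)"

lemma map_closed: "vars t \<subseteq> {..<n} \<Longrightarrow> \<pi> t \<in> carrier H"
  using onto by auto

lemma eval_hom_map: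
  assumes "x \<in> W" "vars t \<subseteq> {..<n}" shows "eval_hom x (\<pi> t) = eval_term x t"
proof -
  have t': "vars (some_term (\<pi> t)) \<subseteq> {..<n} \<and> \<pi> (some_term (\<pi> t)) = \<pi> t"
    by (rule some_term) (rule map_closed[OF assms(2)])
  show ?thesis unfolding eval_hom_def
    by (rule universal) (use assms t' in \<open>auto simp: solution_set_def orthant_def\<close>)
qed

lemma eval_hom_nonneg: "x \<in> W \<Longrightarrow> eval_hom x h \<ge> 0"
  unfolding eval_hom_def by (rule eval_term_nonneg) (rule W_nonneg)

lemma eval_hom:
  assumes x: "x \<in> W" shows "eval_hom x \<in> hoop_hom H real_hoop"
proof -
  have "eval_hom x (g \<otimes> h) = eval_hom x g + eval_hom x h \<and> eval_hom x (g \<setminus> h) = max 0 (eval_hom x g - eval_hom x h)"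
    if gh: "g \<in> carrier H" "h \<in> carrier H" for g h
  proof -
    obtain s t where st: "vars s \<subseteq> {..<n}" "vars t \<subseteq> {..<n}" "g = \<pi> s" "h = \<pi> t"
      using some_term[OF gh(1)] some_term[OF gh(2)] by metis
    then have v: "vars (Plus s t) \<subseteq> {..<n}" "vars (Monus s t) \<subseteq> {..<n}" by auto
    show ?thesis
      using eval_hom_map[OF x v(1)] eval_hom_map[OF x v(2)] eval_hom_map[OF x st(1)] eval_hom_map[OF x st(2)]
      by (simp add: st map_Plus map_Monus)
  qed
  moreover have "eval_hom x \<one> = 0" using eval_hom_map[OF x, of Zero] by (simp add: map_Zero)
  ultimately show ?thesis using eval_hom_nonneg[OF x] by (auto simp: hoop_hom_def hom_def)
qed

lemma hom_nat_pow:
  assumes e: "e \<in> hoop_hom H real_hoop" and h: "h \<in> carrier H"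
  shows "e (h [^] (k::nat)) = real k * e h"
proof (induction k)
  case (Suc k)
  then show ?case using e h nat_pow_closed[OF h, of k] by (simp add: hoop_hom_def hom_def algebra_simps)
qed (use e in \<open>simp add: hoop_hom_def\<close>)

text \<open>As \<open>u\<close> is a unit, each generator lies below a multiple \<open>k i\<close>
  of it, and evaluation turns this into a bound on coordinate \<open>i\<close>. The sum of the
  \<open>k i\<close> serves all coordinates at once, and \<open>Suc\<close> keeps \<open>K\<close>
  positive.\<close>

lemma coordinate_bound: "\<exists>K>0. \<forall>x\<in>W. \<forall>i. x i \<le> K * U x"
proof -
  have u: "u \<in> carrier H" using unit by (simp add: hoop_unit_def)
  have "\<exists>k::nat. \<forall>x\<in>W. x i \<le> real k * U x" if i: "i < n" for i
  proof -
    have v: "vars (Var i) \<subseteq> {..<n}" using i by simp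
    obtain k :: nat where k: "\<pi> (Var i) \<setminus> u [^] k = \<one>"
      using unit map_closed[OF v] unfolding hoop_unit_def hoop_le_def by blast
    have "x i \<le> real k * U x" if x: "x \<in> W" for x
    proof -
      have "0 = eval_hom x (\<pi> (Var i) \<setminus> u [^] k)" using eval_hom[OF x] by (simp add: k hoop_hom_def)
      also have "\<dots> = max 0 (eval_hom x (\<pi> (Var i)) - eval_hom x (u [^] k))"
        using eval_hom[OF x] map_closed[OF v] nat_pow_closed[OF u, of k] by (simp add: hoop_hom_def)
      also have "\<dots> = max 0 (x i - real k * U x)"
        using eval_hom_map[OF x v] hom_nat_pow[OF eval_hom[OF x] u] eval_hom_map[OF x \<upsilon>(1)] by (simp add: \<upsilon>(2))
      finally show ?thesis by simp
    qed
    then show ?thesis by blast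
  qed
  then obtain k :: "nat \<Rightarrow> nat" where k: "\<And>i x. i < n \<Longrightarrow> x \<in> W \<Longrightarrow> x i \<le> real (k i) * U x" by metis
  define K where "K = real (Suc (\<Sum>i<n. k i))"
  have "x i \<le> K * U x" if x: "x \<in> W" for x i
  proof -
    have U: "U x \<ge> 0" by (rule eval_term_nonneg) (rule W_nonneg[OF x])
    show ?thesis
    proof (cases "i < n")
      case True
      then have "k i \<le> (\<Sum>i<n. k i)" by (intro member_le_sum) auto
      then have "real (k i) \<le> K" unfolding K_def by (intro of_nat_mono) simp
      then have "real (k i) * U x \<le> K * U x" using U by (rule mult_right_mono)
      then show ?thesis using k[OF True x] by linarith
    next
      case False
      then have "x i = 0" using W_outside[OF x, of i] by simp
      moreover have "K * U x \<ge> 0" using U by (intro mult_nonneg_nonneg) (simp_all only: K_def of_nat_0_le_iff)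
      ultimately show ?thesis by simp
    qed
  qed
  moreover have "K > 0" unfolding K_def of_nat_0_less_iff by simp
  ultimately show ?thesis by blast
qed

lemma U_pos:
  assumes x: "x \<in> W" "x \<noteq> (\<lambda>_. 0)" shows "U x > 0"
proof -
  obtain K where K: "K > 0" "\<forall>x\<in>W. \<forall>i. x i \<le> K * U x" using coordinate_bound by blast
  obtain i where "x i \<noteq> 0" using x(2) by auto
  then have "x i > 0" using W_nonneg[OF x(1), of i] by simp
  then have "K * U x > 0" using K(2) x(1) by (meson less_le_trans)
  then show ?thesis using K(1) by (simp add: zero_less_mult_iff)
qed

definition state_point :: "('a \<Rightarrow> real) \<Rightarrow> nat \<Rightarrow> real" where
  "state_point e i = (if i < n then e (\<pi> (Var i)) else 0)"

lemma hom_eval_point: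
  assumes e: "e \<in> hoop_hom H real_hoop" and t: "vars t \<subseteq> {..<n}"
  shows "e (\<pi> t) = eval_term (state_point e) t"
  using t
proof (induction t)
  case (Plus s t)
  then show ?case using e map_closed[of s] map_closed[of t] by (simp add: map_Plus hoop_hom_def hom_def)
next
  case (Monus s t)
  then show ?case using e map_closed[of s] map_closed[of t] by (simp add: map_Monus hoop_hom_def)
next
  case Zero
  then show ?case using e by (simp add: map_Zero hoop_hom_def)
qed (auto simp: state_point_def)

lemma state_point_in_W:
  assumes e: "e \<in> hoop_hom H real_hoop" shows "state_point e \<in> W"
proof -
  have "e (\<pi> (Var i)) \<ge> 0" if "i < n" for i
    using e map_closed[of "Var i"] that by (auto simp: hoop_hom_def hom_def)
  moreover have "eval_term (state_point e) r = eval_term (state_point e) s" if rs: "(r, s) \<in> R" for r s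
    using hom_eval_point[OF e, of r] hom_eval_point[OF e, of s] relation_vars[OF rs] relation_holds[OF rs] by simp
  ultimately show ?thesis by (auto simp: solution_set_def orthant_def state_point_def)
qed

definition state_of :: "(nat \<Rightarrow> real) \<Rightarrow> 'a \<Rightarrow> real" where
  "state_of x = restrict (\<lambda>h. eval_hom x h / U x) (carrier H)"

lemma state_of_map: "x \<in> W \<Longrightarrow> vars t \<subseteq> {..<n} \<Longrightarrow> state_of x (\<pi> t) = eval_term x t / U x"
  by (simp add: state_of_def map_closed eval_hom_map)

lemma state_of_extremal:
  assumes x: "x \<in> W" "x \<noteq> (\<lambda>_. 0)"
  shows "state_of x \<in> extremal_states H u"
proof -
  have h: "eval_hom x \<in> hoop_hom H real_hoop" by (rule eval_hom[OF x(1)])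
  have U: "U x > 0" by (rule U_pos[OF x])
  have "max 0 (a - b) / U x = max 0 (a / U x - b / U x)" for a b
    using U max_divide_distrib_right[of 0 "a - b" "U x"] by (simp add: diff_divide_distrib)
  then have "state_of x \<in> hoop_hom H real_hoop"
    using h U monus_closed eval_hom_nonneg[OF x(1)]
    by (auto simp: hoop_hom_def hom_def state_of_def add_divide_distrib)
  moreover have "state_of x u = 1" using state_of_map[OF x(1) \<upsilon>(1)] U by (simp add: \<upsilon>(2))
  ultimately show ?thesis
    by (auto simp: extremal_states_def states_def hoop_hom_def) (simp add: state_of_def)
qed

lemma extremal_state_image_cone:
  assumes e: "e \<in> extremal_states H u"
  shows "e ` carrier H \<subseteq> {0..}" "1 \<in> e ` carrier H"
    "a \<in> e ` carrier H \<Longrightarrow> b \<in> e ` carrier H \<Longrightarrow> a + b \<in> e ` carrier H"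
    "a \<in> e ` carrier H \<Longrightarrow> b \<in> e ` carrier H \<Longrightarrow> max 0 (a - b) \<in> e ` carrier H"
proof -
  have h: "e \<in> hoop_hom H real_hoop" "e u = 1" using e by (auto simp: extremal_states_def states_def)
  show "e ` carrier H \<subseteq> {0..}" using h by (auto simp: hoop_hom_def hom_def)
  show "1 \<in> e ` carrier H" using h(2) unit by (force simp: hoop_unit_def)
  show "a + b \<in> e ` carrier H" if "a \<in> e ` carrier H" "b \<in> e ` carrier H"
  proof -
    obtain g k where "g \<in> carrier H" "k \<in> carrier H" "a = e g" "b = e k" using \<open>a \<in> _\<close> \<open>b \<in> _\<close> by blast
    then have "a + b = e (g \<otimes> k)" "g \<otimes> k \<in> carrier H" using h(1) by (auto simp: hoop_hom_def hom_def)
    then show ?thesis by blast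
  qed
  show "max 0 (a - b) \<in> e ` carrier H" if "a \<in> e ` carrier H" "b \<in> e ` carrier H"
  proof -
    obtain g k where "g \<in> carrier H" "k \<in> carrier H" "a = e g" "b = e k" using \<open>a \<in> _\<close> \<open>b \<in> _\<close> by blast
    then have "max 0 (a - b) = e (g \<setminus> k)" "g \<setminus> k \<in> carrier H"
      using h(1) monus_closed by (auto simp: hoop_hom_def)
    then show ?thesis by blast
  qed
qed

lemma discrete_state_denominator:
  assumes e: "e \<in> discrete_states H u"
  shows "denominator H e \<ge> 1" "e ` carrier H = range (\<lambda>k::nat. real k / real (denominator H e))"
proof -
  have ex: "e \<in> extremal_states H u" "discrete (e ` carrier H)" using e by (auto simp: discrete_states_def)
  obtain b :: nat where b: "b \<ge> 1 \<and> e ` carrier H = range (\<lambda>k::nat. real k / real b)"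
    using discrete_cone_cyclic[OF extremal_state_image_cone[OF ex(1)] ex(2)] by blast
  have "denominator H e = b" unfolding denominator_def
  proof (rule the_equality[of _ b])
    show "1 \<le> b \<and> e ` carrier H = range (\<lambda>k::nat. real k / real b)" by (rule b)
    show "b' = b" if "1 \<le> b' \<and> e ` carrier H = range (\<lambda>k::nat. real k / real b')" for b'
      by (rule range_quotient_unique) (use that b in simp_all)
  qed
  then show "denominator H e \<ge> 1" "e ` carrier H = range (\<lambda>k::nat. real k / real (denominator H e))"
    using b by auto
qed

text \<open>Let \<open>b = U p\<close> and let \<open>c\<close> be the denominator. All values are
  multiples of \<open>1 / b\<close>, so \<open>b = k * c\<close>. Each \<open>p i / b\<close> is a
  multiple of \<open>1 / c\<close>, so \<open>k\<close> divides every entry, and primitivity gives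
  \<open>k = 1\<close>.\<close>

lemma state_of_discrete:
  assumes p: "p \<in> W" "primitive p"
  shows "state_of p \<in> discrete_states H u" "U p = real (denominator H (state_of p))"
proof -
  have nz: "p \<noteq> (\<lambda>_. 0)" by (rule primitive_nonzero[OF p(2)])
  have pN: "p i \<in> \<nat>" for i using p(2) by (simp add: primitive_def)
  have "U p \<in> \<nat>" by (rule eval_term_Nats[OF pN])
  then obtain b where b: "U p = real b" by (auto elim: Nats_cases)
  have b1: "b \<ge> 1" using U_pos[OF p(1) nz] b by simp
  have ex: "state_of p \<in> extremal_states H u" by (rule state_of_extremal[OF p(1) nz])
  have sub: "state_of p ` carrier H \<subseteq> range (\<lambda>k::nat. real k / real b)"
  proof
    fix y assume "y \<in> state_of p ` carrier H"
    then obtain t where t: "vars t \<subseteq> {..<n}" "y = state_of p (\<pi> t)" using ex_term by blast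
    obtain k where "eval_term p t = real k" using eval_term_Nats[of p t, OF pN] by (auto elim: Nats_cases)
    then show "y \<in> range (\<lambda>k::nat. real k / real b)" using t state_of_map[OF p(1) t(1)] b by auto
  qed
  then have "discrete (state_of p ` carrier H)" by (rule discrete_range_quotient)
  with ex show D: "state_of p \<in> discrete_states H u" by (simp add: discrete_states_def)
  define c where "c = denominator H (state_of p)"
  have c: "c \<ge> 1" "state_of p ` carrier H = range (\<lambda>k::nat. real k / real c)"
    unfolding c_def using discrete_state_denominator[OF D] by auto
  have "1 / real c \<in> range (\<lambda>k::nat. real k / real c)" by (rule range_eqI[of _ _ 1]) simp
  then obtain k :: nat where k: "1 / real c = real k / real b" using sub c(2) by blast
  then have "real b = real (k * c)" using b1 c(1) by (simp add: field_simps)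
  then have bkc: "b = k * c" by (simp only: of_nat_eq_iff)
  have "p i / real k \<in> \<nat>" for i
  proof (cases "i < n")
    case True
    then have v: "vars (Var i) \<subseteq> {..<n}" by simp
    have "state_of p (\<pi> (Var i)) \<in> range (\<lambda>k::nat. real k / real c)"
      using map_closed[OF v] c(2) by blast
    then obtain m :: nat where "p i / real b = real m / real c"
      using state_of_map[OF p(1) v] b by auto
    then have "p i / real k = real m" using b1 c(1) by (simp add: bkc field_simps)
    then show ?thesis by simp
  next
    case False
    then show ?thesis using W_outside[OF p(1), of i] by simp
  qed
  moreover have "k \<ge> 1" using bkc b1 by (cases k) auto
  ultimately have "k = 1" using p(2) unfolding primitive_def by blast
  then show "U p = real (denominator H (state_of p))" using b bkc by (simp add: c_def)
qed

lemma discrete_state_primitive: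
  assumes e: "e \<in> discrete_states H u"
  defines "p \<equiv> \<lambda>i. real (denominator H e) * state_point e i"
  shows "p \<in> W" "primitive p" "state_of p = e"
proof -
  define b where "b = denominator H e"
  have b: "b \<ge> 1" "e ` carrier H = range (\<lambda>k::nat. real k / real b)"
    using discrete_state_denominator[OF e] by (auto simp: b_def)
  have h: "e \<in> hoop_hom H real_hoop" "e u = 1" "e \<in> extensional (carrier H)"
    using e by (auto simp: discrete_states_def extremal_states_def states_def)
  have p: "p = (\<lambda>i. real b * state_point e i)" by (simp add: p_def b_def)
  have W: "state_point e \<in> W" by (rule state_point_in_W[OF h(1)])
  show pW: "p \<in> W" unfolding p by (rule solution_set_scale[OF W]) simp
  have ev: "eval_term p t = real b * e (\<pi> t)" if "vars t \<subseteq> {..<n}" for t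
    using hom_eval_point[OF h(1) that] by (simp add: p eval_term_scale)
  have Up: "U p = real b" using ev[OF \<upsilon>(1)] h(2) by (simp add: \<upsilon>(2))
  show "state_of p = e"
  proof (rule extensionalityI[of _ "carrier H"])
    fix g assume "g \<in> carrier H"
    then obtain t where t: "vars t \<subseteq> {..<n}" "g = \<pi> t" using ex_term by blast
    then show "state_of p g = e g" using state_of_map[OF pW t(1)] ev[OF t(1)] Up b(1) by simp
  qed (use h(3) in \<open>auto simp: state_of_def\<close>)
  have pN: "p i \<in> \<nat>" for i
  proof (cases "i < n")
    case True
    then have "e (\<pi> (Var i)) \<in> range (\<lambda>k::nat. real k / real b)" using map_closed[of "Var i"] b(2) by auto
    then show ?thesis using True b(1) by (auto simp: p state_point_def)
  next
    case False
    then show ?thesis by (simp add: p state_point_def)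
  qed
  show "primitive p" unfolding primitive_def
  proof (intro conjI allI impI pN)
    fix k :: nat assume k: "1 \<le> k" "\<forall>i. p i / real k \<in> \<nat>"
    have "1 / real b \<in> range (\<lambda>k::nat. real k / real b)" by (rule range_eqI[of _ _ 1]) simp
    \<comment> \<open>The least positive value \<open>1 / b\<close> is attained, so some term has
      value 1 at \<open>p\<close>. At the integer point \<open>p\<close> divided by \<open>k\<close>
      the same term has value \<open>1 / k\<close>, which must be a natural number.\<close>
    then obtain g where g: "g \<in> carrier H" "e g = 1 / real b" using b(2) by (metis imageE)
    then obtain t where t: "vars t \<subseteq> {..<n}" "g = \<pi> t" using ex_term by blast
    have one: "eval_term p t = 1" using ev[OF t(1)] g(2) b(1) by (simp add: t(2))
    have "eval_term (\<lambda>i. 1 / real k * p i) t = 1 / real k"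
      by (subst eval_term_scale) (use one in auto)
    moreover have "eval_term (\<lambda>i. 1 / real k * p i) t \<in> \<nat>" by (rule eval_term_Nats) (use k in simp)
    ultimately obtain m where "1 / real k = real m" by (metis Nats_cases)
    then have "real (m * k) = real 1" using k(1) by (simp add: field_simps)
    then have "m * k = 1" by (simp only: of_nat_eq_iff)
    then show "k = 1" by simp
  qed
qed

lemma state_of_bij: "bij_betw state_of {p\<in>W. primitive p} (discrete_states H u)"
proof (rule bij_betw_byWitness[where f' = "\<lambda>e i. real (denominator H e) * state_point e i"])
  show "\<forall>p\<in>{p \<in> W. primitive p}. (\<lambda>i. real (denominator H (state_of p)) * state_point (state_of p) i) = p"
  proof
    fix p assume "p \<in> {p \<in> W. primitive p}"
    then have p: "p \<in> W" "primitive p" by auto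
    have "real (denominator H (state_of p)) * state_point (state_of p) i = p i" for i
      using state_of_map[OF p(1), of "Var i"] U_pos[OF p(1) primitive_nonzero[OF p(2)]] W_outside[OF p(1), of i]
        state_of_discrete(2)[OF p] by (auto simp: state_point_def)
    then show "(\<lambda>i. real (denominator H (state_of p)) * state_point (state_of p) i) = p" by blast
  qed
qed (use discrete_state_primitive state_of_discrete(1) in auto)

end

section \<open>Existence of an extremal state\<close>

context cancellative_hoop
begin

abbreviation le :: "'a \<Rightarrow> 'a \<Rightarrow> bool"  (infix \<open>\<preceq>\<close> 50) where "x \<preceq> y \<equiv> hoop_le H x y"

lemma add_left_cancel:
  assumes "x \<in> carrier H" "y \<in> carrier H" "z \<in> carrier H" "x \<otimes> y = x \<otimes> z"
  shows "y = z"
  using cancellation[of y x] cancellation[of z x] assms by (simp add: m_comm)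

lemma monus_one: "x \<in> carrier H \<Longrightarrow> x \<setminus> \<one> = x"
  using cancellation[of x \<one>] by simp

text \<open>Divisibility gives \<open>x \<otimes> (\<one> \<setminus> x) = \<one> \<otimes> (x
  \<setminus> \<one>) = x\<close>; now cancel \<open>x\<close>.\<close>

lemma one_monus:
  assumes x: "x \<in> carrier H" shows "\<one> \<setminus> x = \<one>"
  by (rule add_left_cancel[OF x monus_closed[OF one_closed x] one_closed])
    (use divisibility[OF x one_closed] x in \<open>simp add: monus_one\<close>)

lemma le_one_iff: "x \<in> carrier H \<Longrightarrow> x \<preceq> \<one> \<longleftrightarrow> x = \<one>"
  by (simp add: hoop_le_def monus_one)

lemma one_le: "x \<in> carrier H \<Longrightarrow> \<one> \<preceq> x"
  by (simp add: hoop_le_def one_monus)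

lemma le_refl: "x \<in> carrier H \<Longrightarrow> x \<preceq> x"
  by (simp add: hoop_le_def monus_self)

lemma le_add: "x \<in> carrier H \<Longrightarrow> z \<in> carrier H \<Longrightarrow> x \<preceq> x \<otimes> z"
  unfolding hoop_le_def by (simp add: monus_monus[symmetric] monus_self one_monus)

lemma le_imp_add: "x \<in> carrier H \<Longrightarrow> y \<in> carrier H \<Longrightarrow> x \<preceq> y \<Longrightarrow> y = x \<otimes> (y \<setminus> x)"
  using divisibility[of x y] by (simp add: hoop_le_def)

lemma monus_le_iff:
  "x \<in> carrier H \<Longrightarrow> y \<in> carrier H \<Longrightarrow> z \<in> carrier H \<Longrightarrow> x \<setminus> y \<preceq> z \<longleftrightarrow> x \<preceq> y \<otimes> z"
  by (simp add: hoop_le_def monus_monus)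

lemma le_trans:
  assumes "x \<in> carrier H" "y \<in> carrier H" "z \<in> carrier H" "x \<preceq> y" "y \<preceq> z"
  shows "x \<preceq> z"
proof -
  have "z = y \<otimes> (z \<setminus> y)" "y = x \<otimes> (y \<setminus> x)" using assms le_imp_add by auto
  then have "z = x \<otimes> ((y \<setminus> x) \<otimes> (z \<setminus> y))" using assms monus_closed by (metis m_assoc)
  then show ?thesis using le_add assms monus_closed by (metis m_closed)
qed

lemma add_mono:
  assumes "x \<in> carrier H" "y \<in> carrier H" "z \<in> carrier H" "w \<in> carrier H" "x \<preceq> y" "z \<preceq> w"
  shows "x \<otimes> z \<preceq> y \<otimes> w"
proof -
  have "y = x \<otimes> (y \<setminus> x)" "w = z \<otimes> (w \<setminus> z)" using assms le_imp_add by auto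
  then have "y \<otimes> w = (x \<otimes> z) \<otimes> ((y \<setminus> x) \<otimes> (w \<setminus> z))"
    using assms monus_closed by (metis m_assoc m_lcomm m_closed)
  then show ?thesis using le_add[of "x \<otimes> z" "(y \<setminus> x) \<otimes> (w \<setminus> z)"] assms monus_closed by simp
qed

lemma add_le_cancel:
  assumes "x \<in> carrier H" "y \<in> carrier H" "z \<in> carrier H" "z \<otimes> x \<preceq> z \<otimes> y"
  shows "x \<preceq> y"
proof -
  define w where "w = (z \<otimes> y) \<setminus> (z \<otimes> x)"
  have w: "w \<in> carrier H" using assms monus_closed by (simp add: w_def)
  have "z \<otimes> y = (z \<otimes> x) \<otimes> w" unfolding w_def by (rule le_imp_add) (use assms in auto)
  then have "z \<otimes> y = z \<otimes> (x \<otimes> w)" using assms w by (simp add: m_assoc)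
  then have "y = x \<otimes> w" by (rule add_left_cancel[rotated 3]) (use assms w in auto)
  then show ?thesis using le_add[of x w] assms w by simp
qed

section \<open>Disjointness and maximal ideals\<close>

definition hoop_disjoint :: "'a \<Rightarrow> 'a \<Rightarrow> bool" where
  "hoop_disjoint x y \<longleftrightarrow> (\<forall>z\<in>carrier H. z \<preceq> x \<longrightarrow> z \<preceq> y \<longrightarrow> z = \<one>)"

lemma hoop_disjoint_commute: "hoop_disjoint x y \<longleftrightarrow> hoop_disjoint y x"
  by (auto simp: hoop_disjoint_def)

text \<open>Here \<open>m\<close> is the meet of \<open>a\<close> and \<open>b\<close>.\<close>

lemma monus_disjoint:
  assumes a: "a \<in> carrier H" and b: "b \<in> carrier H"
  shows "hoop_disjoint (a \<setminus> b) (b \<setminus> a)"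
  unfolding hoop_disjoint_def
proof (intro ballI impI)
  fix z assume z: "z \<in> carrier H" "z \<preceq> a \<setminus> b" "z \<preceq> b \<setminus> a"
  define x where "x = a \<setminus> b"
  define y where "y = b \<setminus> a"
  define m where "m = a \<setminus> x"
  have c: "x \<in> carrier H" "y \<in> carrier H" "m \<in> carrier H" using a b monus_closed by (auto simp: x_def y_def m_def)
  have "x \<preceq> a" using monus_le_iff[OF a b a] le_add[OF a b] a b by (simp add: x_def m_comm)
  then have am: "a = m \<otimes> x" using le_imp_add[OF c(1) a] c a by (simp add: m_def m_comm)
  have "b \<otimes> x = a \<otimes> y" using divisibility[OF b a] by (simp add: x_def y_def)
  then have "x \<otimes> b = x \<otimes> (m \<otimes> y)" using am a b c by (simp add: m_ac)
  then have bm: "b = m \<otimes> y" using add_left_cancel[OF c(1) b] c by simp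
  \<comment> \<open>\<open>d\<close> is a common lower bound exceeding the meet by \<open>z\<close>.
    From \<open>d \<preceq> b\<close> follows \<open>x \<preceq> a \<setminus> d\<close>, hence
    \<open>d \<otimes> x \<preceq> a = m \<otimes> x\<close>, and cancellation kills
    \<open>z\<close>.\<close>
  define d where "d = m \<otimes> z"
  have d: "d \<in> carrier H" using c z by (simp add: d_def)
  have da: "d \<preceq> a" unfolding d_def am
    by (rule add_mono) (use c z le_refl in \<open>auto simp: x_def\<close>)
  have db: "d \<preceq> b" unfolding d_def by (subst bm, rule add_mono) (use c z le_refl in \<open>auto simp: y_def\<close>)
  have aad: "a = d \<otimes> (a \<setminus> d)" by (rule le_imp_add[OF d a da])
  have ad: "a \<setminus> d \<in> carrier H" using a d monus_closed by simp
  have "d \<otimes> (a \<setminus> d) \<preceq> b \<otimes> (a \<setminus> d)" by (rule add_mono) (use b d ad db le_refl in auto)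
  then have "x \<preceq> a \<setminus> d" using monus_le_iff[OF a b ad] aad by (simp add: x_def)
  then have "d \<otimes> x \<preceq> d \<otimes> (a \<setminus> d)" by (intro add_mono) (use c d ad le_refl in auto)
  then have "d \<otimes> x \<preceq> m \<otimes> x" using aad am by simp
  moreover have "d \<otimes> x = (m \<otimes> x) \<otimes> z" using c z by (simp add: d_def m_ac)
  ultimately have "(m \<otimes> x) \<otimes> z \<preceq> (m \<otimes> x) \<otimes> \<one>" using c by simp
  then have "z \<preceq> \<one>" by (rule add_le_cancel[rotated 3]) (use c z in auto)
  then show "z = \<one>" using z le_one_iff by blast
qed

text \<open>For \<open>z\<close> below the sum and below \<open>y\<close>, the element
  \<open>z \<setminus> x\<close> lies below \<open>x'\<close> and \<open>y\<close>, so it vanishes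
  and \<open>z\<close> is already below \<open>x\<close>.\<close>

lemma hoop_disjoint_add:
  assumes "x \<in> carrier H" "x' \<in> carrier H" "y \<in> carrier H" "hoop_disjoint x y" "hoop_disjoint x' y"
  shows "hoop_disjoint (x \<otimes> x') y"
  unfolding hoop_disjoint_def
proof (intro ballI impI)
  fix z assume z: "z \<in> carrier H" "z \<preceq> x \<otimes> x'" "z \<preceq> y"
  have zx: "z \<setminus> x \<in> carrier H" using z assms monus_closed by simp
  have "z \<setminus> x \<preceq> x'" using z assms monus_le_iff by simp
  moreover have "z \<setminus> x \<preceq> z" using z assms monus_le_iff[of z x z] le_add[of z x] by (simp add: m_comm)
  then have "z \<setminus> x \<preceq> y" using le_trans zx z assms by blast
  ultimately have "z \<setminus> x = \<one>" using assms(5) zx by (simp add: hoop_disjoint_def)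
  then have "z \<preceq> x" by (simp add: hoop_le_def)
  then show "z = \<one>" using assms(4) z by (simp add: hoop_disjoint_def)
qed

lemma hoop_disjoint_pow:
  assumes "x \<in> carrier H" "y \<in> carrier H" "hoop_disjoint x y"
  shows "hoop_disjoint (x [^] (k::nat)) y"
proof (induction k)
  case 0
  then show ?case using le_one_iff by (auto simp: hoop_disjoint_def)
next
  case (Suc k)
  then show ?case using hoop_disjoint_add[of "x [^] k" x y] assms by simp
qed

definition hoop_ideal :: "'a set \<Rightarrow> bool" where
  "hoop_ideal I \<longleftrightarrow> I \<subseteq> carrier H \<and> \<one> \<in> I \<and> (\<forall>x\<in>I. \<forall>y\<in>I. x \<otimes> y \<in> I) \<and>
     (\<forall>x\<in>carrier H. \<forall>y\<in>I. x \<preceq> y \<longrightarrow> x \<in> I)"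

lemma maximal_ideal_exists:
  assumes u: "u \<in> carrier H" "u \<noteq> \<one>"
  shows "\<exists>I. hoop_ideal I \<and> u \<notin> I \<and> (\<forall>J. hoop_ideal J \<and> u \<notin> J \<longrightarrow> I \<subseteq> J \<longrightarrow> J = I)"
proof -
  define \<A> where "\<A> = {I. hoop_ideal I \<and> u \<notin> I}"
  have "{\<one>} \<in> \<A>" using u le_one_iff by (auto simp: \<A>_def hoop_ideal_def)
  moreover have "\<Union>\<C> \<in> \<A>" if \<C>: "\<C> \<noteq> {}" "subset.chain \<A> \<C>" for \<C>
  proof -
    have ideals: "hoop_ideal I \<and> u \<notin> I" if "I \<in> \<C>" for I
      using \<C>(2) that by (auto simp: subset.chain_def \<A>_def)
    have "hoop_ideal (\<Union>\<C>)" unfolding hoop_ideal_def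
    proof (intro conjI ballI impI)
      show "\<Union>\<C> \<subseteq> carrier H" by (rule Union_least) (use ideals in \<open>simp add: hoop_ideal_def\<close>)
      show "\<one> \<in> \<Union>\<C>" using ideals \<C>(1) by (auto simp: hoop_ideal_def)
      show "x \<in> \<Union>\<C>" if "x \<in> carrier H" "y \<in> \<Union>\<C>" "x \<preceq> y" for x y
        using that ideals unfolding hoop_ideal_def by blast
      fix x y assume "x \<in> \<Union>\<C>" "y \<in> \<Union>\<C>"
      then obtain I J where IJ: "I \<in> \<C>" "J \<in> \<C>" "x \<in> I" "y \<in> J" by blast
      have "I \<subseteq> J \<or> J \<subseteq> I" using \<C>(2) IJ(1,2) by (auto simp: subset.chain_def)
      then obtain K where "K \<in> \<C>" "x \<in> K" "y \<in> K" using IJ by blast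
      then show "x \<otimes> y \<in> \<Union>\<C>" using ideals unfolding hoop_ideal_def by blast
    qed
    then show ?thesis using ideals by (auto simp: \<A>_def)
  qed
  ultimately obtain M where "M \<in> \<A>" "\<forall>X\<in>\<A>. M \<subseteq> X \<longrightarrow> X = M"
    using subset_Zorn_nonempty[of \<A>] by blast
  then show ?thesis by (auto simp: \<A>_def)
qed

end

locale maximal_hoop_ideal = cancellative_hoop H for H (structure) +
  fixes u :: 'a and I :: "'a set"
  assumes unit: "hoop_unit H u" and ideal: "hoop_ideal I" and proper: "u \<notin> I"
    and maximal: "\<And>J. hoop_ideal J \<Longrightarrow> u \<notin> J \<Longrightarrow> I \<subseteq> J \<Longrightarrow> J = I"
begin

lemma u_closed: "u \<in> carrier H" using unit by (simp add: hoop_unit_def)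

lemma ideal_closed: "i \<in> I \<Longrightarrow> i \<in> carrier H"
  and ideal_one: "\<one> \<in> I"
  and ideal_add: "i \<in> I \<Longrightarrow> j \<in> I \<Longrightarrow> i \<otimes> j \<in> I"
  and ideal_down: "x \<in> carrier H \<Longrightarrow> x \<preceq> i \<Longrightarrow> i \<in> I \<Longrightarrow> x \<in> I"
  using ideal by (auto simp: hoop_ideal_def)

text \<open>The elements below some \<open>x [^] k \<otimes> i\<close> form the ideal generated by
  \<open>I\<close> and \<open>x\<close>; being larger than \<open>I\<close>, it must contain
  \<open>u\<close>.\<close>

lemma unit_in_extension:
  assumes x: "x \<in> carrier H" "x \<notin> I"
  shows "\<exists>k::nat. \<exists>i\<in>I. u \<preceq> x [^] k \<otimes> i"
proof (rule ccontr)
  assume no: "\<not> ?thesis"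
  define J where "J = {h\<in>carrier H. \<exists>k::nat. \<exists>i\<in>I. h \<preceq> x [^] k \<otimes> i}"
  have "hoop_ideal J" unfolding hoop_ideal_def
  proof (intro conjI ballI impI)
    show "J \<subseteq> carrier H" by (auto simp: J_def)
    have "\<one> \<preceq> x [^] (0::nat) \<otimes> \<one>" using one_le by simp
    then show "\<one> \<in> J" using ideal_one unfolding J_def by blast
    show "h \<in> J" if h: "h \<in> carrier H" "g \<in> J" "h \<preceq> g" for h g
    proof -
      obtain k :: nat and i where "i \<in> I" "g \<preceq> x [^] k \<otimes> i" "g \<in> carrier H" using h(2) by (auto simp: J_def)
      then show ?thesis using le_trans[of h g "x [^] k \<otimes> i"] h x ideal_closed unfolding J_def by auto
    qed
    fix g h assume "g \<in> J" "h \<in> J"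
    then obtain k l :: nat and i j where ij: "i \<in> I" "j \<in> I" "g \<in> carrier H" "h \<in> carrier H"
      "g \<preceq> x [^] k \<otimes> i" "h \<preceq> x [^] l \<otimes> j" by (auto simp: J_def)
    then have "g \<otimes> h \<preceq> (x [^] k \<otimes> i) \<otimes> (x [^] l \<otimes> j)" using x ideal_closed by (intro add_mono) auto
    also have "(x [^] k \<otimes> i) \<otimes> (x [^] l \<otimes> j) = x [^] (k + l) \<otimes> (i \<otimes> j)"
      using x ij ideal_closed by (simp add: nat_pow_mult[symmetric] m_ac)
    finally show "g \<otimes> h \<in> J" using ij ideal_add unfolding J_def by blast
  qed
  moreover have "I \<subseteq> J"
  proof
    fix i assume i: "i \<in> I"
    then have "i \<preceq> x [^] (0::nat) \<otimes> i" using le_refl ideal_closed by simp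
    then show "i \<in> J" using i ideal_closed unfolding J_def by blast
  qed
  moreover have "x \<in> J"
  proof -
    have "x \<preceq> x [^] (1::nat) \<otimes> \<one>" using le_refl x by simp
    then show ?thesis using x ideal_one unfolding J_def by blast
  qed
  moreover have "u \<notin> J" using no by (auto simp: J_def)
  ultimately show False using maximal x(2) by blast
qed

text \<open>If both differences avoided \<open>I\<close>, then \<open>u\<close> would lie below a
  multiple of each, up to elements \<open>i\<close> and \<open>j\<close> of \<open>I\<close>. So
  \<open>u \<setminus> (i \<otimes> j)\<close> would be below multiples of two disjoint elements,
  hence trivial, and \<open>u\<close> would belong to \<open>I\<close>. This is totality of the
  order modulo \<open>I\<close>.\<close>

lemma prime:
  assumes a: "a \<in> carrier H" and b: "b \<in> carrier H"
  shows "a \<setminus> b \<in> I \<or> b \<setminus> a \<in> I"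
proof (rule ccontr)
  assume "\<not> ?thesis"
  then have n: "a \<setminus> b \<notin> I" "b \<setminus> a \<notin> I" by auto
  have c: "a \<setminus> b \<in> carrier H" "b \<setminus> a \<in> carrier H" using a b monus_closed by auto
  obtain k l :: nat and i j where ij: "i \<in> I" "j \<in> I" "u \<preceq> (a \<setminus> b) [^] k \<otimes> i" "u \<preceq> (b \<setminus> a) [^] l \<otimes> j"
    using unit_in_extension[OF c(1) n(1)] unit_in_extension[OF c(2) n(2)] by blast
  define w where "w = u \<setminus> (i \<otimes> j)"
  have ijc: "i \<in> carrier H" "j \<in> carrier H" using ij ideal_closed by auto
  have w: "w \<in> carrier H" using u_closed ijc monus_closed by (simp add: w_def)
  have pc: "(a \<setminus> b) [^] k \<in> carrier H" "(b \<setminus> a) [^] l \<in> carrier H" using c by auto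
  have "u \<preceq> ((a \<setminus> b) [^] k \<otimes> i) \<otimes> j" using le_trans[OF u_closed _ _ ij(3) le_add] pc ijc by simp
  then have "w \<preceq> (a \<setminus> b) [^] k" unfolding w_def using monus_le_iff u_closed pc ijc by (simp add: m_ac)
  moreover have "u \<preceq> ((b \<setminus> a) [^] l \<otimes> j) \<otimes> i" using le_trans[OF u_closed _ _ ij(4) le_add] pc ijc by simp
  then have "w \<preceq> (b \<setminus> a) [^] l" unfolding w_def using monus_le_iff u_closed pc ijc by (simp add: m_ac)
  moreover have "hoop_disjoint ((a \<setminus> b) [^] k) ((b \<setminus> a) [^] l)"
    using hoop_disjoint_pow[OF c(1) pc(2)] hoop_disjoint_pow[OF c(2) c(1)] monus_disjoint[OF a b]
    by (simp add: hoop_disjoint_commute)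
  ultimately have "w = \<one>" using w by (simp add: hoop_disjoint_def)
  then have "u \<preceq> i \<otimes> j" by (simp add: w_def hoop_le_def)
  then show False using ideal_down u_closed ideal_add ij proper by blast
qed

text \<open>The order of the quotient by \<open>I\<close>, kept as a preorder on \<open>H\<close> so
  that no quotient hoop has to be formed.\<close>

definition below :: "'a \<Rightarrow> 'a \<Rightarrow> bool"  (infix \<open>\<unlhd>\<close> 50) where
  "x \<unlhd> y \<longleftrightarrow> x \<in> carrier H \<and> y \<in> carrier H \<and> x \<setminus> y \<in> I"

lemma below_iff: "x \<unlhd> y \<longleftrightarrow> x \<in> carrier H \<and> y \<in> carrier H \<and> (\<exists>i\<in>I. x \<preceq> y \<otimes> i)"
proof -
  have "x \<setminus> y \<in> I \<longleftrightarrow> (\<exists>i\<in>I. x \<preceq> y \<otimes> i)" if "x \<in> carrier H" "y \<in> carrier H"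
  proof
    assume i: "x \<setminus> y \<in> I"
    have "x \<preceq> y \<otimes> (x \<setminus> y)" using monus_le_iff[of x y "x \<setminus> y"] that monus_closed le_refl by simp
    then show "\<exists>i\<in>I. x \<preceq> y \<otimes> i" using i by blast
  next
    assume "\<exists>i\<in>I. x \<preceq> y \<otimes> i"
    then show "x \<setminus> y \<in> I" using monus_le_iff that ideal_closed monus_closed ideal_down by metis
  qed
  then show ?thesis by (auto simp: below_def)
qed

lemma below_total: "x \<in> carrier H \<Longrightarrow> y \<in> carrier H \<Longrightarrow> x \<unlhd> y \<or> y \<unlhd> x"
  using prime by (auto simp: below_def)

lemma le_imp_below: "x \<in> carrier H \<Longrightarrow> y \<in> carrier H \<Longrightarrow> x \<preceq> y \<Longrightarrow> x \<unlhd> y"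
  by (simp add: below_def hoop_le_def ideal_one)

lemma below_trans:
  assumes "x \<unlhd> y" "y \<unlhd> z" shows "x \<unlhd> z"
proof -
  obtain i j where ij: "i \<in> I" "j \<in> I" "x \<preceq> y \<otimes> i" "y \<preceq> z \<otimes> j" and c: "x \<in> carrier H" "y \<in> carrier H" "z \<in> carrier H"
    using assms by (auto simp: below_iff)
  have ijc: "i \<in> carrier H" "j \<in> carrier H" using ij ideal_closed by auto
  have "y \<otimes> i \<preceq> (z \<otimes> j) \<otimes> i" using c ijc ij le_refl by (intro add_mono) auto
  then have "x \<preceq> (z \<otimes> j) \<otimes> i" using le_trans[OF c(1) _ _ ij(3)] c ijc by simp
  then have "x \<preceq> z \<otimes> (j \<otimes> i)" using c ijc by (simp add: m_assoc)
  then show ?thesis using c ij ideal_add by (auto simp: below_iff)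
qed

lemma below_add:
  assumes "x \<unlhd> y" "x' \<unlhd> y'" shows "x \<otimes> x' \<unlhd> y \<otimes> y'"
proof -
  obtain i j where ij: "i \<in> I" "j \<in> I" "x \<preceq> y \<otimes> i" "x' \<preceq> y' \<otimes> j"
    and c: "x \<in> carrier H" "y \<in> carrier H" "x' \<in> carrier H" "y' \<in> carrier H"
    using assms by (auto simp: below_iff)
  have ijc: "i \<in> carrier H" "j \<in> carrier H" using ij ideal_closed by auto
  have "x \<otimes> x' \<preceq> (y \<otimes> i) \<otimes> (y' \<otimes> j)" using c ijc ij by (intro add_mono) auto
  then have "x \<otimes> x' \<preceq> (y \<otimes> y') \<otimes> (i \<otimes> j)" using c ijc by (simp add: m_ac)
  then show ?thesis using c ij ideal_add by (auto simp: below_iff)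
qed

lemma below_pow: "x \<unlhd> y \<Longrightarrow> x [^] (k::nat) \<unlhd> y [^] k"
proof (induction k)
  case 0
  then show ?case using le_imp_below le_refl by simp
qed (simp add: below_add)

text \<open>For \<open>p > q\<close>, cancelling \<open>u [^] q\<close> would put \<open>u\<close>
  below an element of \<open>I\<close>. So distinct multiples of \<open>u\<close> stay distinct
  modulo \<open>I\<close>.\<close>

lemma unit_pow_below: "u [^] p \<unlhd> u [^] q \<Longrightarrow> p \<le> (q::nat)"
proof (rule ccontr)
  assume pq: "u [^] p \<unlhd> u [^] q" and "\<not> p \<le> q"
  define d where "d = p - Suc q"
  have p: "p = q + Suc d" using \<open>\<not> p \<le> q\<close> by (simp add: d_def)
  obtain i where i: "i \<in> I" "u [^] p \<preceq> u [^] q \<otimes> i" using pq by (auto simp: below_iff)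
  have c: "u [^] q \<in> carrier H" "u [^] d \<in> carrier H" "i \<in> carrier H" using u_closed i ideal_closed by auto
  have "u [^] p = u [^] q \<otimes> (u \<otimes> u [^] d)"
    using u_closed by (simp add: p nat_pow_mult[symmetric] m_ac)
  then have "u \<otimes> u [^] d \<preceq> i" using add_le_cancel[of "u \<otimes> u [^] d" i "u [^] q"] i c u_closed by simp
  then have "u \<preceq> i" using le_trans[OF u_closed _ _ le_add] c u_closed by blast
  then show False using ideal_down u_closed i proper by blast
qed

section \<open>Hoelder's embedding\<close>

text \<open>The Dedekind cut of \<open>h\<close> measured in units of \<open>u\<close>, with
  division avoided by comparing multiples.\<close>

definition slope :: "'a \<Rightarrow> real" where
  "slope h = Sup {real p / real q |p q. q \<ge> 1 \<and> u [^] p \<unlhd> h [^] (q::nat)}"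

lemma below_unit_pow: "h \<in> carrier H \<Longrightarrow> \<exists>k::nat. h \<unlhd> u [^] k"
  using unit u_closed le_imp_below unfolding hoop_unit_def by (metis nat_pow_closed)

lemma slope_compare:
  assumes "h \<in> carrier H" "u [^] p \<unlhd> h [^] (q::nat)" "h [^] (q'::nat) \<unlhd> u [^] p'" "q \<ge> 1" "q' \<ge> 1"
  shows "real p / real q \<le> real p' / real q'"
proof -
  have "u [^] (p * q') \<unlhd> h [^] (q * q')"
    using below_pow[OF assms(2), of q'] assms(1) u_closed by (simp add: nat_pow_pow)
  moreover have "h [^] (q * q') \<unlhd> u [^] (p' * q)"
    using below_pow[OF assms(3), of q] assms(1) u_closed by (simp add: nat_pow_pow mult.commute)
  ultimately have "p * q' \<le> p' * q" using below_trans unit_pow_below by blast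
  then have "real (p * q') \<le> real (p' * q)" by (rule of_nat_mono)
  then show ?thesis using assms(4,5) by (simp add: field_simps)
qed

lemma one_below: "h \<in> carrier H \<Longrightarrow> \<one> \<unlhd> h"
  using le_imp_below one_le by simp

lemma slope_upper:
  assumes h: "h \<in> carrier H" "h [^] (q::nat) \<unlhd> u [^] (p::nat)" "q \<ge> 1"
  shows "slope h \<le> real p / real q"
  unfolding slope_def
proof (rule cSup_least)
  have "real 0 / real 1 \<in> {real p / real q |p q. q \<ge> 1 \<and> u [^] p \<unlhd> h [^] (q::nat)}"
    using one_below h(1) by (intro CollectI exI[of _ 0] exI[of _ "1::nat"]) simp
  then show "{real p / real q |p q. q \<ge> 1 \<and> u [^] p \<unlhd> h [^] (q::nat)} \<noteq> {}" by blast
qed (use slope_compare[OF h(1) _ h(2) _ h(3)] in blast)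

lemma slope_lower:
  assumes h: "h \<in> carrier H" "u [^] (p::nat) \<unlhd> h [^] (q::nat)" "q \<ge> 1"
  shows "real p / real q \<le> slope h"
  unfolding slope_def
proof (rule cSup_upper)
  obtain k :: nat where k: "h \<unlhd> u [^] k" using below_unit_pow[OF h(1)] by blast
  then have k1: "h [^] (1::nat) \<unlhd> u [^] k" using h(1) by simp
  show "bdd_above {real p / real q |p q. q \<ge> 1 \<and> u [^] p \<unlhd> h [^] (q::nat)}"
    by (rule bdd_aboveI[of _ "real k / real 1"]) (use slope_compare[OF h(1) _ k1] in blast)
qed (use h in blast)

text \<open>A least multiple of \<open>u\<close> above \<open>h [^] q\<close> exists because
  \<open>u\<close> is a unit; by totality its predecessor lies below.\<close>

lemma slope_approx:
  assumes h: "h \<in> carrier H" and q: "(q::nat) \<ge> 1"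
  shows "\<exists>p::nat. u [^] p \<unlhd> h [^] q \<and> h [^] q \<unlhd> u [^] Suc p"
proof -
  obtain k :: nat where "h \<unlhd> u [^] k" using below_unit_pow[OF h] by blast
  then have "h [^] q \<unlhd> u [^] (k * q)" using below_pow[of h "u [^] k" q] u_closed by (simp add: nat_pow_pow)
  then have ex: "\<exists>p::nat. h [^] q \<unlhd> u [^] p" by blast
  define P where "P = (LEAST p::nat. h [^] q \<unlhd> u [^] p)"
  have P: "h [^] q \<unlhd> u [^] P" unfolding P_def using ex by (rule LeastI_ex)
  show ?thesis
  proof (cases P)
    case 0
    have "u [^] (0::nat) \<unlhd> u [^] (1::nat)" using one_below u_closed by simp
    then have "h [^] q \<unlhd> u [^] Suc 0" using below_trans[OF P] by (simp add: 0)
    moreover have "u [^] (0::nat) \<unlhd> h [^] q" using one_below h by simp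
    ultimately show ?thesis by blast
  next
    case (Suc p)
    then have "\<not> h [^] q \<unlhd> u [^] p" using not_less_Least[of p "\<lambda>p. h [^] q \<unlhd> u [^] p"] by (simp add: P_def)
    then have "u [^] p \<unlhd> h [^] q" using below_total h u_closed by (metis nat_pow_closed)
    then show ?thesis using P Suc by blast
  qed
qed

text \<open>Approximating \<open>g\<close> and \<open>h\<close> with a common denominator
  \<open>q\<close> gives additivity up to \<open>2 / q\<close>, for every \<open>q\<close>.\<close>

lemma slope_add:
  assumes g: "g \<in> carrier H" and h: "h \<in> carrier H"
  shows "slope (g \<otimes> h) = slope g + slope h"
proof -
  have "\<bar>slope (g \<otimes> h) - (slope g + slope h)\<bar> \<le> 2 / real q" if q: "q \<ge> 1" for q :: nat
  proof -
    obtain p where p: "u [^] p \<unlhd> g [^] q" "g [^] q \<unlhd> u [^] Suc p" using slope_approx[OF g q] by blast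
    obtain r where r: "u [^] r \<unlhd> h [^] q" "h [^] q \<unlhd> u [^] Suc r" using slope_approx[OF h q] by blast
    have gh: "(g \<otimes> h) [^] q = g [^] q \<otimes> h [^] q" using g h by (simp add: nat_pow_distrib)
    have "u [^] (p + r) \<unlhd> (g \<otimes> h) [^] q"
      using below_add[OF p(1) r(1)] u_closed by (simp add: gh nat_pow_mult)
    from slope_lower[OF m_closed[OF g h] this q]
    have 1: "real (p + r) / real q \<le> slope (g \<otimes> h)" .
    have "(g \<otimes> h) [^] q \<unlhd> u [^] (Suc p + Suc r)"
      using below_add[OF p(2) r(2)] nat_pow_mult[OF u_closed, of "Suc p" "Suc r"] by (simp add: gh)
    from slope_upper[OF m_closed[OF g h] this q]
    have 2: "slope (g \<otimes> h) \<le> real (Suc p + Suc r) / real q" .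
    define a b c where "a = real p / real q" and "b = real r / real q" and "c = 1 / real q"
    have "a \<le> slope g" "slope g \<le> a + c" "b \<le> slope h" "slope h \<le> b + c"
      using slope_lower[OF g p(1) q] slope_upper[OF g p(2) q] slope_lower[OF h r(1) q] slope_upper[OF h r(2) q]
      by (simp_all add: a_def b_def c_def add_divide_distrib)
    moreover have "a + b \<le> slope (g \<otimes> h)" "slope (g \<otimes> h) \<le> a + b + 2 * c"
      using 1 2 by (simp_all add: a_def b_def c_def add_divide_distrib)
    ultimately have "\<bar>slope (g \<otimes> h) - (slope g + slope h)\<bar> \<le> 2 * c" by linarith
    then show ?thesis by (simp add: c_def)
  qed
  then have "\<exists>N. \<forall>q\<ge>N. \<bar>slope (g \<otimes> h) - (slope g + slope h)\<bar> \<le> 2 * inverse (real q)"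
    by (intro exI[of _ 1]) (simp add: divide_inverse)
  moreover have "(\<lambda>q. 2 * inverse (real q)) \<longlonglongrightarrow> 2 * 0" by (intro tendsto_intros lim_inverse_n)
  ultimately have "\<bar>slope (g \<otimes> h) - (slope g + slope h)\<bar> \<le> 2 * 0" by (rule LIMSEQ_le_const[rotated])
  then show ?thesis by simp
qed

lemma slope_nonneg: "h \<in> carrier H \<Longrightarrow> slope h \<ge> 0"
  using slope_lower[of h 0 1] one_below by simp

lemma slope_ideal: "i \<in> I \<Longrightarrow> slope i = 0"
proof -
  assume i: "i \<in> I"
  then have "i \<unlhd> \<one>" using ideal_closed monus_one by (simp add: below_def)
  then show "slope i = 0" using slope_upper[of i 1 0] slope_nonneg[of i] ideal_closed[OF i] by simp
qed

text \<open>Divisibility and additivity give \<open>slope g + slope (h \<setminus> g) = slope h +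
  slope (g \<setminus> h)\<close>, and by \<open>prime\<close> one of the two differences has slope
  0.\<close>

lemma slope_monus:
  assumes g: "g \<in> carrier H" and h: "h \<in> carrier H"
  shows "slope (g \<setminus> h) = max 0 (slope g - slope h)"
proof -
  have c: "g \<setminus> h \<in> carrier H" "h \<setminus> g \<in> carrier H" using g h monus_closed by auto
  have "slope (g \<otimes> (h \<setminus> g)) = slope (h \<otimes> (g \<setminus> h))" using divisibility[OF g h] by simp
  then have "slope g + slope (h \<setminus> g) = slope h + slope (g \<setminus> h)" using slope_add g h c by simp
  then show ?thesis using prime[OF g h] slope_ideal slope_nonneg[OF c(1)] slope_nonneg[OF c(2)] by fastforce
qed

lemma slope_unit: "slope u = 1"
proof -
  have "u [^] (1::nat) \<unlhd> u [^] (1::nat)" using le_imp_below le_refl u_closed by simp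
  then show ?thesis using slope_lower[OF u_closed, of 1 1] slope_upper[OF u_closed, of 1 1] by simp
qed

lemma slope_hom: "slope \<in> hoop_hom H real_hoop"
  using slope_add slope_monus slope_nonneg slope_ideal[OF ideal_one]
  by (auto simp: hoop_hom_def hom_def)

end

text \<open>If \<open>u\<close> were \<open>\<one>\<close>, every element would lie below
  \<open>\<one>\<close>; so nontriviality supplies an ideal avoiding \<open>u\<close>.\<close>

lemma (in cancellative_hoop) ex_hom_unit_1:
  assumes unit: "hoop_unit H u" and nontrivial: "carrier H \<noteq> {\<one>}"
  shows "\<exists>e\<in>hoop_hom H real_hoop. e u = 1"
proof -
  have u: "u \<in> carrier H" using unit by (simp add: hoop_unit_def)
  have "u \<noteq> \<one>"
  proof
    assume u1: "u = \<one>"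
    have "h = \<one>" if h: "h \<in> carrier H" for h
    proof -
      obtain k :: nat where "h \<preceq> u [^] k" using unit h by (auto simp: hoop_unit_def)
      then show ?thesis using h by (simp add: u1 le_one_iff)
    qed
    then show False using nontrivial one_closed by blast
  qed
  then obtain I where "hoop_ideal I" "u \<notin> I" "\<And>J. hoop_ideal J \<Longrightarrow> u \<notin> J \<Longrightarrow> I \<subseteq> J \<Longrightarrow> J = I"
    using maximal_ideal_exists[OF u] by blast
  then interpret maximal_hoop_ideal H u I using unit by unfold_locales auto
  show ?thesis using slope_hom slope_unit by blast
qed

section \<open>The mean of the discrete states\<close>

text \<open>The rank \<open>\<kappa>\<close> puts smaller denominators first and numbers each finite
  level arbitrarily. Listing the ranks increasingly treats finite and infinite \<open>D\<close>
  alike.\<close>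

lemma ex_monotone_enumeration:
  fixes den :: "'s \<Rightarrow> nat"
  assumes fin: "\<And>T. finite {x \<in> D. den x \<le> T}"
  shows "\<exists>e. bij_betw e (index_set D) D \<and> mono_on (index_set D) (\<lambda>t. den (e t))"
proof -
  define g where "g b = (SOME f. bij_betw f {x \<in> D. den x = b} {0..<card {x \<in> D. den x = b}})" for b
  have level: "finite {x \<in> D. den x = b}" for b by (rule finite_subset[OF _ fin[of b]]) auto
  have lt: "finite {x \<in> D. den x < b}" for b by (rule finite_subset[OF _ fin[of b]]) auto
  have g: "bij_betw (g b) {x \<in> D. den x = b} {0..<card {x \<in> D. den x = b}}" for b
    unfolding g_def by (rule someI_ex[OF ex_bij_betw_finite_nat[OF level]])
  define \<kappa> where "\<kappa> x = card {y \<in> D. den y < den x} + g (den x) x" for x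
  have less: "\<kappa> x < \<kappa> y" if "x \<in> D" "y \<in> D" "den x < den y" for x y
  proof -
    have "g (den x) x < card {y \<in> D. den y = den x}"
      using bij_betwE[OF g[of "den x"]] that(1) by auto
    then have "\<kappa> x < card {y \<in> D. den y < den x} + card {y \<in> D. den y = den x}" by (simp add: \<kappa>_def)
    also have "\<dots> = card ({y \<in> D. den y < den x} \<union> {y \<in> D. den y = den x})"
      by (rule card_Un_disjoint[symmetric]) (use level lt in auto)
    also have "\<dots> \<le> card {z \<in> D. den z < den y}" using lt that(3) by (intro card_mono) auto
    also have "\<dots> \<le> \<kappa> y" by (simp add: \<kappa>_def)
    finally show ?thesis .
  qed
  have inj: "inj_on \<kappa> D"
  proof (rule inj_onI)
    fix x y assume xy: "x \<in> D" "y \<in> D" "\<kappa> x = \<kappa> y"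
    then have eq: "den x = den y" using less[of x y] less[of y x] by (metis less_irrefl linorder_neqE_nat)
    then have "g (den x) x = g (den x) y" using xy(3) by (simp add: \<kappa>_def)
    then show "x = y" using g[of "den x"] xy(1,2) eq by (auto simp: bij_betw_def dest: inj_onD)
  qed
  define J where "J = (if finite D then {..<card D} else UNIV)"
  have "\<exists>h. bij_betw h J (\<kappa> ` D) \<and> strict_mono_on J h"
  proof (cases "finite D")
    case True
    then obtain h where "bij_betw h {..<card (\<kappa> ` D)} (\<kappa> ` D)" "strict_mono_on {..<card (\<kappa> ` D)} h"
      using ex_bij_betw_strict_mono_card[of "\<kappa> ` D"] by blast
    then show ?thesis using True card_image[OF inj] by (auto simp: J_def)
  next
    case False
    then have "infinite (\<kappa> ` D)" using inj finite_image_iff by blast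
    then show ?thesis using bij_enumerate[of "\<kappa> ` D"] False
      by (auto simp: J_def strict_mono_on_def intro!: exI[of _ "enumerate (\<kappa> ` D)"])
  qed
  then obtain h where h: "bij_betw h J (\<kappa> ` D)" "strict_mono_on J h" by blast
  \<comment> \<open>\<open>index_set\<close> starts at 1, whereas the listing of ranks starts at
    0.\<close>
  have shift: "bij_betw (\<lambda>t. t - 1) (index_set D) J"
    by (rule bij_betw_byWitness[where f' = Suc]) (auto simp: index_set_def J_def)
  define e where "e t = inv_into D \<kappa> (h (t - 1))" for t
  have "bij_betw (inv_into D \<kappa> \<circ> (h \<circ> (\<lambda>t. t - 1))) (index_set D) D"
    by (intro bij_betw_trans[OF bij_betw_trans[OF shift h(1)]] bij_betw_inv_into)
      (use inj in \<open>simp add: bij_betw_def\<close>)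
  then have bij: "bij_betw e (index_set D) D" by (simp add: e_def[abs_def] comp_def)
  have \<kappa>e: "\<kappa> (e t) = h (t - 1)" if "t \<in> index_set D" for t
    unfolding e_def using bij_betwE[OF h(1)] bij_betwE[OF shift] that by (intro f_inv_into_f) auto
  have "den (e s) \<le> den (e t)" if st: "s \<in> index_set D" "t \<in> index_set D" "s \<le> t" for s t
  proof (rule ccontr)
    assume "\<not> den (e s) \<le> den (e t)"
    then have "\<kappa> (e t) < \<kappa> (e s)" using less bij_betwE[OF bij] st by auto
    then have "h (t - 1) < h (s - 1)" using \<kappa>e st by simp
    moreover have "h (s - 1) \<le> h (t - 1)"
      using h(2) bij_betwE[OF shift] st by (metis diff_le_mono le_eq_less_or_eq less_imp_le strict_mono_onD)
    ultimately show False by simp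
  qed
  then show ?thesis using bij by (auto intro!: exI[of _ e] mono_onI)
qed

context unital_presented_hoop
begin

abbreviation D :: "('a \<Rightarrow> real) set" where "D \<equiv> discrete_states H u"

text \<open>\<open>U\<close> vanishes at the origin, so the point of a homomorphism normalised at
  \<open>u\<close> is a different one.\<close>

lemma nonzero_solution:
  assumes "carrier H \<noteq> {\<one>}" shows "\<exists>x\<in>W. x \<noteq> (\<lambda>_. 0)"
proof -
  obtain e where e: "e \<in> hoop_hom H real_hoop" "e u = 1" using ex_hom_unit_1[OF unit assms] by blast
  have "U (state_point e) = 1" using hom_eval_point[OF e(1) \<upsilon>(1)] e(2) by (simp add: \<upsilon>(2))
  moreover have "U (\<lambda>_. 0) = 0" using eval_term_scale[of 0 "\<lambda>_. 0" \<upsilon>] by simp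
  ultimately have "state_point e \<noteq> (\<lambda>_. 0)" by auto
  then show ?thesis using state_point_in_W[OF e(1)] by blast
qed

lemma cone_decomposition_exists:
  assumes "carrier H \<noteq> {\<one>}" "vars t \<subseteq> {..<n}"
  shows "\<exists>\<V> K. cone_decomposition W \<V> n U (\<lambda>x. eval_term x t) K"
proof -
  obtain \<V> where V: "cone_partition W \<V>" "\<And>V. V \<in> \<V> \<Longrightarrow> linear_on n \<upsilon> (open_cone V) \<and> linear_on n t (open_cone V)"
    using solution_set_partition_linear[OF finite_relations relation_vars \<upsilon>(1) assms(2)] by blast
  obtain K where K: "K > 0" "\<forall>x\<in>W. \<forall>i. x i \<le> K * U x" using coordinate_bound by blast
  have "cone_decomposition W \<V> n U (\<lambda>x. eval_term x t) K"
    by unfold_locales (use V K nonzero_solution[OF assms(1)] in \<open>auto simp: linear_on_def\<close>)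
  then show ?thesis by blast
qed

text \<open>\<open>U p\<close> is the denominator of the state of \<open>p\<close>; this transports
  the counts of primitive points to discrete states.\<close>

lemma denominator_level:
  "{e \<in> D. denominator H e \<le> T} = state_of ` primitive_points W U T"
proof (intro equalityI subsetI)
  fix e assume e: "e \<in> {e \<in> D. denominator H e \<le> T}"
  then obtain p where p: "p \<in> W" "primitive p" "e = state_of p"
    using state_of_bij by (auto simp: bij_betw_def)
  then show "e \<in> state_of ` primitive_points W U T"
    using e state_of_discrete(2)[OF p(1,2)] by (auto simp: primitive_points_def)
qed (use state_of_discrete in \<open>auto simp: primitive_points_def\<close>)

lemma state_of_inj: "inj_on state_of (primitive_points W U T)"
  using state_of_bij by (auto simp: bij_betw_def primitive_points_def intro: inj_on_subset)

lemma finite_denominator_level: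
  assumes "carrier H \<noteq> {\<one>}" shows "finite {e \<in> D. denominator H e \<le> T}"
proof -
  obtain \<V> K where "cone_decomposition W \<V> n U (\<lambda>x. eval_term x \<upsilon>) K"
    using cone_decomposition_exists[OF assms \<upsilon>(1)] by blast
  then interpret cone_decomposition W \<V> n U "\<lambda>x. eval_term x \<upsilon>" K .
  have "primitive_points W U T \<subseteq> natural_points W U T"
    using primitive_nonzero by (auto simp: primitive_points_def natural_points_def) (auto simp: primitive_def)
  then have "finite (primitive_points W U T)" using finite_natural_points finite_subset by blast
  then show ?thesis by (simp add: denominator_level)
qed

lemma discrete_states_nonempty:
  assumes "carrier H \<noteq> {\<one>}" shows "D \<noteq> {}"
proof -
  obtain \<V> K where "cone_decomposition W \<V> n U (\<lambda>x. eval_term x \<upsilon>) K"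
    using cone_decomposition_exists[OF assms \<upsilon>(1)] by blast
  then interpret cone_decomposition W \<V> n U "\<lambda>x. eval_term x \<upsilon>" K .
  obtain p where "p \<in> W" "primitive p" using primitive_exists solution_set_scale by (metis less_imp_le)
  then show ?thesis using state_of_discrete(1) by blast
qed

lemma ex_denominator_enumeration:
  "carrier H \<noteq> {\<one>} \<Longrightarrow> \<exists>e. denominator_enumeration H u e"
  unfolding denominator_enumeration_def by (rule ex_monotone_enumeration) (rule finite_denominator_level)

text \<open>In the infinite case the value \<open>L / C\<close> comes from counts over
  \<open>W\<close> that precede any enumeration, in the finite case it is the plain average; the
  order of the quantifiers records independence of \<open>e\<close>.\<close>

lemma mean_exists:
  assumes nontrivial: "carrier H \<noteq> {\<one>}" and h: "h \<in> carrier H"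
  shows "\<exists>l. \<forall>e. denominator_enumeration H u e \<longrightarrow> has_mean H u e h l"
proof (cases "finite D")
  case True
  have "has_mean H u e h ((\<Sum>x\<in>D. x h) / real (card D))" if "denominator_enumeration H u e" for e
  proof -
    have "bij_betw e {1..card D} D" using that True by (simp add: denominator_enumeration_def index_set_def)
    from sum.reindex_bij_betw[OF this, of "\<lambda>x. x h"] True show ?thesis by (simp add: has_mean_def)
  qed
  then show ?thesis by blast
next
  case False
  have nonneg: "e h \<ge> 0" if "e \<in> D" for e
    using that h by (auto simp: discrete_states_def extremal_states_def hoop_hom_def hom_def)
  obtain t where t: "vars t \<subseteq> {..<n}" "h = \<pi> t" using ex_term[OF h] by blast
  obtain \<V> K where "cone_decomposition W \<V> n U (\<lambda>x. eval_term x t) K"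
    using cone_decomposition_exists[OF nontrivial t(1)] by blast
  then interpret cone_decomposition W \<V> n U "\<lambda>x. eval_term x t" K .
  have inf: "infinite {p \<in> W. primitive p}" using False bij_betw_finite[OF state_of_bij] by simp
  have "\<exists>d L C. C > 0 \<and> (\<lambda>T. real (card (primitive_points W U T)) / real T ^ d) \<longlonglongrightarrow> C
    \<and> (\<lambda>T. (\<Sum>p\<in>primitive_points W U T. eval_term p t / U p) / real T ^ d) \<longlonglongrightarrow> L"
    by (rule primitive_asymp[OF _ _ inf])
      (simp_all add: solution_set_scale eval_term_scale eval_term_nonneg W_nonneg)
  then obtain d L C where C: "C > 0" "(\<lambda>T. real (card (primitive_points W U T)) / real T ^ d) \<longlonglongrightarrow> C"
    and L: "(\<lambda>T. (\<Sum>p\<in>primitive_points W U T. eval_term p t / U p) / real T ^ d) \<longlonglongrightarrow> L"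
    by blast
  have card: "card {e \<in> D. denominator H e \<le> T} = card (primitive_points W U T)" for T
    unfolding denominator_level by (rule card_image[OF state_of_inj])
  have sum: "(\<Sum>e | e \<in> D \<and> denominator H e \<le> T. e h) = (\<Sum>p\<in>primitive_points W U T. eval_term p t / U p)" for T
    unfolding denominator_level sum.reindex[OF state_of_inj]
    by (intro sum.cong) (auto simp: primitive_points_def t(2) state_of_map[OF _ t(1)])
  have "has_mean H u e h (L / C)" if e: "denominator_enumeration H u e" for e
  proof -
    have "bij_betw e {1..} D" "mono_on {1..} (\<lambda>t. denominator H (e t))"
      using e False by (simp_all add: denominator_enumeration_def index_set_def)
    then have "(\<lambda>k. (\<Sum>t=1..k. e t h) / real k) \<longlonglongrightarrow> L / C"
      by (intro cesaro_mean_by_levels[where D = D and den = "denominator H" and F = "\<lambda>e. e h" and d = d])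
        (use C L card sum nonneg finite_denominator_level[OF nontrivial] in \<open>auto simp: mono_on_def\<close>)
    then show ?thesis using False by (simp add: has_mean_def)
  qed
  then show ?thesis by blast
qed

lemma has_mean_unique: "has_mean H u e h l \<Longrightarrow> has_mean H u e h l' \<Longrightarrow> l = l'"
  by (auto simp: has_mean_def split: if_splits intro: LIMSEQ_unique)

lemma has_mean_add:
  assumes e: "denominator_enumeration H u e" and gh: "g \<in> carrier H" "h \<in> carrier H"
    and mean: "has_mean H u e g a" "has_mean H u e h b"
  shows "has_mean H u e (g \<otimes> h) (a + b)"
proof -
  have add: "e t (g \<otimes> h) = e t g + e t h" if "t \<in> index_set D" for t
  proof -
    have "e t \<in> D" using e that by (auto simp: denominator_enumeration_def bij_betw_def)
    then show ?thesis using gh by (auto simp: discrete_states_def extremal_states_def hoop_hom_def hom_def)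
  qed
  have sum: "(\<Sum>t=1..k. e t (g \<otimes> h)) = (\<Sum>t=1..k. e t g) + (\<Sum>t=1..k. e t h)" if "{1..k} \<subseteq> index_set D" for k
    unfolding sum.distrib[symmetric] using that by (intro sum.cong refl add) auto
  show ?thesis
  proof (cases "finite D")
    case True
    then show ?thesis using mean sum[of "card D"] by (simp add: has_mean_def index_set_def add_divide_distrib)
  next
    case False
    then have "(\<Sum>t=1..k. e t (g \<otimes> h)) / real k = (\<Sum>t=1..k. e t g) / real k + (\<Sum>t=1..k. e t h) / real k" for k
      using sum[of k] by (auto simp: index_set_def add_divide_distrib)
    then show ?thesis using mean False by (auto simp: has_mean_def intro: tendsto_add)
  qed
qed

text \<open>Meant for \<open>\<one>\<close>, where all states are 0, and for \<open>u\<close>, where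
  they are 1. In the finite case the average needs a nonempty \<open>D\<close>.\<close>

lemma has_mean_const:
  assumes e: "denominator_enumeration H u e" and nontrivial: "carrier H \<noteq> {\<one>}"
    and c: "\<And>x. x \<in> D \<Longrightarrow> x h = c"
  shows "has_mean H u e h c"
proof -
  have "e t h = c" if "t \<in> index_set D" for t
    using e that c by (auto simp: denominator_enumeration_def bij_betw_def)
  then have sum: "(\<Sum>t=1..k. e t h) = real k * c" if "{1..k} \<subseteq> index_set D" for k
    using that by (simp add: subset_iff)
  show ?thesis
  proof (cases "finite D")
    case True
    then have "card D \<noteq> 0" "D \<noteq> {}" using discrete_states_nonempty[OF nontrivial] by simp_all
    then show ?thesis using True sum[of "card D"] by (simp add: has_mean_def index_set_def)
  next
    case False
    have "(\<lambda>k. (\<Sum>t=1..k. e t h) / real k) \<longlonglongrightarrow> c"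
      by (rule tendsto_eventually, rule eventually_sequentiallyI[of 1])
        (use False sum in \<open>auto simp: index_set_def\<close>)
    then show ?thesis using False by (simp add: has_mean_def)
  qed
qed

lemma has_mean_nonneg:
  assumes e: "denominator_enumeration H u e" and h: "h \<in> carrier H" and mean: "has_mean H u e h l"
  shows "l \<ge> 0"
proof -
  have nonneg: "e t h \<ge> 0" if "t \<in> index_set D" for t
  proof -
    have "e t \<in> D" using e that by (auto simp: denominator_enumeration_def bij_betw_def)
    then show ?thesis using h by (auto simp: discrete_states_def extremal_states_def hoop_hom_def hom_def)
  qed
  have sum: "(\<Sum>t=1..k. e t h) / real k \<ge> 0" if "{1..k} \<subseteq> index_set D" for k
    using that nonneg by (intro divide_nonneg_nonneg sum_nonneg) auto
  show ?thesis
  proof (cases "finite D")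
    case True
    then show ?thesis using mean sum[of "card D"] by (simp add: has_mean_def index_set_def)
  next
    case False
    then have "(\<lambda>k. (\<Sum>t=1..k. e t h) / real k) \<longlonglongrightarrow> l" using mean by (simp add: has_mean_def)
    then show ?thesis by (rule LIMSEQ_le_const) (use False sum in \<open>auto simp: index_set_def\<close>)
  qed
qed

end

section \<open>Automorphisms acting on states\<close>

lemma hoop_iso_inv:
  assumes H: "cancellative_hoop H" and \<sigma>: "\<sigma> \<in> hoop_iso H H"
  shows "inv_into (carrier H) \<sigma> \<in> hoop_iso H H"
proof -
  interpret cancellative_hoop H by (rule H)
  define \<tau> where "\<tau> = inv_into (carrier H) \<sigma>"
  have bij: "bij_betw \<sigma> (carrier H) (carrier H)" using \<sigma> by (simp add: hoop_iso_def)
  have hom: "\<And>x y. x \<in> carrier H \<Longrightarrow> y \<in> carrier H \<Longrightarrow> \<sigma> (x \<otimes>\<^bsub>H\<^esub> y) = \<sigma> x \<otimes>\<^bsub>H\<^esub> \<sigma> y"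
    "\<And>x y. x \<in> carrier H \<Longrightarrow> y \<in> carrier H \<Longrightarrow> \<sigma> (x \<setminus>\<^bsub>H\<^esub> y) = \<sigma> x \<setminus>\<^bsub>H\<^esub> \<sigma> y" "\<sigma> \<one>\<^bsub>H\<^esub> = \<one>\<^bsub>H\<^esub>"
    using \<sigma> by (auto simp: hoop_iso_def hoop_hom_def hom_def)
  have \<tau>bij: "bij_betw \<tau> (carrier H) (carrier H)" unfolding \<tau>_def by (rule bij_betw_inv_into[OF bij])
  have \<tau>: "\<tau> x \<in> carrier H" "\<sigma> (\<tau> x) = x" if "x \<in> carrier H" for x
    using bij_betwE[OF \<tau>bij] that bij_betw_inv_into_right[OF bij that] by (auto simp: \<tau>_def)
  have \<tau>eq: "\<tau> (\<sigma> x) = x" if "x \<in> carrier H" for x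
    unfolding \<tau>_def by (rule bij_betw_inv_into_left[OF bij that])
  have "\<tau> (x \<otimes>\<^bsub>H\<^esub> y) = \<tau> x \<otimes>\<^bsub>H\<^esub> \<tau> y" if "x \<in> carrier H" "y \<in> carrier H" for x y
    using \<tau>eq[of "\<tau> x \<otimes>\<^bsub>H\<^esub> \<tau> y"] hom(1)[of "\<tau> x" "\<tau> y"] \<tau> that by simp
  moreover have "\<tau> (x \<setminus>\<^bsub>H\<^esub> y) = \<tau> x \<setminus>\<^bsub>H\<^esub> \<tau> y" if "x \<in> carrier H" "y \<in> carrier H" for x y
    using \<tau>eq[of "\<tau> x \<setminus>\<^bsub>H\<^esub> \<tau> y"] hom(2)[of "\<tau> x" "\<tau> y"] \<tau> that monus_closed by simp
  moreover have "\<tau> \<one>\<^bsub>H\<^esub> = \<one>\<^bsub>H\<^esub>" using \<tau>eq[of "\<one>\<^bsub>H\<^esub>"] hom(3) by simp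
  ultimately show ?thesis using \<tau>bij \<tau>(1) by (auto simp: hoop_iso_def hoop_hom_def hom_def \<tau>_def)
qed

text \<open>Restricted to the carrier because states are extensional.\<close>

definition pullback_state :: "('a, 'b) hoop_scheme \<Rightarrow> ('a \<Rightarrow> 'a) \<Rightarrow> ('a \<Rightarrow> real) \<Rightarrow> 'a \<Rightarrow> real" where
  "pullback_state H \<sigma> x = restrict (\<lambda>h. x (\<sigma> h)) (carrier H)"

lemma pullback_state_image:
  assumes "\<sigma> \<in> hoop_iso H H" shows "pullback_state H \<sigma> x ` carrier H = x ` carrier H"
proof -
  have "pullback_state H \<sigma> x ` carrier H = x ` (\<sigma> ` carrier H)" by (auto simp: pullback_state_def)
  then show ?thesis using assms by (simp add: hoop_iso_def bij_betw_def)
qed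

lemma pullback_state_discrete:
  assumes H: "cancellative_hoop H" and u: "u \<in> carrier H"
    and \<sigma>: "\<sigma> \<in> hoop_iso H H" "\<sigma> u = u" and x: "x \<in> discrete_states H u"
  shows "pullback_state H \<sigma> x \<in> discrete_states H u"
proof -
  interpret cancellative_hoop H by (rule H)
  have \<sigma>c: "\<sigma> h \<in> carrier H" if "h \<in> carrier H" for h
    using \<sigma>(1) that by (auto simp: hoop_iso_def hoop_hom_def hom_def)
  have "discrete (pullback_state H \<sigma> x ` carrier H)"
    using x by (simp add: pullback_state_image[OF \<sigma>(1)] discrete_states_def)
  moreover have "pullback_state H \<sigma> x \<in> hoop_hom H real_hoop"
    using x \<sigma>(1) \<sigma>c monus_closed
    by (auto simp: pullback_state_def discrete_states_def extremal_states_def hoop_hom_def hoop_iso_def hom_def)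
  moreover have "pullback_state H \<sigma> x u = 1"
    using x u \<sigma>(2) by (simp add: pullback_state_def discrete_states_def extremal_states_def states_def)
  ultimately show ?thesis
    by (auto simp: discrete_states_def extremal_states_def states_def hoop_hom_def) (simp add: pullback_state_def)
qed

text \<open>Pulling back along the inverse automorphism undoes the pullback along \<sigma>, so
  discrete states are permuted. Denominators depend only on the image of a state, which does not
  change.\<close>

lemma pullback_state_enumeration:
  assumes H: "cancellative_hoop H" and u: "u \<in> carrier H"
    and \<sigma>: "\<sigma> \<in> hoop_iso H H" "\<sigma> u = u" and e: "denominator_enumeration H u e"
  shows "denominator_enumeration H u (\<lambda>t. pullback_state H \<sigma> (e t))"
proof -
  define \<tau> where "\<tau> = inv_into (carrier H) \<sigma>"
  have bij: "bij_betw \<sigma> (carrier H) (carrier H)" using \<sigma> by (simp add: hoop_iso_def)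
  have \<tau>: "\<tau> \<in> hoop_iso H H" unfolding \<tau>_def by (rule hoop_iso_inv[OF H \<sigma>(1)])
  have \<tau>\<sigma>: "\<tau> (\<sigma> x) = x" "\<sigma> (\<tau> x) = x" "\<tau> x \<in> carrier H" "\<sigma> x \<in> carrier H" if "x \<in> carrier H" for x
    using bij_betw_inv_into_left[OF bij that] bij_betw_inv_into_right[OF bij that]
      bij_betwE[OF bij_betw_inv_into[OF bij]] bij_betwE[OF bij] that by (auto simp: \<tau>_def)
  have \<tau>u: "\<tau> u = u" using \<tau>\<sigma>(1)[OF u] \<sigma>(2) by simp
  have ext: "x \<in> extensional (carrier H)" if "x \<in> discrete_states H u" for x
    using that by (simp add: discrete_states_def extremal_states_def states_def)
  have inv: "pullback_state H \<tau> (pullback_state H \<sigma> x) = x" "pullback_state H \<sigma> (pullback_state H \<tau> x) = x"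
    if "x \<in> discrete_states H u" for x
    using ext[OF that] \<tau>\<sigma> by (auto simp: pullback_state_def extensional_def fun_eq_iff)
  have "bij_betw (pullback_state H \<sigma>) (discrete_states H u) (discrete_states H u)"
    by (rule bij_betw_byWitness[where f' = "pullback_state H \<tau>"])
      (use inv pullback_state_discrete[OF H u \<sigma>] pullback_state_discrete[OF H u \<tau> \<tau>u] in auto)
  then have "bij_betw (pullback_state H \<sigma> \<circ> e) (index_set (discrete_states H u)) (discrete_states H u)"
    using e bij_betw_trans unfolding denominator_enumeration_def by blast
  moreover have "denominator H (pullback_state H \<sigma> x) = denominator H x" for x
    by (simp add: denominator_def pullback_state_image[OF \<sigma>(1)])
  ultimately show ?thesis using e by (simp add: denominator_enumeration_def comp_def)
qed

text \<open>If the carrier were trivial, \<open>u\<close> would be the neutral element and a state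
  would have to take both values 0 and 1 there. The first conjunct keeps the statement about all
  enumerations from being vacuous.\<close>

theorem theorem4p2:
  fixes H :: "('a, 'b) hoop_scheme" and u :: 'a
  assumes "cancellative_hoop H"
    and "finitely_presented H"
    and "hoop_unit H u"
    and nontrivial: "carrier H \<noteq> {\<one>\<^bsub>H\<^esub>}"
  shows "(\<exists>e. denominator_enumeration H u e) \<and>
    (\<exists>m. m \<in> states H u \<and> automorphism_invariant H u m \<and>
       (\<forall>e. denominator_enumeration H u e \<longrightarrow> (\<forall>h\<in>carrier H. has_mean H u e h (m h))))"
proof -
  interpret cancellative_hoop H by (rule assms(1))
  obtain n R \<pi> where "presented_hoop H n R \<pi>"
    using finitely_presented_imp_presented_hoop[OF assms(2)] by blast
  then interpret presented_hoop H n R \<pi> .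
  have u: "u \<in> carrier H" using assms(3) by (simp add: hoop_unit_def)
  have "u \<in> \<pi> ` {t. vars t \<subseteq> {..<n}}" using u onto by simp
  then obtain \<upsilon> where \<upsilon>: "vars \<upsilon> \<subseteq> {..<n}" "\<pi> \<upsilon> = u" by blast
  interpret unital_presented_hoop H n R \<pi> u \<upsilon> by unfold_locales (use assms(3) \<upsilon> in auto)
  obtain L where L: "\<And>h e. h \<in> carrier H \<Longrightarrow> denominator_enumeration H u e \<Longrightarrow> has_mean H u e h (L h)"
    using mean_exists[OF nontrivial] by metis
  obtain e where e: "denominator_enumeration H u e" using ex_denominator_enumeration[OF nontrivial] by blast
  define m where "m = restrict L (carrier H)"
  have m: "has_mean H u e h (m h)" if "h \<in> carrier H" "denominator_enumeration H u e" for h e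
    using L[OF that] that(1) by (simp add: m_def)
  have "m \<in> states H u"
  proof -
    have "m (g \<otimes>\<^bsub>H\<^esub> h) = m g + m h" if "g \<in> carrier H" "h \<in> carrier H" for g h
      using has_mean_unique[OF m[OF m_closed[OF that] e] has_mean_add[OF e that m[OF that(1) e] m[OF that(2) e]]] .
    moreover have "m h \<ge> 0" if "h \<in> carrier H" for h using has_mean_nonneg[OF e that m[OF that e]] .
    moreover have "m \<one>\<^bsub>H\<^esub> = 0"
      by (rule has_mean_unique[OF m[OF one_closed e] has_mean_const[OF e nontrivial]])
        (simp add: discrete_states_def extremal_states_def states_def)
    moreover have "m u = 1"
      by (rule has_mean_unique[OF m[OF u e] has_mean_const[OF e nontrivial]])
        (simp add: discrete_states_def extremal_states_def states_def)
    ultimately show ?thesis by (auto simp: states_def hom_def m_def)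
  qed
  moreover have "automorphism_invariant H u m"
    unfolding automorphism_invariant_def
  proof (intro ballI impI)
    fix \<sigma> h assume \<sigma>: "\<sigma> \<in> hoop_iso H H" "\<sigma> u = u" and h: "h \<in> carrier H"
    have \<sigma>h: "\<sigma> h \<in> carrier H" using \<sigma>(1) h by (auto simp: hoop_iso_def hoop_hom_def hom_def)
    have "has_mean H u (\<lambda>t. pullback_state H \<sigma> (e t)) h (m h)"
      by (rule m[OF h pullback_state_enumeration[OF assms(1) u \<sigma> e]])
    \<comment> \<open>Averaging the pulled-back states at \<open>h\<close> is averaging the original
      ones at \<open>\<sigma> h\<close>; independence of the enumeration identifies the former with
      \<open>m h\<close>.\<close>
    moreover have "has_mean H u (\<lambda>t. pullback_state H \<sigma> (e t)) h = has_mean H u e (\<sigma> h)"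
      using h by (simp add: has_mean_def pullback_state_def fun_eq_iff)
    ultimately have "has_mean H u e (\<sigma> h) (m h)" by simp
    then show "m (\<sigma> h) = m h" by (rule has_mean_unique[OF m[OF \<sigma>h e]])
  qed
  ultimately show ?thesis using e m by blast
qed

end
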